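(* Let $X$ be a radiant toric variety. The derived length of $U_{\max}$ equals the minimal number $k$ such that $$\underbrace{\Big(\cdots\big((\mathfrak R^+)^{\uparrow1}\big)^{\uparrow1}\cdots\Big)^{\uparrow1}}_{k\text{ times}}=\emptyset.$$
   Context: $\mathbb K$ is an algebraically closed field of characteristic zero. $X$ is a complete toric variety of dimension $n$ with acting torus $T$; $N\cong\mathbb Z^n$ is the lattice of one-parameter subgroups of $T$, $M=\mathrm{Hom}(N,\mathbb Z)$, $\langle\cdot,\cdot\rangle$ is the pairing, $\Sigma$ is the fan of $X$, with rays having primitive generators $p_1,\dots,p_m$. $\mathrm{Aut}(X)$ is a linear algebraic group with maximal torus $T$. $X$ is radiant if a maximal unipotent subgroup of $\mathrm{Aut}(X)$ acts on $X$ with an open orbit; it is known that this holds iff $\Sigma$ is bilateral, i.e. up to renumbering $p_1,\dots,p_n$ is a basis of $N$ and $p_k=-\sum_{j=1}^n a_{kj}p_j$ with $a_{kj}\in\mathbb Z_{\ge0}$ for $n<k\le m$. Fix such a numbering; $q_1,\dots,q_n$ is the dual basis of $M$ and $C=\{1,\dots,n\}$. Demazure roots: $\mathfrak R_i=\{e\in M:\langle e,p_i\rangle=-1,\ \langle e,p_s\rangle\ge0\ \forall s\ne i\}$, $\mathfrak R=\bigsqcup_{i=1}^m\mathfrak R_i$; $\mathfrak S=\mathfrak R\cap(-\mathfrak R)$, $\mathfrak U=\mathfrak R\setminus\mathfrak S$. Root subgroups: the Cox ring of $X$ is $\mathbb K[x_1,\dots,x_m]$, graded by $\mathrm{Cl}(X)$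 with $\deg x_l=[D_l]$, the class of the $T$-invariant prime divisor of the $l$-th ray. For $e\in\mathfrak R_i$ let $\partial_e=\big(\prod_{s\ne i}x_s^{\langle e,p_s\rangle}\big)\frac{\partial}{\partial x_i}$, a homogeneous locally nilpotent derivation; the graded automorphisms $\exp(\alpha\partial_e)$, $\alpha\in\mathbb K$, descend to a one-parameter unipotent subgroup $U_e\subseteq\mathrm{Aut}(X)$ through the Cox quotient construction of $X$. Preorder on $C$: $i\succeq j$ iff $a_{ki}\ge a_{kj}$ for all $n<k\le m$; $i\asymp j$ iff equality holds for all such $k$. The numbering is chosen so that the $\asymp$-classes $C_1,\dots,C_r$ satisfy: $C_l\succ C_s$ implies $l<s$, and $C_s=\{c_{s-1}+1,\dots,c_s\}$ for some $0=c_0<c_1<\dots<c_r=n$. Fix $v\in N$ with $\langle q_1,v\rangle<\dots<\langle q_n,v\rangle<0$; put $\mathfrak R^+=\{e\in\mathfrak S:\langle e,v\rangle>0\}\sqcup\mathfrak U$ and let $U_{\max}$ be the subgroup generated by all $U_e$, $e\in\mathfrak R^+$; it is a maximal unipotent subgroup of $\mathrm{Aut}(X)$, and $\mathfrak R^+$ is exactly the set of $e\in\mathfrak R$ with $U_e\subseteq U_{\max}$. For a set of roots $\mathfrak M\subseteq\mathfrak R^+$ that is the set of all roots $e$ with $U_e\subseteq U$ for some $T$-normalized algebraic subgroup $U\subseteq U_{\max}$, $\Gamma(\mathfrak M)$ is the directed graph with vertex set $\mathfrak M$ and an arrow $a\to b$ iff $b=a+e$ for some $e\in\mathfrak M$,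 and $\mathfrak M^{\uparrow1}$ is the set of $b\in\mathfrak M$ that are the end of some arrow of $\Gamma(\mathfrak M)$. At each iteration the operation $^{\uparrow1}$ is taken with respect to the graph of the current set. *)

theory Defs
  imports "HOL-Analysis.Analysis" "HOL-Algebra.Solvable_Groups" "HOL-Algebra.Bij"
    "HOL-Library.Poly_Mapping" "HOL-Computational_Algebra.Polynomial"
begin

section \<open>Lattices and fans\<close>

text \<open>
  After a choice of coordinates, \<open>N\<close> and \<open>M = Hom(N, \<int>)\<close> are both \<^typ>\<open>int ^ 'n\<close> with the
  standard pairing, and the real space containing \<open>N\<close> is \<^typ>\<open>real ^ 'n\<close>.
\<close>

definition pairing :: "int ^ 'n \<Rightarrow> int ^ 'n \<Rightarrow> int" where
  "pairing u w = (\<Sum>j\<in>UNIV. u $ j * w $ j)"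

definition rvec :: "int ^ 'n \<Rightarrow> real ^ 'n" where
  "rvec w = (\<chi> j. real_of_int (w $ j))"

definition primitive_vec :: "int ^ 'n \<Rightarrow> bool" where
  "primitive_vec w \<longleftrightarrow> w \<noteq> 0 \<and> (\<forall>k u. w = k *s u \<longrightarrow> \<bar>k\<bar> = 1)"

definition rational_cone :: "(real ^ 'n) set \<Rightarrow> bool" where
  "rational_cone \<sigma> \<longleftrightarrow> (\<exists>S :: (int ^ 'n) set. finite S \<and> \<sigma> = convex_cone hull (rvec ` S))"

definition strongly_convex_cone :: "(real ^ 'n) set \<Rightarrow> bool" where
  "strongly_convex_cone \<sigma> \<longleftrightarrow> \<sigma> \<inter> uminus ` \<sigma> = {0}"

text \<open>The library's \<^const>\<open>face_of\<close> admits the empty set as a face, which is not a cone.\<close>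

definition fan :: "(real ^ 'n) set set \<Rightarrow> bool" where
  "fan \<Sigma> \<longleftrightarrow> finite \<Sigma> \<and> \<Sigma> \<noteq> {} \<and>
     (\<forall>\<sigma>\<in>\<Sigma>. rational_cone \<sigma> \<and> strongly_convex_cone \<sigma>) \<and>
     (\<forall>\<sigma>\<in>\<Sigma>. \<forall>\<tau>. \<tau> face_of \<sigma> \<and> \<tau> \<noteq> {} \<longrightarrow> \<tau> \<in> \<Sigma>) \<and>
     (\<forall>\<sigma>\<in>\<Sigma>. \<forall>\<tau>\<in>\<Sigma>. \<sigma> \<inter> \<tau> face_of \<sigma> \<and> \<sigma> \<inter> \<tau> face_of \<tau>)"

definition complete_fan :: "(real ^ 'n) set set \<Rightarrow> bool" where
  "complete_fan \<Sigma> \<longleftrightarrow> fan \<Sigma> \<and> \<Union>\<Sigma> = UNIV"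

definition ray_generators :: "(real ^ 'n) set set \<Rightarrow> (int ^ 'n) set" where
  "ray_generators \<Sigma> = {w. primitive_vec w \<and> convex_cone hull {rvec w} \<in> \<Sigma>}"

definition dual_lattice_cone :: "(real ^ 'n) set \<Rightarrow> (int ^ 'n) set" where
  "dual_lattice_cone \<sigma> = {u. \<forall>w\<in>\<sigma>. 0 \<le> rvec u \<bullet> w}"

section \<open>Bilateral fans and the numbering of rays\<close>

definition lattice_basis :: "(nat \<Rightarrow> int ^ 'n) \<Rightarrow> bool" where
  "lattice_basis b \<longleftrightarrow> (\<forall>w. \<exists>!c. c \<in> {1..CARD('n)} \<rightarrow>\<^sub>E (UNIV :: int set) \<and>
     w = (\<Sum>j = 1..CARD('n). c j *s b j))"

definition bilateral_numbering ::
    "(real ^ 'n) set set \<Rightarrow> nat \<Rightarrow> (nat \<Rightarrow> int ^ 'n) \<Rightarrow> (nat \<Rightarrow> nat \<Rightarrow> nat) \<Rightarrow> bool" where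
  "bilateral_numbering \<Sigma> m p a \<longleftrightarrow>
     bij_betw p {1..m} (ray_generators \<Sigma>) \<and> CARD('n) \<le> m \<and> lattice_basis p \<and>
     (\<forall>k\<in>{CARD('n)<..m}. p k = - (\<Sum>j = 1..CARD('n). int (a k j) *s p j))"

definition dual_basis :: "(nat \<Rightarrow> int ^ 'n) \<Rightarrow> (nat \<Rightarrow> int ^ 'n) \<Rightarrow> bool" where
  "dual_basis p q \<longleftrightarrow>
     (\<forall>i\<in>{1..CARD('n)}. \<forall>j\<in>{1..CARD('n)}. pairing (q i) (p j) = (if i = j then 1 else 0))"

definition col_ge :: "nat \<Rightarrow> nat \<Rightarrow> (nat \<Rightarrow> nat \<Rightarrow> nat) \<Rightarrow> nat \<Rightarrow> nat \<Rightarrow> bool" where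
  "col_ge n m a i j \<longleftrightarrow> (\<forall>k\<in>{n<..m}. a k i \<ge> a k j)"

definition col_eq :: "nat \<Rightarrow> nat \<Rightarrow> (nat \<Rightarrow> nat \<Rightarrow> nat) \<Rightarrow> nat \<Rightarrow> nat \<Rightarrow> bool" where
  "col_eq n m a i j \<longleftrightarrow> (\<forall>k\<in>{n<..m}. a k i = a k j)"

definition adapted_numbering :: "nat \<Rightarrow> nat \<Rightarrow> (nat \<Rightarrow> nat \<Rightarrow> nat) \<Rightarrow> bool" where
  "adapted_numbering n m a \<longleftrightarrow>
     (\<exists>(r :: nat) (c :: nat \<Rightarrow> nat). c 0 = 0 \<and> c r = n \<and> (\<forall>s\<in>{1..r}. c (s - 1) < c s) \<and>
        {1..n} // {(i, j). i \<in> {1..n} \<and> j \<in> {1..n} \<and> col_eq n m a i j}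
          = (\<lambda>s. {c (s - 1) + 1..c s}) ` {1..r} \<and>
        (\<forall>l\<in>{1..r}. \<forall>s\<in>{1..r}.
           (\<forall>i\<in>{c (l - 1) + 1..c l}. \<forall>j\<in>{c (s - 1) + 1..c s}.
              col_ge n m a i j \<and> \<not> col_eq n m a i j) \<longrightarrow> l < s))"

section \<open>Demazure roots\<close>

definition demazure_roots_at :: "nat \<Rightarrow> (nat \<Rightarrow> int ^ 'n) \<Rightarrow> nat \<Rightarrow> (int ^ 'n) set" where
  "demazure_roots_at m p i =
     {e. pairing e (p i) = -1 \<and> (\<forall>s\<in>{1..m} - {i}. pairing e (p s) \<ge> 0)}"

definition demazure_roots :: "nat \<Rightarrow> (nat \<Rightarrow> int ^ 'n) \<Rightarrow> (int ^ 'n) set" where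
  "demazure_roots m p = (\<Union>i\<in>{1..m}. demazure_roots_at m p i)"

definition semisimple_roots :: "nat \<Rightarrow> (nat \<Rightarrow> int ^ 'n) \<Rightarrow> (int ^ 'n) set" where
  "semisimple_roots m p = demazure_roots m p \<inter> uminus ` demazure_roots m p"

definition unipotent_roots :: "nat \<Rightarrow> (nat \<Rightarrow> int ^ 'n) \<Rightarrow> (int ^ 'n) set" where
  "unipotent_roots m p = demazure_roots m p - semisimple_roots m p"

definition positive_roots :: "nat \<Rightarrow> (nat \<Rightarrow> int ^ 'n) \<Rightarrow> int ^ 'n \<Rightarrow> (int ^ 'n) set" where
  "positive_roots m p v =
     {e \<in> semisimple_roots m p. pairing e v > 0} \<union> unipotent_roots m p"

definition root_arrow :: "(int ^ 'n) set \<Rightarrow> int ^ 'n \<Rightarrow> int ^ 'n \<Rightarrow> bool" where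
  "root_arrow R a b \<longleftrightarrow> a \<in> R \<and> b \<in> R \<and> (\<exists>e\<in>R. b = a + e)"

definition up1 :: "(int ^ 'n) set \<Rightarrow> (int ^ 'n) set" where
  "up1 R = {b \<in> R. \<exists>a. root_arrow R a b}"

section \<open>The Cox ring and its root derivations\<close>

type_synonym 'k cox_poly = "(nat \<Rightarrow>\<^sub>0 nat) \<Rightarrow>\<^sub>0 'k"

definition cox_ring :: "nat \<Rightarrow> 'k::field cox_poly set" where
  "cox_ring m = {f. \<forall>t\<in>Poly_Mapping.keys f. Poly_Mapping.keys t \<subseteq> {1..m}}"

definition cox_var :: "nat \<Rightarrow> 'k::field cox_poly" where
  "cox_var s = Poly_Mapping.single (Poly_Mapping.single s 1) 1"

definition peval :: "(nat \<Rightarrow> 'k) \<Rightarrow> 'k::field cox_poly \<Rightarrow> 'k" where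
  "peval x f = (\<Sum>t\<in>Poly_Mapping.keys f.
     Poly_Mapping.lookup f t * (\<Prod>s\<in>Poly_Mapping.keys t. x s ^ Poly_Mapping.lookup t s))"

definition partial_deriv :: "nat \<Rightarrow> 'k::field cox_poly \<Rightarrow> 'k cox_poly" where
  "partial_deriv i f = (\<Sum>t\<in>Poly_Mapping.keys f.
     Poly_Mapping.single (t - Poly_Mapping.single i 1)
       (of_nat (Poly_Mapping.lookup t i) * Poly_Mapping.lookup f t))"

definition root_derivation ::
    "nat \<Rightarrow> (nat \<Rightarrow> int ^ 'n) \<Rightarrow> nat \<Rightarrow> int ^ 'n \<Rightarrow> 'k::field cox_poly \<Rightarrow> 'k cox_poly" where
  "root_derivation m p i e f =
     Poly_Mapping.single (\<Sum>s\<in>{1..m} - {i}. Poly_Mapping.single s (nat (pairing e (p s)))) 1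
       * partial_deriv i f"

text \<open>The index set below is finite for every \<open>f\<close> as soon as \<open>D\<close> is locally nilpotent.\<close>

definition exp_lnd ::
    "'k::field_char_0 \<Rightarrow> ('k cox_poly \<Rightarrow> 'k cox_poly) \<Rightarrow> 'k cox_poly \<Rightarrow> 'k cox_poly" where
  "exp_lnd \<alpha> D f =
     (\<Sum>k\<in>{k. (D ^^ k) f \<noteq> 0}. Poly_Mapping.single 0 (\<alpha> ^ k / fact k) * (D ^^ k) f)"

text \<open>The automorphism of affine \<open>m\<close>-space whose comorphism is \<open>exp (\<alpha> \<partial>\<^sub>e)\<close>.\<close>

definition root_aut_affine ::
    "nat \<Rightarrow> (nat \<Rightarrow> int ^ 'n) \<Rightarrow> nat \<Rightarrow> int ^ 'n \<Rightarrow> 'k::field_char_0 \<Rightarrow> (nat \<Rightarrow> 'k) \<Rightarrow> (nat \<Rightarrow> 'k)" where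
  "root_aut_affine m p i e \<alpha> x =
     (\<lambda>s\<in>{1..m}. peval x (exp_lnd \<alpha> (root_derivation m p i e) (cox_var s)))"

section \<open>The toric variety as a Cox quotient\<close>

text \<open>
  The open subset of affine \<open>m\<close>-space on which the quotient is taken, that is, the complement of
  the zero set of the ideal generated by the products of the \<open>x\<^sub>s\<close> with \<open>p\<^sub>s \<notin> \<sigma>\<close>, for
  \<open>\<sigma> \<in> \<Sigma>\<close>.
\<close>

definition cox_space ::
    "(real ^ 'n) set set \<Rightarrow> nat \<Rightarrow> (nat \<Rightarrow> int ^ 'n) \<Rightarrow> (nat \<Rightarrow> 'k::field) set" where
  "cox_space \<Sigma> m p =
     {x \<in> {1..m} \<rightarrow>\<^sub>E UNIV. \<exists>\<sigma>\<in>\<Sigma>. \<forall>s\<in>{1..m}. x s = 0 \<longrightarrow> rvec (p s) \<in> \<sigma>}"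

text \<open>
  A closed point of the affine chart of a cone \<open>\<sigma>\<close> is a homomorphism of monoids from
  \<open>\<sigma>\<^sup>\<or> \<inter> M\<close> to the multiplicative monoid of the field. Each point of the variety is represented
  by this homomorphism on the smallest chart containing it, as a partial function on \<open>M\<close>.
  The Cox quotient map is the toric morphism induced by the lattice map sending the \<open>s\<close>-th
  standard basis vector to \<open>p\<^sub>s\<close>: the pullback of the character of \<open>u\<close> is the product of the
  \<open>x\<^sub>s\<close> raised to \<open>\<langle>u, p\<^sub>s\<rangle>\<close>, and the smallest chart containing the image of \<open>x\<close> belongs to the
  smallest cone \<open>\<sigma>\<close> containing all \<open>p\<^sub>s\<close> with \<open>x\<^sub>s = 0\<close>. On \<open>\<sigma>\<^sup>\<or>\<close> the exponents of
  the vanishing \<open>x\<^sub>s\<close> are nonnegative.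
\<close>

type_synonym ('n, 'k) tpoint = "int ^ 'n \<Rightarrow> 'k option"

definition cox_map ::
    "(real ^ 'n) set set \<Rightarrow> nat \<Rightarrow> (nat \<Rightarrow> int ^ 'n) \<Rightarrow> (nat \<Rightarrow> 'k::field) \<Rightarrow> ('n, 'k) tpoint" where
  "cox_map \<Sigma> m p x =
     (let \<sigma> = \<Inter>{\<tau>\<in>\<Sigma>. \<forall>s\<in>{1..m}. x s = 0 \<longrightarrow> rvec (p s) \<in> \<tau>}
      in (\<lambda>u. if u \<in> dual_lattice_cone \<sigma> then Some (\<Prod>s = 1..m. x s powi pairing u (p s)) else None))"

definition toric_variety ::
    "(real ^ 'n) set set \<Rightarrow> nat \<Rightarrow> (nat \<Rightarrow> int ^ 'n) \<Rightarrow> ('n, 'k::field) tpoint set" where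
  "toric_variety \<Sigma> m p = cox_map \<Sigma> m p ` cox_space \<Sigma> m p"

text \<open>
  Since the Cox map is a good categorical quotient, the Zariski topology of the variety is the
  quotient topology, and a function on an open set is regular iff its pullback is.
\<close>

definition cox_open ::
    "(real ^ 'n) set set \<Rightarrow> nat \<Rightarrow> (nat \<Rightarrow> int ^ 'n) \<Rightarrow> (nat \<Rightarrow> 'k::field) set \<Rightarrow> bool" where
  "cox_open \<Sigma> m p W \<longleftrightarrow>
     (\<exists>F \<subseteq> cox_ring m. W = {x \<in> cox_space \<Sigma> m p. \<exists>f\<in>F. peval x f \<noteq> 0})"

definition cox_regular :: "nat \<Rightarrow> (nat \<Rightarrow> 'k::field) set \<Rightarrow> ((nat \<Rightarrow> 'k) \<Rightarrow> 'k) \<Rightarrow> bool" where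
  "cox_regular m W f \<longleftrightarrow>
     (\<forall>x\<in>W. \<exists>g\<in>cox_ring m. \<exists>h\<in>cox_ring m. peval x h \<noteq> 0 \<and>
        (\<forall>y\<in>W. peval y h \<noteq> 0 \<longrightarrow> f y = peval y g / peval y h))"

definition toric_open ::
    "(real ^ 'n) set set \<Rightarrow> nat \<Rightarrow> (nat \<Rightarrow> int ^ 'n) \<Rightarrow> ('n, 'k::field) tpoint set \<Rightarrow> bool" where
  "toric_open \<Sigma> m p V \<longleftrightarrow> V \<subseteq> toric_variety \<Sigma> m p \<and>
     cox_open \<Sigma> m p {x \<in> cox_space \<Sigma> m p. cox_map \<Sigma> m p x \<in> V}"

definition toric_regular ::
    "(real ^ 'n) set set \<Rightarrow> nat \<Rightarrow> (nat \<Rightarrow> int ^ 'n) \<Rightarrow> ('n, 'k::field) tpoint set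
      \<Rightarrow> (('n, 'k) tpoint \<Rightarrow> 'k) \<Rightarrow> bool" where
  "toric_regular \<Sigma> m p V f \<longleftrightarrow>
     cox_regular m {x \<in> cox_space \<Sigma> m p. cox_map \<Sigma> m p x \<in> V} (f \<circ> cox_map \<Sigma> m p)"

definition toric_morphism ::
    "(real ^ 'n) set set \<Rightarrow> nat \<Rightarrow> (nat \<Rightarrow> int ^ 'n)
      \<Rightarrow> (('n, 'k::field) tpoint \<Rightarrow> ('n, 'k) tpoint) \<Rightarrow> bool" where
  "toric_morphism \<Sigma> m p \<psi> \<longleftrightarrow>
     \<psi> ` toric_variety \<Sigma> m p \<subseteq> toric_variety \<Sigma> m p \<and>
     (\<forall>V. toric_open \<Sigma> m p V \<longrightarrow>
        toric_open \<Sigma> m p {x \<in> toric_variety \<Sigma> m p. \<psi> x \<in> V} \<and>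
        (\<forall>f. toric_regular \<Sigma> m p V f \<longrightarrow>
           toric_regular \<Sigma> m p {x \<in> toric_variety \<Sigma> m p. \<psi> x \<in> V} (f \<circ> \<psi>)))"

section \<open>Automorphisms and root subgroups\<close>

definition toric_Aut ::
    "(real ^ 'n) set set \<Rightarrow> nat \<Rightarrow> (nat \<Rightarrow> int ^ 'n)
      \<Rightarrow> (('n, 'k::field) tpoint \<Rightarrow> ('n, 'k) tpoint) monoid" where
  "toric_Aut \<Sigma> m p = (BijGroup (toric_variety \<Sigma> m p))
     \<lparr>carrier := {\<psi> \<in> Bij (toric_variety \<Sigma> m p). toric_morphism \<Sigma> m p \<psi> \<and>
        toric_morphism \<Sigma> m p (inv_into (toric_variety \<Sigma> m p) \<psi>)}\<rparr>"

definition root_subgroup ::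
    "(real ^ 'n) set set \<Rightarrow> nat \<Rightarrow> (nat \<Rightarrow> int ^ 'n) \<Rightarrow> int ^ 'n
      \<Rightarrow> (('n, 'k::field_char_0) tpoint \<Rightarrow> ('n, 'k) tpoint) set" where
  "root_subgroup \<Sigma> m p e =
     {\<psi> \<in> carrier (toric_Aut \<Sigma> m p). \<exists>i\<in>{1..m}. e \<in> demazure_roots_at m p i \<and>
        (\<exists>\<alpha>. \<forall>x\<in>cox_space \<Sigma> m p.
           \<psi> (cox_map \<Sigma> m p x) = cox_map \<Sigma> m p (root_aut_affine m p i e \<alpha> x))}"

definition U_max ::
    "(real ^ 'n) set set \<Rightarrow> nat \<Rightarrow> (nat \<Rightarrow> int ^ 'n) \<Rightarrow> int ^ 'n
      \<Rightarrow> (('n, 'k::field_char_0) tpoint \<Rightarrow> ('n, 'k) tpoint) monoid" where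
  "U_max \<Sigma> m p v =
     subgroup_generated (toric_Aut \<Sigma> m p) (\<Union>e\<in>positive_roots m p v. root_subgroup \<Sigma> m p e)"

text \<open>Only meaningful for solvable \<open>G\<close>.\<close>

definition derived_length :: "('a, 'b) monoid_scheme \<Rightarrow> nat" where
  "derived_length G = (LEAST k. (derived G ^^ k) (carrier G) = {\<one>\<^bsub>G\<^esub>})"

end

theory Submission
  imports Defs
begin

text \<open>
  In Cox coordinates the root subgroup of \<open>e \<in> \<RR>\<^sub>i\<close> consists of the substitutions
  \<open>x\<^sub>i \<mapsto> x\<^sub>i + \<alpha> \<Prod>\<^sub>s\<^sub>\<noteq>\<^sub>i x\<^sub>s\<^bsup>\<langle>e, p\<^sub>s\<rangle>\<^esup>\<close>. The positive roots are exactly the roots \<open>e \<in> \<RR>\<^sub>i\<close> with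
  \<open>i \<le> n\<close> for which only variables \<open>x\<^sub>l\<close> with \<open>l > i\<close> occur among \<open>x\<^sub>1, \<dots>, x\<^sub>n\<close> in this monomial
  (\<open>positive_roots_iff\<close>), so the generators of the maximal unipotent subgroup are triangular
  substitutions. Expanding
  \<open>(x\<^sub>i - \<alpha> M)\<^sup>d\<close> gives, for \<open>e \<in> \<RR>\<^sub>i\<close> and \<open>f \<in> \<RR>\<^sub>j\<close> with \<open>d = \<langle>f, p\<^sub>i\<rangle> > 0\<close>, the commutator
  relation
  \<open>[u\<^sub>e(\<alpha>), u\<^sub>f(\<beta>)] = u\<^bsub>f+e\<^esub>(- d \<alpha> \<beta>) \<cdot> z\<close>, where \<open>z\<close> is a product of elements of the root
  subgroups of \<open>f + t e\<close> with \<open>2 \<le> t \<le> d\<close> (\<open>root_auto_commutator\<close>); the root subgroups of two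
  positive roots whose sum is not a root commute.

  The rest is group theory (\<open>root_group\<close>). Let \<open>M\<close> be a set of positive roots that contains every
  positive root that is a sum of two of its elements, and let \<open>G(M)\<close> be generated by the root
  subgroups with root in \<open>M\<close>. By the relations the generators of \<open>G(M)\<close> commute modulo the
  normal subgroup \<open>G(M\<^sup>\<up>\<^sup>1)\<close>, hence the derived subgroup of \<open>G(M)\<close> lies in it. Conversely, the
  commutators yield each \<open>u\<^bsub>f+e\<^esub>(\<gamma>)\<close> up to factors with \<open>t \<ge> 2\<close>, and these belong to the derived
  subgroup by induction on \<open>d\<close>; here \<open>d \<noteq> 0\<close> in the ground field is essential. So the derived
  series of \<open>G(M)\<close> is given by iterating \<open>\<up>1\<close>, and since every \<open>u\<^sub>e(1)\<close> is nontrivial, a term of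
  the series is trivial exactly if the corresponding set of roots is empty. A linear functional
  that is positive and bounded on the positive roots shows that this happens eventually.

  Applying this to the toric variety requires that the substitutions descend to automorphisms of
  the variety, although the fibres of the Cox quotient are single torus orbits only for
  simplicial fans. That a substitution preserves the Cox space is a property of Demazure roots: if
  \<open>e\<close> vanishes on some rays of a cone, then these rays and the \<open>i\<close>-th ray lie in a common cone
  (\<open>in_common_cone_insert_root\<close>). That it respects the fibres is shown by comparing characters at
  the image points (\<open>cox_map_root_shift_cong\<close>). Both rest on the convex geometry of rational
  cones, in which real separating functionals are replaced by integral ones with the same signs
  on finitely many lattice vectors (\<open>integral_functional_same_signs\<close>).
\<close>

section \<open>The lattice pairing\<close>

lemma rvec_inner: "rvec u \<bullet> rvec w = of_int (pairing u w)"
  by (simp add: inner_vec_def rvec_def pairing_def)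

lemma pairing_add_left: "pairing (u + w) x = pairing u x + pairing w x"
  by (simp add: pairing_def algebra_simps sum.distrib)

lemma pairing_minus_left: "pairing (- u) x = - pairing u x"
  by (simp add: pairing_def sum_negf)

lemma pairing_scale_left: "pairing (c *s u) x = c * pairing u x"
  by (simp add: pairing_def sum_distrib_left mult.assoc)

lemma pairing_add_right: "pairing x (u + w) = pairing x u + pairing x w"
  by (simp add: pairing_def algebra_simps sum.distrib)

lemma pairing_minus_right: "pairing x (- u) = - pairing x u"
  by (simp add: pairing_def sum_negf)

lemma pairing_scale_right: "pairing x (c *s u) = c * pairing x u"
  by (simp add: pairing_def sum_distrib_left algebra_simps)

lemma pairing_sum_right: "pairing x (\<Sum>j\<in>J. f j) = (\<Sum>j\<in>J. pairing x (f j))"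
  by (induction J rule: infinite_finite_induct)
     (simp_all add: pairing_add_right, simp_all add: pairing_def)

lemmas pairing_linear = pairing_add_left pairing_minus_left pairing_scale_left
  pairing_add_right pairing_minus_right pairing_scale_right pairing_sum_right

section \<open>Rational functionals and rational cones\<close>

text \<open>
  By Dirichlet's theorem some positive integral multiple of the real functional \<open>w\<close> is arbitrarily
  close to an integral one. An integer of absolute value less than one is zero, which
  takes care of the vectors on which \<open>w\<close> vanishes; on the others the approximation is closer than
  the smallest nonzero value.
\<close>

lemma integral_functional_same_signs:
  fixes w :: "real ^ 'n" and S :: "(int ^ 'n) set"
  assumes "finite S"
  obtains z :: "int ^ 'n" where "\<And>s. s \<in> S \<Longrightarrow> sgn (real_of_int (pairing z s)) = sgn (w \<bullet> rvec s)"
proof -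
  define B where "B = (\<Sum>s\<in>S. \<Sum>j\<in>UNIV. \<bar>real_of_int (s $ j)\<bar>)"
  define D where "D = Min (insert 1 ((\<lambda>s. \<bar>w \<bullet> rvec s\<bar>) ` {s\<in>S. w \<bullet> rvec s \<noteq> 0}))"
  have D: "D > 0" unfolding D_def using assms by (subst Min_gr_iff) auto
  have D1: "D \<le> 1" unfolding D_def using assms by (intro Min_le) auto
  have Ds: "D \<le> \<bar>w \<bullet> rvec s\<bar>" if "s \<in> S" "w \<bullet> rvec s \<noteq> 0" for s
    unfolding D_def using assms that by (intro Min_le) auto
  have B0: "B \<ge> 0" by (simp add: B_def sum_nonneg)
  have Bs: "(\<Sum>j\<in>UNIV. \<bar>real_of_int (s $ j)\<bar>) \<le> B" if "s \<in> S" for s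
    unfolding B_def using assms that
    by (intro member_le_sum[of s S "\<lambda>s. \<Sum>j\<in>UNIV. \<bar>real_of_int (s $ j)\<bar>"]) (auto simp: sum_nonneg)
  obtain N :: nat where N: "N > 0" "B / D < N"
    by (metis D B0 divide_nonneg_pos gr0I le_less_trans less_irrefl of_nat_0 reals_Archimedean2)
  obtain h where h: "bij_betw h {0..<CARD('n)} (UNIV :: 'n set)"
    using ex_bij_betw_nat_finite[of "UNIV :: 'n set"] by auto
  obtain Q P where Q: "0 < Q"
    and P: "\<And>i. i < CARD('n) \<Longrightarrow> \<bar>of_int Q * (w $ h i) - of_int (P i)\<bar> < 1 / N"
    using Dirichlet_approx_simult[OF \<open>N > 0\<close>, of "CARD('n)" "\<lambda>i. w $ h i"] by blast
  define z :: "int ^ 'n" where "z = (\<chi> j. P (inv_into {0..<CARD('n)} h j))"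
  have z: "\<bar>of_int Q * w $ j - of_int (z $ j)\<bar> \<le> 1 / N" for j
  proof -
    have "j \<in> h ` {0..<CARD('n)}" using h by (simp add: bij_betw_def)
    then have "inv_into {0..<CARD('n)} h j < CARD('n)" "h (inv_into {0..<CARD('n)} h j) = j"
      using inv_into_into[of j h "{0..<CARD('n)}"] f_inv_into_f[of j h "{0..<CARD('n)}"] by auto
    with P[of "inv_into {0..<CARD('n)} h j"] show ?thesis by (simp add: z_def less_imp_le)
  qed
  have close: "\<bar>of_int Q * (w \<bullet> rvec s) - of_int (pairing z s)\<bar> < D" if "s \<in> S" for s
  proof -
    have "of_int Q * (w \<bullet> rvec s) - of_int (pairing z s)
        = (\<Sum>j\<in>UNIV. (of_int Q * w $ j - of_int (z $ j)) * of_int (s $ j))"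
      by (simp add: inner_vec_def rvec_def pairing_def algebra_simps sum_distrib_left sum_subtractf)
    also have "\<bar>\<dots>\<bar> \<le> (\<Sum>j\<in>UNIV. 1 / N * \<bar>real_of_int (s $ j)\<bar>)"
      by (rule sum_abs[THEN order_trans], rule sum_mono)
         (simp only: abs_mult, intro mult_right_mono z abs_ge_zero)
    also have "\<dots> \<le> 1 / N * B"
      using Bs[OF that] by (simp add: sum_divide_distrib[symmetric] divide_right_mono)
    also have "\<dots> < D" using N D by (simp add: field_simps)
    finally show ?thesis .
  qed
  show thesis
  proof
    fix s assume s: "s \<in> S"
    show "sgn (real_of_int (pairing z s)) = sgn (w \<bullet> rvec s)"
    proof (cases "w \<bullet> rvec s = 0")
      case True
      with close[OF s] D1 have "\<bar>real_of_int (pairing z s)\<bar> < 1" by simp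
      then have "pairing z s = 0" by linarith
      with True show ?thesis by simp
    next
      case False
      have "\<bar>w \<bullet> rvec s\<bar> \<le> of_int Q * \<bar>w \<bullet> rvec s\<bar>"
        using mult_right_mono[of 1 "real_of_int Q" "\<bar>w \<bullet> rvec s\<bar>"] Q by simp
      then have "D \<le> \<bar>of_int Q * (w \<bullet> rvec s)\<bar>" using Ds[OF s False] Q by (simp add: abs_mult)
      with close[OF s] have "sgn (real_of_int (pairing z s)) = sgn (of_int Q * (w \<bullet> rvec s))"
        by (auto simp: sgn_if abs_if split: if_splits)
      with Q show ?thesis by (simp add: sgn_mult)
    qed
  qed
qed

lemma convex_cone_hull_finite:
  fixes f :: "'i \<Rightarrow> 'a::real_vector"
  assumes "finite I"
  shows "convex_cone hull (f ` I) = {\<Sum>i\<in>I. c i *\<^sub>R f i | c. \<forall>i\<in>I. 0 \<le> c i}" (is "_ = ?R")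
proof
  have "convex_cone ?R"
    unfolding convex_cone_iff
  proof (intro conjI ballI allI impI)
    show "0 \<in> ?R" by (auto intro!: exI[of _ "\<lambda>_. 0"])
  next
    fix x y assume "x \<in> ?R" "y \<in> ?R"
    then obtain c d where "x = (\<Sum>i\<in>I. c i *\<^sub>R f i)" "y = (\<Sum>i\<in>I. d i *\<^sub>R f i)"
      "\<forall>i\<in>I. 0 \<le> c i" "\<forall>i\<in>I. 0 \<le> d i" by auto
    then show "x + y \<in> ?R"
      by (auto intro!: exI[of _ "\<lambda>i. c i + d i"] simp: scaleR_add_left sum.distrib)
  next
    fix x and t :: real assume "x \<in> ?R" "0 \<le> t"
    then obtain c where "x = (\<Sum>i\<in>I. c i *\<^sub>R f i)" "\<forall>i\<in>I. 0 \<le> c i" by auto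
    with \<open>0 \<le> t\<close> show "t *\<^sub>R x \<in> ?R"
      by (auto intro!: exI[of _ "\<lambda>i. t * c i"] simp: scaleR_sum_right)
  qed
  moreover have "f ` I \<subseteq> ?R"
  proof
    fix y assume "y \<in> f ` I"
    then obtain j where j: "j \<in> I" "y = f j" by auto
    have "(\<Sum>i\<in>I. (if i = j then 1 else 0) *\<^sub>R f i) = f j"
      using assms j by (subst sum.mono_neutral_right[of _ "{j}"]) auto
    with j show "y \<in> ?R" by (auto intro!: exI[of _ "\<lambda>i. if i = j then 1 else 0"])
  qed
  ultimately show "convex_cone hull (f ` I) \<subseteq> ?R" by (simp add: hull_minimal)
  show "?R \<subseteq> convex_cone hull (f ` I)"
  proof
    fix x assume "x \<in> ?R"
    then obtain c where c: "x = (\<Sum>i\<in>I. c i *\<^sub>R f i)" "\<forall>i\<in>I. 0 \<le> c i" by auto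
    have "(\<Sum>i\<in>J. c i *\<^sub>R f i) \<in> convex_cone hull (f ` I)" if "J \<subseteq> I" for J
      using finite_subset[OF that assms] that
    proof induction
      case (insert j J)
      then show ?case
        by (auto intro!: convex_cone_hull_add convex_cone_hull_mul simp: c(2) hull_inc)
    qed (simp add: convex_cone_hull_contains_0)
    with c show "x \<in> convex_cone hull (f ` I)" by simp
  qed
qed

text \<open>The sum is twice the midpoint, which lies in the open segment between the summands.\<close>

lemma face_of_cone_add_closed:
  assumes "F face_of S" "convex_cone S" "convex_cone F" "x \<in> S" "y \<in> S" "x + y \<in> F"
  shows "x \<in> F"
proof (cases "x = y")
  case True
  have "(1/2) *\<^sub>R (x + y) \<in> F" using assms(3,6) by (simp add: convex_cone_scaleR)
  moreover have "(1/2) *\<^sub>R (x + y) = x" using scaleR_half_double[of x] True by simp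
  ultimately show ?thesis by simp
next
  case False
  have "(1/2) *\<^sub>R (x + y) \<in> open_segment x y"
    unfolding in_segment using False by (auto intro!: exI[of _ "1/2"] simp: scaleR_add_right)
  moreover have "(1/2) *\<^sub>R (x + y) \<in> F" using assms(3,6) by (simp add: convex_cone_scaleR)
  ultimately show ?thesis using assms unfolding face_of_def by blast
qed

text \<open>Divide \<open>g\<close> by the largest integer that divides all its coordinates.\<close>

lemma primitive_direction:
  fixes g :: "int ^ 'n"
  assumes "g \<noteq> 0"
  obtains w k where "primitive_vec w" "k > 0" "g = k *s w"
proof -
  obtain j where j: "g $ j \<noteq> 0" using assms by (auto simp: vec_eq_iff)
  define K where "K = {k. k > 0 \<and> (\<exists>w. g = k *s w)}"
  have "1 \<in> K" by (auto simp: K_def)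
  have K: "K \<subseteq> {1..\<bar>g $ j\<bar>}"
  proof
    fix k assume "k \<in> K"
    then obtain w where "k > 0" "g = k *s w" by (auto simp: K_def)
    then have "k dvd g $ j" by simp
    from dvd_imp_le_int[OF j this] \<open>k > 0\<close> show "k \<in> {1..\<bar>g $ j\<bar>}" by simp
  qed
  then have fin: "finite K" by (rule finite_subset) simp
  define k where "k = Max K"
  have "k \<in> K" unfolding k_def using fin \<open>1 \<in> K\<close> by (intro Max_in) auto
  then obtain w where w: "k > 0" "g = k *s w" by (auto simp: K_def)
  have "primitive_vec w"
    unfolding primitive_vec_def
  proof (intro conjI allI impI)
    show "w \<noteq> 0" using w assms by (auto simp: vec_eq_iff)
    fix l u assume wl: "w = l *s u"
    then have "l \<noteq> 0" using \<open>w \<noteq> 0\<close> by (auto simp: vec_eq_iff)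
    have "g = (k * \<bar>l\<bar>) *s (sgn l *s u)"
      using w wl by (simp add: vec_eq_iff abs_mult_sgn mult.assoc flip: mult.assoc[of "\<bar>l\<bar>"])
    moreover have "k * \<bar>l\<bar> > 0" using w \<open>l \<noteq> 0\<close> by simp
    ultimately have "k * \<bar>l\<bar> \<in> K" unfolding K_def by blast
    then have "k * \<bar>l\<bar> \<le> k" unfolding k_def using fin by simp
    with w have "\<bar>l\<bar> \<le> 1" by simp
    with \<open>l \<noteq> 0\<close> show "\<bar>l\<bar> = 1" by linarith
  qed
  with w that show thesis by blast
qed

text \<open>
  In a generating set of least size every generator spans an extreme ray: a positive multiple of
  \<open>g\<close> that is a sum of two elements of the cone can only use \<open>g\<close>, since otherwise \<open>g\<close> would be
  superfluous or the cone would contain a line.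
\<close>

lemma strongly_convex_cone_generated_by_rays:
  fixes \<sigma> :: "(real ^ 'n) set"
  assumes "rational_cone \<sigma>" "strongly_convex_cone \<sigma>"
  obtains T :: "(int ^ 'n) set" where "finite T" "\<sigma> = convex_cone hull (rvec ` T)"
    "\<And>g. g \<in> T \<Longrightarrow> g \<noteq> 0 \<and> convex_cone hull {rvec g} face_of \<sigma>"
proof -
  define ok where "ok T \<longleftrightarrow> finite T \<and> \<sigma> = convex_cone hull (rvec ` T)" for T :: "(int ^ 'n) set"
  obtain T0 where "ok T0" using assms(1) by (auto simp: rational_cone_def ok_def)
  define T where "T = arg_min card ok"
  have T: "ok T" "\<And>T'. ok T' \<Longrightarrow> card T \<le> card T'"
    unfolding T_def using arg_min_nat_lemma[of ok T0 card, OF \<open>ok T0\<close>] by auto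
  then have fin: "finite T" and gen: "\<sigma> = convex_cone hull (rvec ` T)" by (auto simp: ok_def)
  note span = convex_cone_hull_finite[OF fin, of rvec, folded gen]
  have cc: "convex_cone \<sigma>" by (simp add: gen convex_cone_convex_cone_hull)
  have mem: "rvec s \<in> \<sigma>" if "s \<in> T" for s using that by (auto simp: gen intro: hull_inc)
  have red: "rvec g \<notin> convex_cone hull (rvec ` (T - {g}))" if g: "g \<in> T" for g
  proof
    assume *: "rvec g \<in> convex_cone hull (rvec ` (T - {g}))"
    have "\<sigma> = convex_cone hull (insert (rvec g) (rvec ` (T - {g})))"
      using g by (simp add: gen insert_absorb flip: image_insert)
    also have "\<dots> = convex_cone hull (rvec ` (T - {g}))"
      by (rule hull_redundant[OF *])
    finally have "ok (T - {g})" using fin by (simp add: ok_def)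
    then have "card T \<le> card (T - {g})" by (rule T)
    with g fin show False by (metis card_Diff1_less not_less)
  qed
  have "g \<noteq> 0 \<and> convex_cone hull {rvec g} face_of \<sigma>" if g: "g \<in> T" for g
  proof
    have "rvec (0 :: int ^ 'n) = 0" by (simp add: rvec_def vec_eq_iff)
    with red[OF g] show g0: "g \<noteq> 0" by (metis convex_cone_hull_contains_0)
    have ray: "convex_cone hull {rvec g} = {c *\<^sub>R rvec g | c. 0 \<le> c}"
      using convex_cone_hull_finite[of "{g}" rvec] by auto
    show "convex_cone hull {rvec g} face_of \<sigma>"
      unfolding face_of_def
    proof (intro conjI ballI impI)
      show "convex_cone hull {rvec g} \<subseteq> \<sigma>"
        using g unfolding gen by (intro hull_mono) auto
      show "convex (convex_cone hull {rvec g})" by (rule convex_convex_cone_hull)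
      have main: "x \<in> convex_cone hull {rvec g} \<and> y \<in> convex_cone hull {rvec g}"
        if xy: "x \<in> \<sigma>" "y \<in> \<sigma>" "z \<in> convex_cone hull {rvec g}" "z \<in> open_segment x y" for x y z
      proof -
        obtain a where a: "0 < a" "a < 1" "z = (1 - a) *\<^sub>R x + a *\<^sub>R y"
          using xy(4) by (auto simp: in_segment)
        obtain c where c: "x = (\<Sum>s\<in>T. c s *\<^sub>R rvec s)" "\<forall>s\<in>T. 0 \<le> c s"
          using xy(1) span by auto
        obtain d where d: "y = (\<Sum>s\<in>T. d s *\<^sub>R rvec s)" "\<forall>s\<in>T. 0 \<le> d s"
          using xy(2) span by auto
        obtain b where b: "z = b *\<^sub>R rvec g" using xy(3) ray by auto
        define k where "k s = (1 - a) * c s + a * d s" for s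
        have k0: "\<forall>s\<in>T. 0 \<le> k s" using a c d by (auto simp: k_def)
        have zk: "z = (\<Sum>s\<in>T. k s *\<^sub>R rvec s)"
          using a c d by (simp add: k_def scaleR_sum_right sum.distrib scaleR_add_left)
        then have zk': "(b - k g) *\<^sub>R rvec g = (\<Sum>s\<in>T - {g}. k s *\<^sub>R rvec s)"
          using b g fin by (simp add: sum.remove[of T g] algebra_simps)
        define r where "r = (\<Sum>s\<in>T - {g}. k s *\<^sub>R rvec s)"
        have r: "r \<in> convex_cone hull (rvec ` (T - {g}))"
          unfolding r_def using fin k0 by (subst convex_cone_hull_finite) auto
        have "\<not> b > k g"
        proof
          assume "b > k g"
          then have "rvec g = (1 / (b - k g)) *\<^sub>R r" using zk' by (simp add: r_def flip: zk')
          with r \<open>b > k g\<close> red[OF g] show False by (simp add: convex_cone_hull_mul)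
        qed
        then have "- r = (k g - b) *\<^sub>R rvec g" "0 \<le> k g - b"
          using zk' by (auto simp: r_def algebra_simps)
        then have mr: "- r \<in> \<sigma>" using mem[OF g] cc by (simp add: convex_cone_scaleR)
        have k_zero: "k s = 0" if s: "s \<in> T - {g}" for s
        proof (rule ccontr)
          assume "k s \<noteq> 0"
          have "r - k s *\<^sub>R rvec s = (\<Sum>t\<in>T - {g} - {s}. k t *\<^sub>R rvec t)"
            using s fin by (simp add: r_def sum.remove[of "T - {g}" s])
          also have "\<dots> \<in> convex_cone hull (rvec ` (T - {g} - {s}))"
            using fin k0 by (subst convex_cone_hull_finite) auto
          also have "\<dots> \<subseteq> \<sigma>" unfolding gen by (intro hull_mono) auto
          finally have "(r - k s *\<^sub>R rvec s) + (- r) \<in> \<sigma>" using mr cc convex_cone_add by blast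
          then have "- (k s *\<^sub>R rvec s) \<in> \<sigma>" by simp
          moreover have "k s *\<^sub>R rvec s \<in> \<sigma>" using mem s k0 cc by (auto intro: convex_cone_scaleR)
          ultimately have "k s *\<^sub>R rvec s = 0"
            using assms(2) unfolding strongly_convex_cone_def by (metis IntI image_eqI minus_minus singletonD)
          with \<open>k s \<noteq> 0\<close> have "rvec s = 0" by simp
          with red[of s] s show False by (simp add: convex_cone_hull_contains_0)
        qed
        have "c s = 0 \<and> d s = 0" if "s \<in> T - {g}" for s
        proof -
          have "(1 - a) * c s + a * d s = 0" "0 \<le> (1 - a) * c s" "0 \<le> a * d s"
            using k_zero[OF that] that a c d by (auto simp: k_def)
          with a show ?thesis by (simp add: add_nonneg_eq_0_iff)
        qed
        then have "x = c g *\<^sub>R rvec g" "y = d g *\<^sub>R rvec g"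
          using c d g fin by (simp_all add: sum.remove[of T g])
        with c(2) d(2) g ray show ?thesis by auto
      qed
      fix x y z
      assume "x \<in> \<sigma>" "y \<in> \<sigma>" "z \<in> convex_cone hull {rvec g}" "z \<in> open_segment x y"
      from main[OF this] show "x \<in> convex_cone hull {rvec g}" "y \<in> convex_cone hull {rvec g}"
        by auto
    qed
  qed
  with fin gen that show thesis by blast
qed

section \<open>The cones of a complete fan\<close>

text \<open>
  Cones are handled through the set of indices of the rays that they contain. The least cone
  containing given rays is a cone of the fan because the fan is finite and closed under
  intersections.
\<close>

locale complete_toric =
  fixes \<Sigma> :: "(real ^ 'n) set set" and m :: nat and p :: "nat \<Rightarrow> int ^ 'n"
  assumes complete: "complete_fan \<Sigma>"
    and numbering: "bij_betw p {1..m} (ray_generators \<Sigma>)"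
begin

definition ray_indices :: "(real ^ 'n) set \<Rightarrow> nat set" where
  "ray_indices \<sigma> = {s\<in>{1..m}. rvec (p s) \<in> \<sigma>}"

definition in_common_cone :: "nat set \<Rightarrow> bool" where
  "in_common_cone I \<longleftrightarrow> (\<exists>\<tau>\<in>\<Sigma>. I \<subseteq> ray_indices \<tau>)"

definition least_cone :: "nat set \<Rightarrow> (real ^ 'n) set" where
  "least_cone I = \<Inter>{\<tau>\<in>\<Sigma>. I \<subseteq> ray_indices \<tau>}"

lemma fan: "fan \<Sigma>" and covers: "\<Union>\<Sigma> = UNIV"
  using complete by (auto simp: complete_fan_def)

lemma finite_fan: "finite \<Sigma>"
  using fan by (simp add: fan_def)

lemma face_in_fan: "\<sigma> \<in> \<Sigma> \<Longrightarrow> \<tau> face_of \<sigma> \<Longrightarrow> \<tau> \<noteq> {} \<Longrightarrow> \<tau> \<in> \<Sigma>"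
  using fan by (auto simp: fan_def)

lemma Int_face: "\<sigma> \<in> \<Sigma> \<Longrightarrow> \<tau> \<in> \<Sigma> \<Longrightarrow> \<sigma> \<inter> \<tau> face_of \<sigma>"
  using fan by (auto simp: fan_def)

lemma cone_polyhedral:
  assumes "\<sigma> \<in> \<Sigma>"
  shows "convex_cone \<sigma>" "polyhedron \<sigma>" "strongly_convex_cone \<sigma>"
proof -
  from assms have "rational_cone \<sigma>" and sc: "strongly_convex_cone \<sigma>"
    using fan by (auto simp: fan_def)
  then obtain S :: "(int ^ 'n) set" where S: "finite S" "\<sigma> = convex_cone hull (rvec ` S)"
    by (auto simp: rational_cone_def)
  then show "convex_cone \<sigma>" "polyhedron \<sigma>"
    by (simp_all add: convex_cone_convex_cone_hull polyhedron_convex_cone_hull)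
  show "strongly_convex_cone \<sigma>" by (rule sc)
qed

lemma ray_indices_subset: "ray_indices \<sigma> \<subseteq> {1..m}"
  by (auto simp: ray_indices_def)

lemma ray_indices_mono: "\<sigma> \<subseteq> \<tau> \<Longrightarrow> ray_indices \<sigma> \<subseteq> ray_indices \<tau>"
  by (auto simp: ray_indices_def)

text \<open>
  The extreme rays of a cone are faces, hence belong to the fan, hence are spanned by one of the
  vectors \<open>p\<^sub>s\<close>.
\<close>

lemma cone_generated_by_rays:
  assumes "\<sigma> \<in> \<Sigma>"
  shows "\<sigma> = convex_cone hull ((\<lambda>s. rvec (p s)) ` ray_indices \<sigma>)" (is "_ = ?H")
proof
  have "rational_cone \<sigma>" "strongly_convex_cone \<sigma>" using assms fan by (auto simp: fan_def)
  then obtain T :: "(int ^ 'n) set" where "finite T" and T: "\<sigma> = convex_cone hull (rvec ` T)"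
    "\<And>g. g \<in> T \<Longrightarrow> g \<noteq> 0 \<and> convex_cone hull {rvec g} face_of \<sigma>"
    using strongly_convex_cone_generated_by_rays by metis
  have "rvec g \<in> ?H" if g: "g \<in> T" for g
  proof -
    obtain w k where w: "primitive_vec w" "k > 0" "g = k *s w"
      using T(2)[OF g] primitive_direction by blast
    have gw: "rvec g = real_of_int k *\<^sub>R rvec w" "rvec w = (1 / real_of_int k) *\<^sub>R rvec g"
      using w by (simp_all add: rvec_def vec_eq_iff)
    have "rvec g \<in> convex_cone hull {rvec w}"
      unfolding gw(1) using w by (intro convex_cone_hull_mul hull_inc) auto
    moreover have ww: "rvec w \<in> convex_cone hull {rvec g}"
      unfolding gw(2) using w by (intro convex_cone_hull_mul hull_inc) auto
    ultimately have "convex_cone hull {rvec w} = convex_cone hull {rvec g}"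
      by (intro subset_antisym hull_minimal) (auto simp: convex_cone_convex_cone_hull)
    moreover have "convex_cone hull {rvec g} \<in> \<Sigma>"
      using T(2)[OF g] assms face_in_fan convex_cone_hull_nonempty by blast
    ultimately have "w \<in> ray_generators \<Sigma>" using w by (simp add: ray_generators_def)
    then obtain s where s: "s \<in> {1..m}" "w = p s"
      using numbering unfolding bij_betw_def by blast
    have "rvec w \<in> \<sigma>" using ww T(2)[OF g] face_of_imp_subset by blast
    with s have "s \<in> ray_indices \<sigma>" by (simp add: ray_indices_def)
    then show ?thesis
      unfolding gw(1) s(2) using w(2) by (intro convex_cone_hull_mul hull_inc) auto
  qed
  then have "convex_cone hull (rvec ` T) \<subseteq> ?H"
    by (intro hull_minimal convex_cone_convex_cone_hull) blast
  then show "\<sigma> \<subseteq> ?H" using T(1) by simp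
  show "?H \<subseteq> \<sigma>"
    using cone_polyhedral(1)[OF assms] by (intro hull_minimal) (auto simp: ray_indices_def)
qed

lemma cone_mono:
  assumes "\<sigma> \<in> \<Sigma>" "\<tau> \<in> \<Sigma>" "ray_indices \<sigma> \<subseteq> ray_indices \<tau>"
  shows "\<sigma> \<subseteq> \<tau>"
proof -
  have "convex_cone hull ((\<lambda>s. rvec (p s)) ` ray_indices \<sigma>)
      \<subseteq> convex_cone hull ((\<lambda>s. rvec (p s)) ` ray_indices \<tau>)"
    using assms(3) by (intro hull_mono) auto
  then show ?thesis
    using cone_generated_by_rays[OF assms(1)] cone_generated_by_rays[OF assms(2)] by simp
qed

lemma nonneg_on_cone_iff:
  assumes "\<sigma> \<in> \<Sigma>"
  shows "(\<forall>w\<in>\<sigma>. 0 \<le> u \<bullet> w) \<longleftrightarrow> (\<forall>s\<in>ray_indices \<sigma>. 0 \<le> u \<bullet> rvec (p s))"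
proof
  assume "\<forall>s\<in>ray_indices \<sigma>. 0 \<le> u \<bullet> rvec (p s)"
  then have "convex_cone hull ((\<lambda>s. rvec (p s)) ` ray_indices \<sigma>) \<subseteq> {w. u \<bullet> w \<ge> 0}"
    by (intro hull_minimal convex_cone_halfspace_ge) auto
  then show "\<forall>w\<in>\<sigma>. 0 \<le> u \<bullet> w" using cone_generated_by_rays[OF assms] by blast
qed (auto simp: ray_indices_def)

lemma dual_lattice_cone_iff:
  assumes "\<sigma> \<in> \<Sigma>"
  shows "u \<in> dual_lattice_cone \<sigma> \<longleftrightarrow> (\<forall>s\<in>ray_indices \<sigma>. 0 \<le> pairing u (p s))"
  using nonneg_on_cone_iff[OF assms, of "rvec u"] by (simp add: dual_lattice_cone_def rvec_inner)

lemma cone_Int: "\<sigma> \<in> \<Sigma> \<Longrightarrow> \<tau> \<in> \<Sigma> \<Longrightarrow> \<sigma> \<inter> \<tau> \<in> \<Sigma>"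
  using face_in_fan[OF _ Int_face] cone_polyhedral(1) convex_cone_contains_0 by blast

lemma cone_Inter:
  assumes "finite F" "F \<noteq> {}" "F \<subseteq> \<Sigma>"
  shows "\<Inter>F \<in> \<Sigma>"
  using assms
proof (induction F rule: finite_ne_induct)
  case (insert \<sigma> F)
  then show ?case using cone_Int[of \<sigma> "\<Inter>F"] by simp
qed auto

lemma least_cone_in_fan:
  assumes "in_common_cone I"
  shows "least_cone I \<in> \<Sigma>"
  unfolding least_cone_def
  using assms finite_fan by (intro cone_Inter) (auto simp: in_common_cone_def)

lemma least_cone_subset: "\<tau> \<in> \<Sigma> \<Longrightarrow> I \<subseteq> ray_indices \<tau> \<Longrightarrow> least_cone I \<subseteq> \<tau>"
  by (auto simp: least_cone_def)

lemma subset_ray_indices_least_cone: "in_common_cone I \<Longrightarrow> I \<subseteq> ray_indices (least_cone I)"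
  by (fastforce simp: least_cone_def ray_indices_def in_common_cone_def)

lemma in_common_cone_mono: "in_common_cone J \<Longrightarrow> I \<subseteq> J \<Longrightarrow> in_common_cone I"
  by (auto simp: in_common_cone_def)

lemma least_cone_mono: "I \<subseteq> J \<Longrightarrow> least_cone I \<subseteq> least_cone J"
  by (auto simp: least_cone_def)

lemma least_cone_absorb:
  assumes "in_common_cone I" "I \<subseteq> J" "J \<subseteq> ray_indices (least_cone I)"
  shows "in_common_cone J" "least_cone J = least_cone I"
  using assms least_cone_in_fan[OF assms(1)] least_cone_subset[of "least_cone I" J]
    least_cone_mono[of I J]
  by (auto simp: in_common_cone_def)

text \<open>
  The zero set of \<open>u\<close> on the least cone is a face, hence a cone of the fan that contains the same
  rays; by minimality it is everything.
\<close>

lemma vanishes_on_least_cone: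
  assumes I: "in_common_cone I" and u: "u \<in> dual_lattice_cone (least_cone I)"
    and van: "\<And>s. s \<in> I \<Longrightarrow> pairing u (p s) = 0" and s: "s \<in> ray_indices (least_cone I)"
  shows "pairing u (p s) = 0"
proof -
  let ?F = "least_cone I \<inter> {w. rvec u \<bullet> w = 0}"
  note \<sigma> = least_cone_in_fan[OF I]
  have "?F face_of least_cone I"
    using u cone_polyhedral(1)[OF \<sigma>]
    by (intro face_of_Int_supporting_hyperplane_ge)
       (auto simp: dual_lattice_cone_def convex_cone_def)
  moreover have "0 \<in> ?F" using cone_polyhedral(1)[OF \<sigma>] by (simp add: convex_cone_contains_0)
  ultimately have "?F \<in> \<Sigma>" using face_in_fan[OF \<sigma>] by blast
  moreover have "I \<subseteq> ray_indices ?F"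
    using subset_ray_indices_least_cone[OF I] van by (auto simp: ray_indices_def rvec_inner)
  ultimately have "least_cone I \<subseteq> ?F" by (rule least_cone_subset)
  with s show ?thesis by (auto simp: ray_indices_def rvec_inner)
qed

text \<open>Faces of polyhedra are exposed; only the signs of the exposing functional on the rays matter,
  so it can be chosen integral.\<close>

lemma exposing_functional:
  assumes "\<sigma> \<in> \<Sigma>" "\<tau> \<in> \<Sigma>" "\<tau> \<subseteq> \<sigma>"
  obtains u where "u \<in> dual_lattice_cone \<sigma>"
    "\<And>s. s \<in> ray_indices \<sigma> \<Longrightarrow> pairing u (p s) = 0 \<longleftrightarrow> s \<in> ray_indices \<tau>"
proof -
  have "\<tau> face_of \<sigma>" using Int_face[OF assms(1,2)] assms(3) by (simp add: Int_absorb1)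
  then have "\<tau> exposed_face_of \<sigma>"
    using exposed_face_of_polyhedron cone_polyhedral(2)[OF assms(1)] by blast
  then obtain c b where cb: "\<sigma> \<subseteq> {x. c \<bullet> x \<le> b}" "\<tau> = \<sigma> \<inter> {x. c \<bullet> x = b}"
    by (auto simp: exposed_face_of_def)
  have "0 \<in> \<tau>" using cone_polyhedral(1)[OF assms(2)] by (rule convex_cone_contains_0)
  with cb have "b = 0" by auto
  obtain u where u: "\<And>s. s \<in> p ` {1..m} \<Longrightarrow> sgn (real_of_int (pairing u s)) = sgn ((- c) \<bullet> rvec s)"
    using integral_functional_same_signs[of "p ` {1..m}" "- c"] by blast
  have sgns: "sgn (real_of_int (pairing u (p s))) = - sgn (c \<bullet> rvec (p s))"
    if "s \<in> {1..m}" for s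
    using u[of "p s"] that by (simp add: sgn_minus)
  show thesis
  proof
    show "u \<in> dual_lattice_cone \<sigma>"
      unfolding dual_lattice_cone_iff[OF assms(1)]
    proof
      fix s assume s: "s \<in> ray_indices \<sigma>"
      then have "c \<bullet> rvec (p s) \<le> 0" using cb \<open>b = 0\<close> by (auto simp: ray_indices_def)
      with sgns[of s] s show "0 \<le> pairing u (p s)"
        by (auto simp: ray_indices_def sgn_if split: if_splits)
    qed
    fix s assume s: "s \<in> ray_indices \<sigma>"
    then have "s \<in> ray_indices \<tau> \<longleftrightarrow> c \<bullet> rvec (p s) = 0"
      using cb \<open>b = 0\<close> by (auto simp: ray_indices_def)
    with sgns[of s] s show "pairing u (p s) = 0 \<longleftrightarrow> s \<in> ray_indices \<tau>"
      by (auto simp: ray_indices_def sgn_if split: if_splits)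
  qed
qed

text \<open>
  Duality for rational cones: a ray outside of \<open>\<sigma>\<close> is separated from \<open>\<sigma>\<close> by an integral functional.
  It follows that a point of the toric variety, being a partial function on \<open>M\<close>, determines the cone
  of its chart.
\<close>

lemma cone_subset_if_dual_subset:
  assumes "\<sigma> \<in> \<Sigma>" "\<tau> \<in> \<Sigma>" "dual_lattice_cone \<sigma> \<subseteq> dual_lattice_cone \<tau>"
  shows "\<tau> \<subseteq> \<sigma>"
proof (rule cone_mono[OF assms(2,1)], rule ccontr)
  assume "\<not> ray_indices \<tau> \<subseteq> ray_indices \<sigma>"
  then obtain s where s: "s \<in> ray_indices \<tau>" "s \<notin> ray_indices \<sigma>" by auto
  then have sm: "s \<in> {1..m}" "rvec (p s) \<notin> \<sigma>" by (auto simp: ray_indices_def)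
  note cc = cone_polyhedral(1)[OF assms(1)]
  have "convex \<sigma>" "closed \<sigma>"
    using cc cone_polyhedral(2)[OF assms(1)] by (auto simp: convex_cone_def polyhedron_imp_closed)
  then obtain c b where cb: "c \<bullet> rvec (p s) < b" "\<forall>x\<in>\<sigma>. c \<bullet> x > b"
    using separating_hyperplane_closed_point[of \<sigma> "rvec (p s)"] sm by blast
  have "b < 0" using cb(2) cc convex_cone_contains_0 by fastforce
  \<comment> \<open>a functional that is bounded below on a cone is nonnegative there\<close>
  have nonneg: "0 \<le> c \<bullet> x" if x: "x \<in> \<sigma>" for x
  proof (rule ccontr)
    assume neg: "\<not> 0 \<le> c \<bullet> x"
    then have "(b / (c \<bullet> x)) *\<^sub>R x \<in> \<sigma>"
      using cc x \<open>b < 0\<close> by (intro convex_cone_scaleR) (auto simp: divide_nonpos_neg)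
    with cb(2) have "c \<bullet> ((b / (c \<bullet> x)) *\<^sub>R x) > b" by blast
    with neg show False by simp
  qed
  obtain u where u: "\<And>s. s \<in> p ` {1..m} \<Longrightarrow> sgn (real_of_int (pairing u s)) = sgn (c \<bullet> rvec s)"
    using integral_functional_same_signs[of "p ` {1..m}" c] by blast
  have "u \<in> dual_lattice_cone \<sigma>"
    unfolding dual_lattice_cone_iff[OF assms(1)]
  proof
    fix t assume t: "t \<in> ray_indices \<sigma>"
    with nonneg have "0 \<le> c \<bullet> rvec (p t)" by (simp add: ray_indices_def)
    with u[of "p t"] t show "0 \<le> pairing u (p t)"
      by (auto simp: ray_indices_def sgn_if split: if_splits)
  qed
  then have "u \<in> dual_lattice_cone \<tau>" using assms(3) by blast
  with s have "0 \<le> pairing u (p s)" by (simp add: dual_lattice_cone_iff[OF assms(2)])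
  moreover have "sgn (real_of_int (pairing u (p s))) = -1"
    using u[of "p s"] sm cb(1) \<open>b < 0\<close> by simp
  ultimately show False by (auto simp: sgn_if split: if_splits)
qed

lemma ex_ray_negative:
  assumes "rvec u \<bullet> w < 0"
  obtains \<sigma> s where "\<sigma> \<in> \<Sigma>" "w \<in> \<sigma>" "s \<in> ray_indices \<sigma>" "pairing u (p s) < 0"
proof -
  obtain \<sigma> where \<sigma>: "\<sigma> \<in> \<Sigma>" "w \<in> \<sigma>" using covers by blast
  then have "\<not> (\<forall>s\<in>ray_indices \<sigma>. 0 \<le> rvec u \<bullet> rvec (p s))"
    using nonneg_on_cone_iff[OF \<sigma>(1), of "rvec u"] assms by fastforce
  with \<sigma> that show thesis by (auto simp: rvec_inner)
qed

text \<open>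
  If \<open>w\<close> is the sum of the generators with index in \<open>I\<close>, then \<open>e\<close> is negative at
  \<open>w + \<epsilon> p\<^sub>i\<close>, so every cone containing this point has the only ray on which \<open>e\<close> is negative,
  namely the \<open>i\<close>-th. As there are finitely many cones, one of them serves for a sequence of
  \<open>\<epsilon>\<close> tending to zero and contains \<open>w\<close> as well; being a sum in a face, \<open>w\<close> brings its summands
  along.
\<close>

lemma in_common_cone_insert_root:
  assumes I: "in_common_cone I" and e: "e \<in> demazure_roots_at m p i"
    and van: "\<And>s. s \<in> I \<Longrightarrow> pairing e (p s) = 0"
  shows "in_common_cone (insert i I)"
proof -
  define w where "w = (\<Sum>s\<in>I. rvec (p s))"
  have Im: "I \<subseteq> {1..m}" using I ray_indices_subset by (auto simp: in_common_cone_def)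
  then have fin: "finite I" by (rule finite_subset) simp
  have ew: "rvec e \<bullet> w = 0" using van by (simp add: w_def inner_sum_right rvec_inner)
  have ei: "pairing e (p i) = -1" using e by (simp add: demazure_roots_at_def)
  have "\<exists>\<sigma>\<in>\<Sigma>. w + (1 / real (Suc k)) *\<^sub>R rvec (p i) \<in> \<sigma> \<and> i \<in> ray_indices \<sigma>" for k
  proof -
    have "rvec e \<bullet> (w + (1 / real (Suc k)) *\<^sub>R rvec (p i)) < 0"
      using ew ei by (simp add: inner_add_right rvec_inner)
    then obtain \<sigma> s where s: "\<sigma> \<in> \<Sigma>" "w + (1 / real (Suc k)) *\<^sub>R rvec (p i) \<in> \<sigma>"
      "s \<in> ray_indices \<sigma>" "pairing e (p s) < 0"
      by (rule ex_ray_negative)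
    then have "s = i" using e ray_indices_subset by (force simp: demazure_roots_at_def)
    with s show ?thesis by blast
  qed
  then obtain f where f: "\<And>k. f k \<in> \<Sigma>" "\<And>k. w + (1 / real (Suc k)) *\<^sub>R rvec (p i) \<in> f k"
    "\<And>k. i \<in> ray_indices (f k)" by metis
  have "finite (f ` UNIV)" using f(1) finite_fan by (auto intro: finite_subset)
  then obtain k0 where inf: "infinite {k \<in> UNIV. f k = f k0}"
    using pigeonhole_infinite[of UNIV f] by auto
  have "closed (f k0)" using f(1) cone_polyhedral(2) polyhedron_imp_closed by blast
  moreover have "\<exists>y\<in>f k0. dist y w < \<epsilon>" if "\<epsilon> > 0" for \<epsilon>
  proof -
    obtain K :: nat where K: "norm (rvec (p i)) / \<epsilon> < K" using reals_Archimedean2 by blast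
    obtain k where k: "k > K" "f k = f k0" using inf by (auto simp: infinite_nat_iff_unbounded)
    have "norm (rvec (p i)) / \<epsilon> < real (Suc k)" using K k by linarith
    then have "norm (rvec (p i)) / real (Suc k) < \<epsilon>"
      using that by (simp add: field_simps del: of_nat_Suc)
    then have "dist (w + (1 / real (Suc k)) *\<^sub>R rvec (p i)) w < \<epsilon>"
      by (simp add: dist_norm del: of_nat_Suc)
    with f(2)[of k] k show ?thesis by auto
  qed
  ultimately have wk: "w \<in> f k0" using closed_approachable by blast
  note \<sigma> = least_cone_in_fan[OF I]
  have mem: "rvec (p s) \<in> least_cone I" if "s \<in> I" for s
    using subset_ray_indices_least_cone[OF I] that by (auto simp: ray_indices_def)
  have sums: "(\<Sum>s\<in>J. rvec (p s)) \<in> least_cone I" if "J \<subseteq> I" for J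
    using finite_subset[OF that fin] that
  proof induction
    case (insert j J)
    then show ?case using mem cone_polyhedral(1)[OF \<sigma>] by (auto intro!: convex_cone_add)
  qed (use cone_polyhedral(1)[OF \<sigma>] convex_cone_contains_0 in auto)
  have "rvec (p s) \<in> f k0" if s: "s \<in> I" for s
  proof -
    have "rvec (p s) \<in> least_cone I \<inter> f k0"
    proof (rule face_of_cone_add_closed[OF Int_face[OF \<sigma> f(1)]])
      show "convex_cone (least_cone I)" "convex_cone (least_cone I \<inter> f k0)"
        using cone_polyhedral(1) \<sigma> cone_Int f(1) by auto
      show "rvec (p s) + (\<Sum>t\<in>I - {s}. rvec (p t)) \<in> least_cone I \<inter> f k0"
        using wk sums[of I] s fin by (simp add: w_def sum.remove[of I s])
    qed (use mem s sums[of "I - {s}"] in auto)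
    then show ?thesis by simp
  qed
  then have "insert i I \<subseteq> ray_indices (f k0)" using Im f(3) by (auto simp: ray_indices_def)
  with f(1) show ?thesis by (auto simp: in_common_cone_def)
qed

end

section \<open>Polynomial functions on the Cox space\<close>

definition eval_monom :: "(nat \<Rightarrow> 'k::field) \<Rightarrow> (nat \<Rightarrow>\<^sub>0 nat) \<Rightarrow> 'k" where
  "eval_monom x t = (\<Prod>s\<in>Poly_Mapping.keys t. x s ^ Poly_Mapping.lookup t s)"

lemma eval_monom_superset:
  assumes "finite A" "Poly_Mapping.keys t \<subseteq> A"
  shows "eval_monom x t = (\<Prod>s\<in>A. x s ^ Poly_Mapping.lookup t s)"
  unfolding eval_monom_def
  using assms by (intro prod.mono_neutral_left) (auto simp: in_keys_iff)

lemma eval_monom_add: "eval_monom x (t + t') = eval_monom x t * eval_monom x t'"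
proof -
  let ?A = "Poly_Mapping.keys t \<union> Poly_Mapping.keys t'"
  have sub: "Poly_Mapping.keys (t + t') \<subseteq> ?A" by (rule Poly_Mapping.keys_add)
  show ?thesis
    using eval_monom_superset[OF _ sub, of x] eval_monom_superset[of ?A t x]
      eval_monom_superset[of ?A t' x]
    by (simp add: lookup_add power_add prod.distrib)
qed

lemma eval_monom_zero [simp]: "eval_monom x 0 = 1"
  by (simp add: eval_monom_def)

lemma eval_monom_single [simp]: "eval_monom x (Poly_Mapping.single s k) = x s ^ k"
  by (simp add: eval_monom_def)

lemma eval_monom_sum:
  "finite J \<Longrightarrow> eval_monom x (\<Sum>s\<in>J. t s) = (\<Prod>s\<in>J. eval_monom x (t s))"
  by (induction J rule: finite_induct) (simp_all add: eval_monom_add)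

lemma peval_superset:
  assumes "finite A" "Poly_Mapping.keys f \<subseteq> A"
  shows "peval x f = (\<Sum>t\<in>A. Poly_Mapping.lookup f t * eval_monom x t)"
  unfolding peval_def eval_monom_def[symmetric]
  using assms by (intro sum.mono_neutral_left) (auto simp: in_keys_iff)

lemma peval_add: "peval x (f + g) = peval x f + peval x g"
proof -
  let ?A = "Poly_Mapping.keys f \<union> Poly_Mapping.keys g"
  have sub: "Poly_Mapping.keys (f + g) \<subseteq> ?A" by (rule Poly_Mapping.keys_add)
  show ?thesis
    using peval_superset[OF _ sub, of x] peval_superset[of ?A f x] peval_superset[of ?A g x]
    by (simp add: lookup_add algebra_simps sum.distrib)
qed

lemma peval_zero [simp]: "peval x 0 = 0"
  by (simp add: peval_def)

lemma peval_sum: "peval x (\<Sum>i\<in>I. f i) = (\<Sum>i\<in>I. peval x (f i))"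
  by (induction I rule: infinite_finite_induct) (simp_all add: peval_add)

lemma peval_single [simp]: "peval x (Poly_Mapping.single t c) = c * eval_monom x t"
  by (simp add: peval_def eval_monom_def)

lemma poly_mapping_sum_singles:
  "f = (\<Sum>t\<in>Poly_Mapping.keys f. Poly_Mapping.single t (Poly_Mapping.lookup f t))"
  by (rule poly_mapping_eqI) (simp add: lookup_sum lookup_single when_def in_keys_iff)

text \<open>Both factors are sums of monomials, on which evaluation is multiplicative.\<close>

lemma peval_mult: "peval x (f * g) = peval x f * peval x g"
proof -
  have "peval x (f * g) = peval x
      ((\<Sum>t\<in>Poly_Mapping.keys f. Poly_Mapping.single t (Poly_Mapping.lookup f t)) *
       (\<Sum>t\<in>Poly_Mapping.keys g. Poly_Mapping.single t (Poly_Mapping.lookup g t)))"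
    by (simp flip: poly_mapping_sum_singles)
  also have "\<dots> = peval x f * peval x g"
    by (simp add: sum_product mult_single peval_sum eval_monom_add mult_ac
        peval_def[of x f] peval_def[of x g] flip: eval_monom_def)
  finally show ?thesis .
qed

lemma cox_ring_single: "Poly_Mapping.keys t \<subseteq> {1..m} \<Longrightarrow> Poly_Mapping.single t c \<in> cox_ring m"
  by (auto simp: cox_ring_def)

lemma cox_ring_add: "f \<in> cox_ring m \<Longrightarrow> g \<in> cox_ring m \<Longrightarrow> f + g \<in> cox_ring m"
  using Poly_Mapping.keys_add[of f g] by (fastforce simp: cox_ring_def)

lemma cox_ring_mult: "f \<in> cox_ring m \<Longrightarrow> g \<in> cox_ring m \<Longrightarrow> f * g \<in> cox_ring m"
proof -
  assume fg: "f \<in> cox_ring m" "g \<in> cox_ring m"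
  have "Poly_Mapping.keys t \<subseteq> {1..m}" if "t \<in> Poly_Mapping.keys (f * g)" for t
  proof -
    obtain t1 t2 where "t = t1 + t2" "t1 \<in> Poly_Mapping.keys f" "t2 \<in> Poly_Mapping.keys g"
      using \<open>t \<in> _\<close> keys_mult[of f g] by blast
    with fg Poly_Mapping.keys_add[of t1 t2] show ?thesis by (fastforce simp: cox_ring_def)
  qed
  then show ?thesis by (simp add: cox_ring_def)
qed

text \<open>
  Composing polynomials is avoided by working with the functions that they define: the topology
  and the regular functions on the toric variety only depend on these.
\<close>

definition poly_function :: "nat \<Rightarrow> ((nat \<Rightarrow> 'k::field) \<Rightarrow> 'k) \<Rightarrow> bool" where
  "poly_function m F \<longleftrightarrow> (\<exists>f\<in>cox_ring m. \<forall>x. peval x f = F x)"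

lemma poly_function_const: "poly_function m (\<lambda>x. c)"
  unfolding poly_function_def
  by (rule bexI[of _ "Poly_Mapping.single 0 c"]) (auto intro: cox_ring_single)

lemma poly_function_coord: "s \<in> {1..m} \<Longrightarrow> poly_function m (\<lambda>x. x s)"
  unfolding poly_function_def
  by (rule bexI[of _ "Poly_Mapping.single (Poly_Mapping.single s 1) 1"])
     (auto intro!: cox_ring_single)

lemma poly_function_add:
  assumes "poly_function m F" "poly_function m G"
  shows "poly_function m (\<lambda>x. F x + G x)"
  using assms unfolding poly_function_def by (metis peval_add cox_ring_add)

lemma poly_function_mult:
  assumes "poly_function m F" "poly_function m G"
  shows "poly_function m (\<lambda>x. F x * G x)"
  using assms unfolding poly_function_def by (metis peval_mult cox_ring_mult)

lemma poly_function_power: "poly_function m F \<Longrightarrow> poly_function m (\<lambda>x. F x ^ k)"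
  by (induction k) (simp_all add: poly_function_const poly_function_mult)

lemma poly_function_sum:
  "(\<And>i. i \<in> I \<Longrightarrow> poly_function m (F i)) \<Longrightarrow> poly_function m (\<lambda>x. \<Sum>i\<in>I. F i x)"
  by (induction I rule: infinite_finite_induct)
     (simp_all add: poly_function_const poly_function_add)

lemma poly_function_prod:
  "(\<And>i. i \<in> I \<Longrightarrow> poly_function m (F i)) \<Longrightarrow> poly_function m (\<lambda>x. \<Prod>i\<in>I. F i x)"
  by (induction I rule: infinite_finite_induct)
     (simp_all add: poly_function_const poly_function_mult)

lemma poly_function_compose:
  assumes f: "f \<in> cox_ring m" and \<phi>: "\<And>s. s \<in> {1..m} \<Longrightarrow> poly_function m (\<lambda>x. \<phi> x s)"
  shows "poly_function m (\<lambda>x. peval (\<phi> x) f)"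
  unfolding peval_def
proof (intro poly_function_sum poly_function_mult poly_function_const poly_function_prod
    poly_function_power \<phi>)
  fix t s assume "t \<in> Poly_Mapping.keys f" "s \<in> Poly_Mapping.keys t"
  with f show "s \<in> {1..m}" unfolding cox_ring_def by blast
qed

section \<open>The automorphisms of affine space attached to roots\<close>

definition root_monom :: "nat \<Rightarrow> (nat \<Rightarrow> int ^ 'n) \<Rightarrow> nat \<Rightarrow> int ^ 'n \<Rightarrow> (nat \<Rightarrow> 'k::field) \<Rightarrow> 'k" where
  "root_monom m p i e x = (\<Prod>s\<in>{1..m} - {i}. x s ^ nat (pairing e (p s)))"

text \<open>A closed form of the automorphism of affine space with comorphism \<open>exp (\<alpha> \<partial>\<^sub>e)\<close>; see
  \<open>root_aut_affine_eq\<close>.\<close>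

definition root_shift ::
    "nat \<Rightarrow> (nat \<Rightarrow> int ^ 'n) \<Rightarrow> nat \<Rightarrow> int ^ 'n \<Rightarrow> 'k::field \<Rightarrow> (nat \<Rightarrow> 'k) \<Rightarrow> (nat \<Rightarrow> 'k)" where
  "root_shift m p i e \<alpha> x = x(i := x i + \<alpha> * root_monom m p i e x)"

lemma partial_deriv_single:
  "partial_deriv i (Poly_Mapping.single t c)
    = Poly_Mapping.single (t - Poly_Mapping.single i 1) (of_nat (Poly_Mapping.lookup t i) * c)"
  by (simp add: partial_deriv_def)

lemma root_derivation_var:
  "root_derivation m p i e (cox_var s)
    = (if s = i then Poly_Mapping.single (\<Sum>s\<in>{1..m} - {i}. Poly_Mapping.single s (nat (pairing e (p s)))) 1 else 0)"
  by (simp add: root_derivation_def cox_var_def partial_deriv_single lookup_single mult_single)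

text \<open>The monomial of the derivation does not involve \<open>x\<^sub>i\<close>.\<close>

lemma root_derivation_var_twice:
  "root_derivation m p i e (root_derivation m p i e (cox_var s)) = 0"
proof -
  have "Poly_Mapping.lookup (\<Sum>s\<in>{1..m} - {i}. Poly_Mapping.single s (nat (pairing e (p s)))) i = 0"
    by (simp add: lookup_sum lookup_single when_def)
  moreover have "partial_deriv i 0 = (0 :: 'a cox_poly)"
    by (simp add: partial_deriv_def)
  ultimately show ?thesis
    unfolding root_derivation_var by (simp add: root_derivation_def partial_deriv_single flip: One_nat_def)
qed

lemma exp_lnd_square_zero:
  assumes "D (D f) = 0" "D 0 = 0"
  shows "exp_lnd \<alpha> D f = f + Poly_Mapping.single 0 \<alpha> * D f"
proof -
  have zero: "(D ^^ Suc (Suc k)) f = 0" for k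
    by (induction k) (use assms in auto)
  have sub: "{k. (D ^^ k) f \<noteq> 0} \<subseteq> {0, 1}"
  proof
    fix k assume k: "k \<in> {k. (D ^^ k) f \<noteq> 0}"
    show "k \<in> {0, 1}"
    proof (rule ccontr)
      assume "k \<notin> {0, 1}"
      then obtain j where "k = Suc (Suc j)" by (metis One_nat_def insertI1 insertI2 not0_implies_Suc)
      with k zero[of j] show False by auto
    qed
  qed
  have "exp_lnd \<alpha> D f = (\<Sum>k\<in>{0, 1}. Poly_Mapping.single 0 (\<alpha> ^ k / fact k) * (D ^^ k) f)"
    unfolding exp_lnd_def using sub by (intro sum.mono_neutral_left) auto
  then show ?thesis by simp
qed

lemma root_aut_affine_eq:
  assumes "x \<in> extensional {1..m}" "i \<in> {1..m}"
  shows "root_aut_affine m p i e \<alpha> x = root_shift m p i e \<alpha> x"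
proof
  fix s
  show "root_aut_affine m p i e \<alpha> x s = root_shift m p i e \<alpha> x s"
  proof (cases "s \<in> {1..m}")
    case True
    have "root_derivation m p i e 0 = 0"
      by (simp add: root_derivation_def partial_deriv_def)
    then have "exp_lnd \<alpha> (root_derivation m p i e) (cox_var s)
      = cox_var s + Poly_Mapping.single 0 \<alpha> * root_derivation m p i e (cox_var s)"
      by (intro exp_lnd_square_zero root_derivation_var_twice)
    then have "root_aut_affine m p i e \<alpha> x s
      = peval x (cox_var s + Poly_Mapping.single 0 \<alpha> * root_derivation m p i e (cox_var s))"
      using True by (simp add: root_aut_affine_def)
    also have "\<dots> = root_shift m p i e \<alpha> x s"
      by (simp add: peval_add peval_mult root_derivation_var eval_monom_sum
          root_shift_def root_monom_def) (simp add: cox_var_def)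
    finally show ?thesis .
  next
    case False
    then show ?thesis
      using assms by (auto simp: root_aut_affine_def root_shift_def extensional_def)
  qed
qed

lemma root_monom_indep: "root_monom m p i e (x(i := c)) = root_monom m p i e x"
  unfolding root_monom_def by (intro prod.cong) auto

lemma root_shift_add: "root_shift m p i e \<alpha> (root_shift m p i e \<beta> x) = root_shift m p i e (\<alpha> + \<beta>) x"
  by (simp add: root_shift_def root_monom_indep algebra_simps)

lemma root_shift_zero: "root_shift m p i e 0 x = x"
  by (simp add: root_shift_def)

lemma poly_function_root_shift:
  assumes "i \<in> {1..m}" "s \<in> {1..m}"
  shows "poly_function m (\<lambda>x. root_shift m p i e \<alpha> x s)"
proof -
  have "poly_function m (root_monom m p i e)"
    unfolding root_monom_def by (intro poly_function_prod poly_function_power poly_function_coord) auto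
  then show ?thesis
    using assms unfolding root_shift_def
    by (cases "s = i")
       (simp_all add: poly_function_coord, intro poly_function_add poly_function_mult
         poly_function_const poly_function_coord, simp_all)
qed

section \<open>Root automorphisms descend to the toric variety\<close>

lemma power_int_nat: "0 \<le> k \<Longrightarrow> (x :: 'k::field) powi k = x ^ nat k"
  by (simp add: power_int_def)

lemma prod_power_int: "(\<Prod>s\<in>A. (f s :: 'k::field)) powi k = (\<Prod>s\<in>A. f s powi k)"
  by (induction A rule: infinite_finite_induct) (simp_all add: power_int_mult_distrib)

lemma root_atD:
  assumes "e \<in> demazure_roots_at m p i"
  shows "pairing e (p i) = -1" "\<And>s. s \<in> {1..m} \<Longrightarrow> s \<noteq> i \<Longrightarrow> 0 \<le> pairing e (p s)"
  using assms by (auto simp: demazure_roots_at_def)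

context complete_toric
begin

definition zeros :: "(nat \<Rightarrow> 'k::field) \<Rightarrow> nat set" where
  "zeros x = {s\<in>{1..m}. x s = 0}"

text \<open>
  The pullback of the character of \<open>u\<close> to affine space. A negative power of zero is zero here, but
  such powers do not occur where \<open>u\<close> is nonnegative on the chart of \<open>x\<close>.
\<close>

definition character :: "int ^ 'n \<Rightarrow> (nat \<Rightarrow> 'k::field) \<Rightarrow> 'k" where
  "character u x = (\<Prod>s = 1..m. x s powi pairing u (p s))"

lemma cox_space_iff:
  "x \<in> cox_space \<Sigma> m p \<longleftrightarrow> x \<in> extensional {1..m} \<and> in_common_cone (zeros x)"
proof -
  have "(\<forall>s\<in>{1..m}. x s = 0 \<longrightarrow> rvec (p s) \<in> \<tau>) \<longleftrightarrow> zeros x \<subseteq> ray_indices \<tau>" for \<tau>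
    by (auto simp: zeros_def ray_indices_def)
  then show ?thesis by (simp add: cox_space_def PiE_def in_common_cone_def)
qed

lemma cox_map_eq:
  "cox_map \<Sigma> m p x =
    (\<lambda>u. if u \<in> dual_lattice_cone (least_cone (zeros x)) then Some (character u x) else None)"
proof -
  have "{\<tau>\<in>\<Sigma>. \<forall>s\<in>{1..m}. x s = 0 \<longrightarrow> rvec (p s) \<in> \<tau>} = {\<tau>\<in>\<Sigma>. zeros x \<subseteq> ray_indices \<tau>}"
    by (auto simp: zeros_def ray_indices_def)
  then show ?thesis unfolding cox_map_def Let_def least_cone_def character_def by simp
qed

lemma cox_map_eqI:
  assumes "least_cone (zeros x) = least_cone (zeros y)"
    "\<And>u. u \<in> dual_lattice_cone (least_cone (zeros y)) \<Longrightarrow> character u x = character u y"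
  shows "cox_map \<Sigma> m p x = cox_map \<Sigma> m p y"
  using assms by (auto simp: cox_map_eq)

lemma cox_map_eqD:
  assumes x: "x \<in> cox_space \<Sigma> m p" and y: "y \<in> cox_space \<Sigma> m p"
    and eq: "cox_map \<Sigma> m p x = cox_map \<Sigma> m p y"
  shows "least_cone (zeros x) = least_cone (zeros y)"
    "\<And>u. u \<in> dual_lattice_cone (least_cone (zeros x)) \<Longrightarrow> character u x = character u y"
proof -
  have dom: "u \<in> dual_lattice_cone (least_cone (zeros x)) \<longleftrightarrow> u \<in> dual_lattice_cone (least_cone (zeros y))" for u
    using fun_cong[OF eq, of u] by (auto simp: cox_map_eq split: if_splits)
  have "least_cone (zeros x) \<in> \<Sigma>" "least_cone (zeros y) \<in> \<Sigma>"
    using x y by (auto simp: cox_space_iff least_cone_in_fan)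
  then show "least_cone (zeros x) = least_cone (zeros y)"
    using cone_subset_if_dual_subset dom by (meson subsetI subset_antisym)
  show "character u x = character u y" if "u \<in> dual_lattice_cone (least_cone (zeros x))" for u
    using fun_cong[OF eq, of u] that dom[of u] by (simp add: cox_map_eq)
qed

lemma character_zero:
  assumes "s \<in> zeros x" "pairing u (p s) \<noteq> 0"
  shows "character u x = 0"
  unfolding character_def using assms
  by (intro prod_zero[OF finite_atLeastAtMost] bexI[of _ s]) (auto simp: zeros_def power_int_0_left_if)

lemma character_split:
  "i \<in> {1..m} \<Longrightarrow> character u x = x i powi pairing u (p i) * (\<Prod>s\<in>{1..m} - {i}. x s powi pairing u (p s))"
  unfolding character_def by (rule prod.remove) auto

lemma character_upd_zero:
  assumes "i \<in> {1..m}" "pairing u (p i) = 0"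
  shows "character u (x(i := c)) = character u x"
  unfolding character_def using assms by (intro prod.cong) auto

lemma root_monom_powi:
  assumes "e \<in> demazure_roots_at m p i"
  shows "root_monom m p i e x = (\<Prod>s\<in>{1..m} - {i}. x s powi pairing e (p s))"
  unfolding root_monom_def
  using root_atD(2)[OF assms] by (intro prod.cong) (auto simp: power_int_nat)

lemma root_monom_nonzero_iff:
  assumes "e \<in> demazure_roots_at m p i"
  shows "root_monom m p i e x \<noteq> 0 \<longleftrightarrow> (\<forall>s\<in>zeros x - {i}. pairing e (p s) = 0)"
proof -
  have "nat (pairing e (p s)) = 0 \<longleftrightarrow> pairing e (p s) = 0" if "s \<in> {1..m}" "s \<noteq> i" for s
    using root_atD(2)[OF assms that] by auto
  then show ?thesis
    unfolding root_monom_def by (fastforce simp: prod_zero_iff zeros_def)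
qed

lemma least_cone_subset_iff:
  assumes "in_common_cone I" "\<tau> \<in> \<Sigma>"
  shows "I \<subseteq> ray_indices \<tau> \<longleftrightarrow> least_cone I \<subseteq> \<tau>"
  using least_cone_subset[OF assms(2), of I] subset_ray_indices_least_cone[OF assms(1)]
    ray_indices_mono[of "least_cone I" \<tau>] by blast

lemma least_cone_insert_cong:
  assumes "in_common_cone I" "in_common_cone J" "least_cone I = least_cone J"
  shows "least_cone (insert i I) = least_cone (insert i J)"
proof -
  have "{\<tau>\<in>\<Sigma>. insert i I \<subseteq> ray_indices \<tau>} = {\<tau>\<in>\<Sigma>. insert i J \<subseteq> ray_indices \<tau>}"
    using least_cone_subset_iff[OF assms(1)] least_cone_subset_iff[OF assms(2)] assms(3)
    by (metis insert_subset)
  then show ?thesis by (simp add: least_cone_def)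
qed

lemma dual_lattice_cone_antimono: "\<sigma> \<subseteq> \<tau> \<Longrightarrow> dual_lattice_cone \<tau> \<subseteq> dual_lattice_cone \<sigma>"
  by (auto simp: dual_lattice_cone_def)

text \<open>
  The only new zero can be the \<open>i\<close>-th coordinate, and it appears only if \<open>e\<close> vanishes on all rays whose
  coordinates are zero.
\<close>

lemma root_shift_in_cox_space:
  assumes x: "x \<in> cox_space \<Sigma> m p" and i: "i \<in> {1..m}" and e: "e \<in> demazure_roots_at m p i"
  shows "root_shift m p i e \<alpha> x \<in> cox_space \<Sigma> m p"
proof -
  let ?y = "root_shift m p i e \<alpha> x"
  have Z: "in_common_cone (zeros x)" and ext: "x \<in> extensional {1..m}"
    using x by (auto simp: cox_space_iff)
  have sub: "zeros ?y \<subseteq> insert i (zeros x)" by (auto simp: zeros_def root_shift_def)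
  have "in_common_cone (zeros ?y)"
  proof (cases "?y i \<noteq> 0 \<or> x i = 0")
    case True
    then have "zeros ?y \<subseteq> zeros x" using sub i by (auto simp: zeros_def)
    with Z show ?thesis by (rule in_common_cone_mono)
  next
    case False
    then have "root_monom m p i e x \<noteq> 0" by (auto simp: root_shift_def)
    moreover have "i \<notin> zeros x" using False by (simp add: zeros_def)
    ultimately have "in_common_cone (insert i (zeros x))"
      using root_monom_nonzero_iff[OF e] by (intro in_common_cone_insert_root[OF Z e]) auto
    with sub show ?thesis using in_common_cone_mono by blast
  qed
  with ext i show ?thesis by (auto simp: cox_space_iff root_shift_def extensional_def)
qed

text \<open>
  For nonsimplicial fans the \<open>i\<close>-th ray may lie in the least cone of the remaining zero
  coordinates. The chart and the characters that are nonzero at \<open>x\<close> then do not see \<open>x\<^sub>i\<close>.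
\<close>

lemma cox_map_irrelevant_coordinate:
  assumes x: "x \<in> cox_space \<Sigma> m p" and i: "i \<in> ray_indices (least_cone (zeros x - {i}))"
  shows "cox_map \<Sigma> m p (x(i := c)) = cox_map \<Sigma> m p x"
proof -
  let ?I = "zeros x - {i}"
  have im: "i \<in> {1..m}" by (rule subsetD[OF ray_indices_subset i])
  have I: "in_common_cone ?I" using x in_common_cone_mono by (auto simp: cox_space_iff)
  have sub: "?I \<subseteq> ray_indices (least_cone ?I)" by (rule subset_ray_indices_least_cone[OF I])
  have cone: "least_cone J = least_cone ?I" if "?I \<subseteq> J" "J \<subseteq> insert i ?I" for J
    using that sub i by (intro least_cone_absorb(2)[OF I]) auto
  have 1: "least_cone (zeros x) = least_cone ?I" "least_cone (zeros (x(i := c))) = least_cone ?I"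
    by (intro cone; auto simp: zeros_def)+
  show ?thesis
  proof (rule cox_map_eqI)
    fix u assume "u \<in> dual_lattice_cone (least_cone (zeros x))"
    then have u: "u \<in> dual_lattice_cone (least_cone ?I)" by (simp add: 1)
    show "character u (x(i := c)) = character u x"
    proof (cases "\<forall>s\<in>?I. pairing u (p s) = 0")
      case True
      then have "pairing u (p i) = 0" using vanishes_on_least_cone[OF I u _ i] by blast
      then show ?thesis by (rule character_upd_zero[OF im])
    next
      case False
      then obtain s where s: "s \<in> ?I" "pairing u (p s) \<noteq> 0" by blast
      then have "s \<in> zeros x" "s \<in> zeros (x(i := c))" by (auto simp: zeros_def)
      then show ?thesis using character_zero s(2) by metis
    qed
  qed (simp add: 1)
qed

text \<open>
  If the \<open>i\<close>-th ray is not in the cone \<open>\<sigma>\<close> of the point, then the character of \<open>e\<close> is regular at this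
  point, and the shift multiplies \<open>x\<^sub>i\<close> by \<open>c = 1 + \<alpha> \<chi>\<^sup>e\<close>, a number depending only on the point of the
  variety. For \<open>c = 0\<close> the point moves to the least cone containing \<open>\<sigma>\<close> and the \<open>i\<close>-th ray.
\<close>

lemma cox_map_root_shift_cong_outside:
  assumes x: "x \<in> cox_space \<Sigma> m p" and y: "y \<in> cox_space \<Sigma> m p"
    and eq: "cox_map \<Sigma> m p x = cox_map \<Sigma> m p y"
    and i: "i \<in> {1..m}" and e: "e \<in> demazure_roots_at m p i"
    and out: "i \<notin> ray_indices (least_cone (zeros x))"
  shows "cox_map \<Sigma> m p (root_shift m p i e \<alpha> x) = cox_map \<Sigma> m p (root_shift m p i e \<alpha> y)"
proof -
  define \<sigma> where "\<sigma> = least_cone (zeros x)"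
  have Zx: "in_common_cone (zeros x)" and Zy: "in_common_cone (zeros y)"
    using x y by (auto simp: cox_space_iff)
  have \<sigma>y: "least_cone (zeros y) = \<sigma>" using cox_map_eqD(1)[OF x y eq] by (simp add: \<sigma>_def)
  have ch: "character u x = character u y" if "u \<in> dual_lattice_cone \<sigma>" for u
    using cox_map_eqD(2)[OF x y eq] that by (simp add: \<sigma>_def)
  have \<sigma>: "\<sigma> \<in> \<Sigma>" unfolding \<sigma>_def by (rule least_cone_in_fan[OF Zx])
  have ed: "e \<in> dual_lattice_cone \<sigma>"
    unfolding dual_lattice_cone_iff[OF \<sigma>]
  proof
    fix s assume "s \<in> ray_indices \<sigma>"
    then show "0 \<le> pairing e (p s)"
      using out root_atD(2)[OF e, of s] subsetD[OF ray_indices_subset, of s] by (auto simp: \<sigma>_def)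
  qed
  define c where "c = 1 + \<alpha> * character e x"
  have c': "c = 1 + \<alpha> * character e y" using ch[OF ed] by (simp add: c_def)
  have nz: "i \<notin> zeros x" "i \<notin> zeros y"
    using out subset_ray_indices_least_cone[OF Zx] subset_ray_indices_least_cone[OF Zy] \<sigma>y
    by (auto simp: \<sigma>_def)
  have shift: "root_shift m p i e \<alpha> z = z(i := z i * (1 + \<alpha> * character e z))" if "i \<notin> zeros z" for z
  proof -
    have "z i \<noteq> 0" using that i by (auto simp: zeros_def)
    moreover have "character e z = z i powi (- 1) * root_monom m p i e z"
      unfolding character_split[OF i] root_monom_powi[OF e] by (simp add: root_atD(1)[OF e])
    ultimately show ?thesis by (simp add: root_shift_def power_int_minus field_simps)
  qed
  have sx: "root_shift m p i e \<alpha> x = x(i := x i * c)" using shift[OF nz(1)] by (simp add: c_def)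
  have sy: "root_shift m p i e \<alpha> y = y(i := y i * c)" using shift[OF nz(2)] by (simp add: c')
  show ?thesis
  proof (cases "c = 0")
    case False
    have zeq: "zeros (z(i := z i * c)) = zeros z" for z :: "nat \<Rightarrow> 'a"
      using False by (auto simp: zeros_def)
    have chs: "character u (z(i := z i * c)) = character u z * c powi pairing u (p i)" for u and z :: "nat \<Rightarrow> 'a"
    proof -
      have "(\<Prod>s\<in>{1..m} - {i}. (z(i := z i * c)) s powi pairing u (p s))
          = (\<Prod>s\<in>{1..m} - {i}. z s powi pairing u (p s))"
        by (intro prod.cong) auto
      then show ?thesis
        by (simp add: character_split[OF i] power_int_mult_distrib mult_ac)
    qed
    show ?thesis
      unfolding sx sy
      by (rule cox_map_eqI) (use ch \<sigma>y in \<open>auto simp: zeq chs \<sigma>_def\<close>)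
  next
    case True
    have zz: "zeros (z(i := 0)) = insert i (zeros z)" for z :: "nat \<Rightarrow> 'a"
      using i by (auto simp: zeros_def)
    have cone: "least_cone (insert i (zeros x)) = least_cone (insert i (zeros y))"
      by (rule least_cone_insert_cong[OF Zx Zy]) (simp add: \<sigma>y \<sigma>_def)
    show ?thesis
      unfolding sx sy True mult_zero_right
    proof (rule cox_map_eqI)
      show "least_cone (zeros (x(i := 0))) = least_cone (zeros (y(i := 0)))"
        by (simp add: zz cone)
      fix u assume u: "u \<in> dual_lattice_cone (least_cone (zeros (y(i := 0))))"
      show "character u (x(i := 0)) = character u (y(i := 0))"
      proof (cases "pairing u (p i) = 0")
        case True
        have "u \<in> dual_lattice_cone \<sigma>"
          using u dual_lattice_cone_antimono[OF least_cone_mono[of "zeros y" "insert i (zeros y)"]]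
          by (auto simp: zz \<sigma>y)
        with ch True show ?thesis by (simp add: character_upd_zero[OF i])
      next
        case False
        then show ?thesis
          using character_zero[of i "x(i := 0)" u] character_zero[of i "y(i := 0)" u] by (simp add: zz)
      qed
    qed
  qed
qed

text \<open>
  Consider points with the \<open>i\<close>-th ray in their cone. Among these, the points defined here are the only
  ones that the shift can move: the cone is then a pyramid with apex the \<open>i\<close>-th ray over a facet on which
  \<open>e\<close> vanishes, and the shift leads to the orbit of this facet.
\<close>

definition facet_point :: "nat \<Rightarrow> int ^ 'n \<Rightarrow> (nat \<Rightarrow> 'k::field) \<Rightarrow> bool" where
  "facet_point i e x \<longleftrightarrow> i \<notin> ray_indices (least_cone (zeros x - {i})) \<and>
     (\<forall>s\<in>zeros x - {i}. pairing e (p s) = 0)"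

lemma cox_map_root_shift_fixed:
  assumes x: "x \<in> cox_space \<Sigma> m p" and e: "e \<in> demazure_roots_at m p i"
    and n: "\<not> facet_point i e x"
  shows "cox_map \<Sigma> m p (root_shift m p i e \<alpha> x) = cox_map \<Sigma> m p x"
proof (cases "i \<in> ray_indices (least_cone (zeros x - {i}))")
  case True
  then show ?thesis unfolding root_shift_def by (rule cox_map_irrelevant_coordinate[OF x])
next
  case False
  then have "root_monom m p i e x = 0"
    using n root_monom_nonzero_iff[OF e, of x] by (auto simp: facet_point_def)
  then show ?thesis by (simp add: root_shift_def)
qed

text \<open>
  Let \<open>u\<close> expose the facet cone \<open>\<tau>\<close> of \<open>\<sigma>\<close>. The combination \<open>\<langle>u, p\<^sub>i\<rangle> e + u\<close> is zero at \<open>p\<^sub>i\<close> and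
  nonnegative on the other rays, and it vanishes on the rays that define \<open>\<sigma>\<close>. It therefore vanishes on
  \<open>\<sigma>\<close>, and so do both of its summands on all rays other than the \<open>i\<close>-th.
\<close>

lemma facet_point_other_rays:
  assumes x: "x \<in> cox_space \<Sigma> m p" and e: "e \<in> demazure_roots_at m p i"
    and i: "i \<in> ray_indices (least_cone (zeros x))" and f: "facet_point i e x"
  shows "i \<in> zeros x"
    "\<And>l. l \<in> ray_indices (least_cone (zeros x)) \<Longrightarrow> l \<noteq> i \<Longrightarrow>
      l \<in> ray_indices (least_cone (zeros x - {i})) \<and> pairing e (p l) = 0"
proof -
  let ?\<sigma> = "least_cone (zeros x)" and ?\<tau> = "least_cone (zeros x - {i})"
  have Z: "in_common_cone (zeros x)" using x by (simp add: cox_space_iff)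
  then have Z': "in_common_cone (zeros x - {i})" using in_common_cone_mono by blast
  show iz: "i \<in> zeros x"
  proof (rule ccontr)
    assume "i \<notin> zeros x"
    then have "zeros x - {i} = zeros x" by auto
    with i f show False by (simp add: facet_point_def)
  qed
  note \<sigma> = least_cone_in_fan[OF Z]
  obtain u where u: "u \<in> dual_lattice_cone ?\<sigma>"
    "\<And>s. s \<in> ray_indices ?\<sigma> \<Longrightarrow> pairing u (p s) = 0 \<longleftrightarrow> s \<in> ray_indices ?\<tau>"
    by (rule exposing_functional[OF \<sigma> least_cone_in_fan[OF Z'] least_cone_mono]) auto
  have pos: "0 \<le> pairing u (p s)" if "s \<in> ray_indices ?\<sigma>" for s
    using u(1) that by (simp add: dual_lattice_cone_iff[OF \<sigma>])
  have epos: "0 \<le> pairing e (p s)" if "s \<in> ray_indices ?\<sigma>" "s \<noteq> i" for s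
    using root_atD(2)[OF e, of s] that ray_indices_subset by blast
  have ui: "pairing u (p i) > 0"
    using pos[OF i] u(2)[OF i] f by (auto simp: facet_point_def)
  define w where "w = pairing u (p i) *s e + u"
  have w: "pairing w x = pairing u (p i) * pairing e x + pairing u x" for x
    by (simp add: w_def pairing_linear)
  have wd: "w \<in> dual_lattice_cone ?\<sigma>"
    unfolding dual_lattice_cone_iff[OF \<sigma>]
  proof
    fix s assume s: "s \<in> ray_indices ?\<sigma>"
    show "0 \<le> pairing w (p s)"
    proof (cases "s = i")
      case True
      then show ?thesis by (simp add: w root_atD(1)[OF e])
    next
      case False
      then show ?thesis using epos[OF s] pos[OF s] ui by (simp add: w)
    qed
  qed
  have wz: "pairing w (p s) = 0" if s: "s \<in> zeros x" for s
  proof (cases "s = i")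
    case True
    then show ?thesis by (simp add: w root_atD(1)[OF e])
  next
    case False
    then have "s \<in> ray_indices ?\<tau>" "s \<in> ray_indices ?\<sigma>" "pairing e (p s) = 0"
      using s subset_ray_indices_least_cone[OF Z] subset_ray_indices_least_cone[OF Z'] f
      by (auto simp: facet_point_def)
    then show ?thesis using u(2) by (simp add: w)
  qed
  show "l \<in> ray_indices ?\<tau> \<and> pairing e (p l) = 0" if l: "l \<in> ray_indices ?\<sigma>" "l \<noteq> i" for l
  proof -
    have "pairing u (p i) * pairing e (p l) + pairing u (p l) = 0"
      using vanishes_on_least_cone[OF Z wd wz l(1)] by (simp add: w)
    moreover have "0 \<le> pairing u (p i) * pairing e (p l)" using epos[OF l] ui by simp
    ultimately have "pairing u (p l) = 0" "pairing u (p i) * pairing e (p l) = 0"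
      using pos[OF l(1)] by linarith+
    then show ?thesis using u(2)[OF l(1)] ui by simp
  qed
qed

text \<open>Being a pyramid over a facet is a property of the cone, which two points with the same image share.\<close>

lemma facet_point_transfer:
  assumes x: "x \<in> cox_space \<Sigma> m p" and y: "y \<in> cox_space \<Sigma> m p"
    and e: "e \<in> demazure_roots_at m p i"
    and same: "least_cone (zeros x) = least_cone (zeros y)"
    and i: "i \<in> ray_indices (least_cone (zeros x))" and f: "facet_point i e x"
  shows "facet_point i e y" "least_cone (zeros y - {i}) \<subseteq> least_cone (zeros x - {i})"
proof -
  have "zeros y \<subseteq> ray_indices (least_cone (zeros x))"
    using y subset_ray_indices_least_cone by (auto simp: same cox_space_iff)
  then have *: "s \<in> ray_indices (least_cone (zeros x - {i})) \<and> pairing e (p s) = 0"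
    if "s \<in> zeros y - {i}" for s
    using facet_point_other_rays(2)[OF x e i f] that by blast
  have "in_common_cone (zeros x - {i})"
    using x in_common_cone_mono by (auto simp: cox_space_iff)
  then show sub: "least_cone (zeros y - {i}) \<subseteq> least_cone (zeros x - {i})"
    using * by (intro least_cone_subset least_cone_in_fan) auto
  then show "facet_point i e y"
    using * f ray_indices_mono[OF sub] by (auto simp: facet_point_def)
qed

text \<open>
  Since \<open>x\<^sub>i = 0\<close>, the new coordinate is \<open>\<alpha>\<close> times the monomial of \<open>e\<close>; the functional
  \<open>u + \<langle>u, p\<^sub>i\<rangle> e\<close> is zero at \<open>p\<^sub>i\<close>, hence expresses the characters after the shift by those before it.
\<close>

lemma facet_point_root_shift:
  assumes x: "x \<in> cox_space \<Sigma> m p" and e: "e \<in> demazure_roots_at m p i"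
    and i: "i \<in> ray_indices (least_cone (zeros x))" and f: "facet_point i e x" and \<alpha>: "\<alpha> \<noteq> 0"
  shows "zeros (root_shift m p i e \<alpha> x) = zeros x - {i}"
    "character u (root_shift m p i e \<alpha> x)
      = \<alpha> powi pairing u (p i) * character (u + pairing u (p i) *s e) x"
    "u \<in> dual_lattice_cone (least_cone (zeros x - {i})) \<Longrightarrow>
      u + pairing u (p i) *s e \<in> dual_lattice_cone (least_cone (zeros x))"
proof -
  have im: "i \<in> {1..m}" by (rule subsetD[OF ray_indices_subset i])
  have Z: "in_common_cone (zeros x)" using x by (simp add: cox_space_iff)
  have iz: "i \<in> zeros x" by (rule facet_point_other_rays(1)[OF x e i f])
  then have xi: "x i = 0" by (simp add: zeros_def)
  have mon: "root_monom m p i e x \<noteq> 0"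
    using f unfolding root_monom_nonzero_iff[OF e] facet_point_def by blast
  have y: "root_shift m p i e \<alpha> x = x(i := \<alpha> * root_monom m p i e x)"
    by (simp add: root_shift_def xi)
  show "zeros (root_shift m p i e \<alpha> x) = zeros x - {i}"
    unfolding y using mon \<alpha> by (auto simp: zeros_def)
  let ?k = "pairing u (p i)"
  have w: "pairing (u + ?k *s e) z = pairing u z + ?k * pairing e z" for z
    by (simp add: pairing_linear)
  have "root_monom m p i e x powi ?k = (\<Prod>s\<in>{1..m} - {i}. x s powi (pairing e (p s) * ?k))"
    unfolding root_monom_powi[OF e] by (simp add: prod_power_int power_int_mult)
  moreover have "(\<Prod>s\<in>{1..m} - {i}. (x(i := \<alpha> * root_monom m p i e x)) s powi pairing u (p s))
      = (\<Prod>s\<in>{1..m} - {i}. x s powi pairing u (p s))"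
    by (intro prod.cong) auto
  moreover have "x s powi (pairing e (p s) * ?k) * x s powi pairing u (p s)
      = x s powi (pairing u (p s) + ?k * pairing e (p s))" if s: "s \<in> {1..m} - {i}" for s
  proof (cases "x s = 0")
    case True
    then have "pairing e (p s) = 0" using s f by (auto simp: facet_point_def zeros_def)
    then show ?thesis by simp
  next
    case False
    then show ?thesis by (simp add: power_int_add mult_ac)
  qed
  ultimately show "character u (root_shift m p i e \<alpha> x) = \<alpha> powi ?k * character (u + ?k *s e) x"
    unfolding y character_split[OF im] w
    by (simp add: power_int_mult_distrib root_atD(1)[OF e] mult.assoc flip: prod.distrib)
  assume "u \<in> dual_lattice_cone (least_cone (zeros x - {i}))"
  moreover have "in_common_cone (zeros x - {i})" using Z in_common_cone_mono by blast
  ultimately have "0 \<le> pairing u (p s)" if "s \<in> ray_indices (least_cone (zeros x - {i}))" for s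
    using that by (simp add: dual_lattice_cone_iff least_cone_in_fan)
  then show "u + ?k *s e \<in> dual_lattice_cone (least_cone (zeros x))"
    unfolding dual_lattice_cone_iff[OF least_cone_in_fan[OF Z]] w
    using facet_point_other_rays(2)[OF x e i f] root_atD(1)[OF e] by (metis add.right_inverse
        mult_minus1_right mult_zero_right add.right_neutral order_refl)
qed

text \<open>
  If the cone of the two points contains the \<open>i\<close>-th ray, then either both are facet points, with the
  same facet, or the shift moves neither of their images.
\<close>

lemma cox_map_root_shift_cong:
  assumes x: "x \<in> cox_space \<Sigma> m p" and y: "y \<in> cox_space \<Sigma> m p"
    and eq: "cox_map \<Sigma> m p x = cox_map \<Sigma> m p y"
    and i: "i \<in> {1..m}" and e: "e \<in> demazure_roots_at m p i"
  shows "cox_map \<Sigma> m p (root_shift m p i e \<alpha> x) = cox_map \<Sigma> m p (root_shift m p i e \<alpha> y)"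
proof (cases "i \<in> ray_indices (least_cone (zeros x))")
  case False
  then show ?thesis by (rule cox_map_root_shift_cong_outside[OF x y eq i e])
next
  case ix: True
  have same: "least_cone (zeros x) = least_cone (zeros y)" by (rule cox_map_eqD(1)[OF x y eq])
  have iy: "i \<in> ray_indices (least_cone (zeros y))" using ix by (simp add: same)
  show ?thesis
  proof (cases "facet_point i e x \<and> \<alpha> \<noteq> 0")
    case False
    show ?thesis
    proof (cases "\<alpha> = 0")
      case True
      then show ?thesis using eq by (simp add: root_shift_zero)
    next
      case \<alpha>: False
      with False have fx: "\<not> facet_point i e x" by simp
      then have "\<not> facet_point i e y"
        using facet_point_transfer(1)[OF y x e same[symmetric] iy] by blast
      then show ?thesis
        using cox_map_root_shift_fixed[OF x e fx] cox_map_root_shift_fixed[OF y e] eq by metis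
    qed
  next
    case True
    then have fx: "facet_point i e x" and \<alpha>: "\<alpha> \<noteq> 0" by auto
    note fy = facet_point_transfer(1)[OF x y e same ix fx]
    have facet: "least_cone (zeros x - {i}) = least_cone (zeros y - {i})"
      using facet_point_transfer(2)[OF x y e same ix fx]
        facet_point_transfer(2)[OF y x e same[symmetric] iy fy] by blast
    show ?thesis
    proof (rule cox_map_eqI)
      show "least_cone (zeros (root_shift m p i e \<alpha> x)) = least_cone (zeros (root_shift m p i e \<alpha> y))"
        unfolding facet_point_root_shift(1)[OF x e ix fx \<alpha>] facet_point_root_shift(1)[OF y e iy fy \<alpha>]
        by (rule facet)
      fix u assume "u \<in> dual_lattice_cone (least_cone (zeros (root_shift m p i e \<alpha> y)))"
      then have "u \<in> dual_lattice_cone (least_cone (zeros x - {i}))"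
        unfolding facet_point_root_shift(1)[OF y e iy fy \<alpha>] facet .
      then have "u + pairing u (p i) *s e \<in> dual_lattice_cone (least_cone (zeros x))"
        by (rule facet_point_root_shift(3)[OF x e ix fx \<alpha>])
      then show "character u (root_shift m p i e \<alpha> x) = character u (root_shift m p i e \<alpha> y)"
        unfolding facet_point_root_shift(2)[OF x e ix fx \<alpha>] facet_point_root_shift(2)[OF y e iy fy \<alpha>]
        using cox_map_eqD(2)[OF x y eq] by simp
    qed
  qed
qed

end

section \<open>Root automorphisms of the toric variety\<close>

context complete_toric
begin

abbreviation X :: "('n, 'k::field_char_0) tpoint set" where
  "X \<equiv> toric_variety \<Sigma> m p"

abbreviation Aut :: "(('n, 'k::field_char_0) tpoint \<Rightarrow> ('n, 'k) tpoint) monoid" where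
  "Aut \<equiv> toric_Aut \<Sigma> m p"

lemma cox_map_in_X: "x \<in> cox_space \<Sigma> m p \<Longrightarrow> cox_map \<Sigma> m p x \<in> X"
  by (simp add: toric_variety_def)

lemma cox_regular_cong:
  assumes "\<And>y. y \<in> W \<Longrightarrow> f y = g y"
  shows "cox_regular m W f \<longleftrightarrow> cox_regular m W g"
  using assms unfolding cox_regular_def by simp

lemma toric_regular_cong:
  assumes "\<And>P. P \<in> V \<Longrightarrow> f P = g P"
  shows "toric_regular \<Sigma> m p V f \<longleftrightarrow> toric_regular \<Sigma> m p V g"
  unfolding toric_regular_def by (rule cox_regular_cong) (simp add: assms)

lemma toric_morphism_cong:
  fixes \<psi> \<omega> :: "('n, 'k::field_char_0) tpoint \<Rightarrow> ('n, 'k) tpoint"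
  assumes "\<And>P. P \<in> X \<Longrightarrow> \<psi> P = \<omega> P" and \<omega>: "toric_morphism \<Sigma> m p \<omega>"
  shows "toric_morphism \<Sigma> m p \<psi>"
proof -
  have pre: "{P \<in> X. \<psi> P \<in> V} = {P \<in> X. \<omega> P \<in> V}" for V using assms(1) by auto
  have "toric_regular \<Sigma> m p {P \<in> X. \<omega> P \<in> V} (f \<circ> \<psi>) \<longleftrightarrow>
      toric_regular \<Sigma> m p {P \<in> X. \<omega> P \<in> V} (f \<circ> \<omega>)" for V f
    using assms(1) by (intro toric_regular_cong) auto
  moreover have "\<psi> ` X = \<omega> ` X" using assms(1) by (intro image_cong) auto
  ultimately show ?thesis using \<omega> unfolding toric_morphism_def pre by simp
qed

lemma toric_morphismD:
  assumes "toric_morphism \<Sigma> m p \<psi>"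
  shows "P \<in> X \<Longrightarrow> \<psi> P \<in> X"
    "toric_open \<Sigma> m p V \<Longrightarrow> toric_open \<Sigma> m p {P \<in> X. \<psi> P \<in> V}"
    "toric_open \<Sigma> m p V \<Longrightarrow> toric_regular \<Sigma> m p V f \<Longrightarrow>
      toric_regular \<Sigma> m p {P \<in> X. \<psi> P \<in> V} (f \<circ> \<psi>)"
proof -
  note * = assms[unfolded toric_morphism_def]
  show "P \<in> X \<Longrightarrow> \<psi> P \<in> X" using conjunct1[OF *] by (rule subsetD) (rule imageI)
  show "toric_open \<Sigma> m p V \<Longrightarrow> toric_open \<Sigma> m p {P \<in> X. \<psi> P \<in> V}"
    by (rule conjunct1[OF conjunct2[OF *, rule_format]])
  show "toric_open \<Sigma> m p V \<Longrightarrow> toric_regular \<Sigma> m p V f \<Longrightarrow>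
      toric_regular \<Sigma> m p {P \<in> X. \<psi> P \<in> V} (f \<circ> \<psi>)"
    by (rule conjunct2[OF conjunct2[OF *, rule_format], rule_format])
qed

lemma toric_morphismI:
  assumes "\<And>P. P \<in> X \<Longrightarrow> \<psi> P \<in> X"
    and "\<And>V. toric_open \<Sigma> m p V \<Longrightarrow> toric_open \<Sigma> m p {P \<in> X. \<psi> P \<in> V}"
    and "\<And>V f. toric_open \<Sigma> m p V \<Longrightarrow> toric_regular \<Sigma> m p V f \<Longrightarrow>
      toric_regular \<Sigma> m p {P \<in> X. \<psi> P \<in> V} (f \<circ> \<psi>)"
  shows "toric_morphism \<Sigma> m p \<psi>"
  unfolding toric_morphism_def by (intro conjI allI impI image_subsetI assms)

lemma toric_morphism_compose:
  fixes \<psi> \<omega> :: "('n, 'k::field_char_0) tpoint \<Rightarrow> ('n, 'k) tpoint"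
  assumes \<psi>: "toric_morphism \<Sigma> m p \<psi>" and \<omega>: "toric_morphism \<Sigma> m p \<omega>"
  shows "toric_morphism \<Sigma> m p (\<psi> \<circ> \<omega>)"
proof (rule toric_morphismI)
  have pre: "{P \<in> X. (\<psi> \<circ> \<omega>) P \<in> V} = {P \<in> X. \<omega> P \<in> {Q \<in> X. \<psi> Q \<in> V}}" for V
    using toric_morphismD(1)[OF \<omega>] by auto
  show "(\<psi> \<circ> \<omega>) P \<in> X" if "P \<in> X" for P
    using toric_morphismD(1)[OF \<psi> toric_morphismD(1)[OF \<omega> that]] by simp
  fix V :: "('n, 'k) tpoint set" assume V: "toric_open \<Sigma> m p V"
  note V' = toric_morphismD(2)[OF \<psi> V]
  show "toric_open \<Sigma> m p {P \<in> X. (\<psi> \<circ> \<omega>) P \<in> V}"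
    unfolding pre by (rule toric_morphismD(2)[OF \<omega> V'])
  show "toric_regular \<Sigma> m p {P \<in> X. (\<psi> \<circ> \<omega>) P \<in> V} (f \<circ> (\<psi> \<circ> \<omega>))"
    if "toric_regular \<Sigma> m p V f" for f
    unfolding pre comp_assoc[symmetric]
    by (rule toric_morphismD(3)[OF \<omega> V' toric_morphismD(3)[OF \<psi> V that]])
qed

lemma toric_morphism_id:
  "toric_morphism \<Sigma> m p (\<lambda>P :: ('n, 'k::field_char_0) tpoint. P)"
proof -
  have "{P \<in> X. P \<in> V} = V" if "toric_open \<Sigma> m p V" for V :: "('n, 'k) tpoint set"
    using that by (auto simp: toric_open_def)
  then show ?thesis by (intro toric_morphismI) (simp_all add: comp_def)
qed

text \<open>Any morphism that is a left inverse may take the place of the inverse function in the definition.\<close>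

lemma carrier_Aut_iff:
  "\<psi> \<in> carrier Aut \<longleftrightarrow> \<psi> \<in> Bij X \<and> toric_morphism \<Sigma> m p \<psi> \<and>
    (\<exists>\<omega>. toric_morphism \<Sigma> m p \<omega> \<and> (\<forall>P\<in>X. \<omega> (\<psi> P) = P))"
proof
  assume "\<psi> \<in> carrier Aut"
  then have \<psi>: "\<psi> \<in> Bij X" "toric_morphism \<Sigma> m p \<psi>" "toric_morphism \<Sigma> m p (inv_into X \<psi>)"
    by (auto simp: toric_Aut_def)
  moreover have "\<forall>P\<in>X. inv_into X \<psi> (\<psi> P) = P"
    using \<psi>(1) by (auto simp: Bij_def bij_betw_def)
  ultimately show "\<psi> \<in> Bij X \<and> toric_morphism \<Sigma> m p \<psi> \<and>
    (\<exists>\<omega>. toric_morphism \<Sigma> m p \<omega> \<and> (\<forall>P\<in>X. \<omega> (\<psi> P) = P))" by blast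
next
  assume "\<psi> \<in> Bij X \<and> toric_morphism \<Sigma> m p \<psi> \<and>
    (\<exists>\<omega>. toric_morphism \<Sigma> m p \<omega> \<and> (\<forall>P\<in>X. \<omega> (\<psi> P) = P))"
  then obtain \<omega> where \<psi>: "\<psi> \<in> Bij X" "toric_morphism \<Sigma> m p \<psi>"
    and \<omega>: "toric_morphism \<Sigma> m p \<omega>" "\<And>P. P \<in> X \<Longrightarrow> \<omega> (\<psi> P) = P" by blast
  have "inv_into X \<psi> Q = \<omega> Q" if Q: "Q \<in> X" for Q
  proof -
    have "\<psi> ` X = X" using \<psi>(1) by (simp add: Bij_def bij_betw_def)
    then have "inv_into X \<psi> Q \<in> X" "\<psi> (inv_into X \<psi> Q) = Q"
      using Q by (auto simp: inv_into_into f_inv_into_f)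
    then show ?thesis using \<omega>(2)[of "inv_into X \<psi> Q"] by simp
  qed
  then have "toric_morphism \<Sigma> m p (inv_into X \<psi>)" by (rule toric_morphism_cong[OF _ \<omega>(1)])
  with \<psi> show "\<psi> \<in> carrier Aut" by (simp add: toric_Aut_def)
qed

lemma Aut_mult: "\<psi> \<in> carrier Aut \<Longrightarrow> \<omega> \<in> carrier Aut \<Longrightarrow> \<psi> \<otimes>\<^bsub>Aut\<^esub> \<omega> = compose X \<psi> \<omega>"
  by (simp add: carrier_Aut_iff) (simp add: toric_Aut_def BijGroup_def)

lemma Aut_one: "\<one>\<^bsub>Aut\<^esub> = (\<lambda>P\<in>X. P)"
  by (simp add: toric_Aut_def BijGroup_def)

lemma group_Aut: "group (Aut :: (('n, 'k::field_char_0) tpoint \<Rightarrow> ('n, 'k) tpoint) monoid)"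
proof -
  let ?H = "carrier (Aut :: (('n, 'k) tpoint \<Rightarrow> ('n, 'k) tpoint) monoid)"
  interpret B: group "BijGroup (X :: ('n, 'k) tpoint set)" by (rule group_BijGroup)
  have "subgroup ?H (BijGroup X)"
  proof
    show "?H \<subseteq> carrier (BijGroup X)" by (auto simp: carrier_Aut_iff BijGroup_def)
    have "toric_morphism \<Sigma> m p (\<lambda>P\<in>X. P :: ('n, 'k) tpoint)"
      by (rule toric_morphism_cong[OF _ toric_morphism_id]) simp
    then have "(\<lambda>P\<in>X. P) \<in> ?H"
      unfolding carrier_Aut_iff using id_Bij toric_morphism_id by fastforce
    then show "\<one>\<^bsub>BijGroup X\<^esub> \<in> ?H" by (simp add: BijGroup_def)
  next
    fix \<psi> \<omega> assume "\<psi> \<in> ?H" "\<omega> \<in> ?H"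
    then obtain \<psi>' \<omega>' where *: "\<psi> \<in> Bij X" "\<omega> \<in> Bij X" "toric_morphism \<Sigma> m p \<psi>" "toric_morphism \<Sigma> m p \<omega>"
      "toric_morphism \<Sigma> m p \<psi>'" "toric_morphism \<Sigma> m p \<omega>'"
      "\<And>P. P \<in> X \<Longrightarrow> \<psi>' (\<psi> P) = P" "\<And>P. P \<in> X \<Longrightarrow> \<omega>' (\<omega> P) = P"
      unfolding carrier_Aut_iff by blast
    have \<omega>X: "\<omega> P \<in> X" if "P \<in> X" for P using toric_morphismD(1)[OF *(4) that] .
    have "toric_morphism \<Sigma> m p (compose X \<psi> \<omega>)"
      by (rule toric_morphism_cong[OF _ toric_morphism_compose[OF *(3,4)]]) (simp add: compose_def)
    moreover have "\<forall>P\<in>X. (\<omega>' \<circ> \<psi>') (compose X \<psi> \<omega> P) = P"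
      using * \<omega>X by (simp add: compose_def)
    ultimately have "compose X \<psi> \<omega> \<in> ?H"
      unfolding carrier_Aut_iff using compose_Bij[OF *(1,2)] toric_morphism_compose[OF *(6,5)] by blast
    with * show "\<psi> \<otimes>\<^bsub>BijGroup X\<^esub> \<omega> \<in> ?H" by (simp add: BijGroup_def)
  next
    fix \<psi> assume "\<psi> \<in> ?H"
    then have \<psi>: "\<psi> \<in> Bij X" "toric_morphism \<Sigma> m p \<psi>" "toric_morphism \<Sigma> m p (inv_into X \<psi>)"
      by (auto simp: toric_Aut_def)
    have "toric_morphism \<Sigma> m p (\<lambda>P\<in>X. inv_into X \<psi> P)"
      by (rule toric_morphism_cong[OF _ \<psi>(3)]) simp
    moreover have "\<forall>P\<in>X. \<psi> ((\<lambda>P\<in>X. inv_into X \<psi> P) P) = P"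
      using \<psi>(1) by (auto simp: Bij_def bij_betw_def f_inv_into_f)
    ultimately have "(\<lambda>P\<in>X. inv_into X \<psi> P) \<in> ?H"
      unfolding carrier_Aut_iff using restrict_inv_into_Bij[OF \<psi>(1)] \<psi>(2) by blast
    then show "inv\<^bsub>BijGroup X\<^esub> \<psi> \<in> ?H" using inv_BijGroup[OF \<psi>(1)] by simp
  qed
  then have "group (BijGroup X\<lparr>carrier := ?H\<rparr>)" by (rule subgroup.subgroup_is_group) (rule B.is_group)
  moreover have "BijGroup X\<lparr>carrier := ?H\<rparr> = Aut" by (simp add: toric_Aut_def)
  ultimately show ?thesis by simp
qed

text \<open>
  Identities between automorphisms of the variety are checked on the substitutions of the Cox
  coordinates that induce them; see \<open>lifted_by_mult\<close> and \<open>lifted_by_unique\<close>.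
\<close>

definition lifted_by ::
    "(('n, 'k::field_char_0) tpoint \<Rightarrow> ('n, 'k) tpoint) \<Rightarrow> ((nat \<Rightarrow> 'k) \<Rightarrow> (nat \<Rightarrow> 'k)) \<Rightarrow> bool" where
  "lifted_by \<psi> \<phi> \<longleftrightarrow> \<psi> \<in> carrier Aut \<and>
    (\<forall>x\<in>cox_space \<Sigma> m p. \<phi> x \<in> cox_space \<Sigma> m p \<and> \<psi> (cox_map \<Sigma> m p x) = cox_map \<Sigma> m p (\<phi> x))"

lemma lifted_by_mult:
  assumes "lifted_by \<psi> \<phi>" "lifted_by \<psi>' \<phi>'"
  shows "lifted_by (\<psi> \<otimes>\<^bsub>Aut\<^esub> \<psi>') (\<lambda>x. \<phi> (\<phi>' x))"
proof -
  have c: "\<psi> \<in> carrier Aut" "\<psi>' \<in> carrier Aut" using assms by (auto simp: lifted_by_def)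
  then have "\<psi> \<otimes>\<^bsub>Aut\<^esub> \<psi>' \<in> carrier Aut" by (rule monoid.m_closed[OF group.is_monoid[OF group_Aut]])
  then show ?thesis
    using assms by (simp add: lifted_by_def Aut_mult[OF c] compose_def cox_map_in_X)
qed

lemma lifted_by_one: "lifted_by \<one>\<^bsub>Aut\<^esub> (\<lambda>x. x)"
  using monoid.one_closed[OF group.is_monoid[OF group_Aut]]
  by (simp add: lifted_by_def Aut_one cox_map_in_X)

lemma lifted_by_unique:
  assumes "lifted_by \<psi> \<phi>" "lifted_by \<psi>' \<phi>'"
    and "\<And>x. x \<in> cox_space \<Sigma> m p \<Longrightarrow> \<phi> x = \<phi>' x"
  shows "\<psi> = \<psi>'"
proof (rule extensionalityI[of _ X])
  show "\<psi> \<in> extensional X" "\<psi>' \<in> extensional X"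
    using assms(1,2) by (auto simp: lifted_by_def carrier_Aut_iff Bij_def)
  fix P :: "('n, 'a) tpoint" assume "P \<in> X"
  then obtain x :: "nat \<Rightarrow> 'a" where "x \<in> cox_space \<Sigma> m p" "P = cox_map \<Sigma> m p x"
    by (auto simp: toric_variety_def)
  then show "\<psi> P = \<psi>' P" using assms by (simp add: lifted_by_def)
qed

definition root_auto :: "nat \<Rightarrow> int ^ 'n \<Rightarrow> 'k::field_char_0 \<Rightarrow> ('n, 'k) tpoint \<Rightarrow> ('n, 'k) tpoint" where
  "root_auto i e \<alpha> = (\<lambda>P\<in>X. cox_map \<Sigma> m p
     (root_shift m p i e \<alpha> (SOME x. x \<in> cox_space \<Sigma> m p \<and> cox_map \<Sigma> m p x = P)))"

lemma root_auto_cox_map: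
  assumes i: "i \<in> {1..m}" "e \<in> demazure_roots_at m p i" and x: "x \<in> cox_space \<Sigma> m p"
  shows "root_auto i e \<alpha> (cox_map \<Sigma> m p x) = cox_map \<Sigma> m p (root_shift m p i e \<alpha> x)"
proof -
  let ?y = "SOME y. y \<in> cox_space \<Sigma> m p \<and> cox_map \<Sigma> m p y = cox_map \<Sigma> m p x"
  have "?y \<in> cox_space \<Sigma> m p \<and> cox_map \<Sigma> m p ?y = cox_map \<Sigma> m p x"
    using someI[of "\<lambda>y. y \<in> cox_space \<Sigma> m p \<and> cox_map \<Sigma> m p y = cox_map \<Sigma> m p x" x] x by simp
  then show ?thesis
    using cox_map_root_shift_cong[OF _ x _ i, of ?y \<alpha>] cox_map_in_X[OF x] by (simp add: root_auto_def)
qed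

lemma cox_open_root_shift:
  assumes i: "i \<in> {1..m}" "e \<in> demazure_roots_at m p i" and W: "cox_open \<Sigma> m p W"
  shows "cox_open \<Sigma> m p {x \<in> cox_space \<Sigma> m p. root_shift m p i e \<alpha> x \<in> W}"
proof -
  obtain F where F: "F \<subseteq> cox_ring m" "W = {x \<in> cox_space \<Sigma> m p. \<exists>f\<in>F. peval x f \<noteq> 0}"
    using W by (auto simp: cox_open_def)
  have "\<exists>g\<in>cox_ring m. \<forall>x. peval x g = peval (root_shift m p i e \<alpha> x) f" if "f \<in> F" for f
    using poly_function_compose[of f m "root_shift m p i e \<alpha>"] poly_function_root_shift[OF i(1)] F that
    unfolding poly_function_def by blast
  then obtain T where T: "\<And>f. f \<in> F \<Longrightarrow> T f \<in> cox_ring m \<and> (\<forall>x. peval x (T f) = peval (root_shift m p i e \<alpha> x) f)"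
    by metis
  have "{x \<in> cox_space \<Sigma> m p. root_shift m p i e \<alpha> x \<in> W} = {x \<in> cox_space \<Sigma> m p. \<exists>g\<in>T ` F. peval x g \<noteq> 0}"
    using T F(2) root_shift_in_cox_space[OF _ i] by auto
  moreover have "T ` F \<subseteq> cox_ring m" using T by auto
  ultimately show ?thesis unfolding cox_open_def by blast
qed

lemma cox_regular_root_shift:
  assumes i: "i \<in> {1..m}" "e \<in> demazure_roots_at m p i" and f: "cox_regular m W f"
  shows "cox_regular m {x \<in> cox_space \<Sigma> m p. root_shift m p i e \<alpha> x \<in> W} (\<lambda>x. f (root_shift m p i e \<alpha> x))"
  unfolding cox_regular_def
proof
  let ?\<phi> = "root_shift m p i e \<alpha>"
  have pull: "\<exists>g'\<in>cox_ring m. \<forall>x. peval x g' = peval (?\<phi> x) g" if "g \<in> cox_ring m" for g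
    using poly_function_compose[OF that, of ?\<phi>] poly_function_root_shift[OF i(1)]
    unfolding poly_function_def by blast
  fix x assume "x \<in> {x \<in> cox_space \<Sigma> m p. ?\<phi> x \<in> W}"
  then have "?\<phi> x \<in> W" by simp
  then obtain g h where gh: "g \<in> cox_ring m" "h \<in> cox_ring m" "peval (?\<phi> x) h \<noteq> 0"
    "\<And>y. y \<in> W \<Longrightarrow> peval y h \<noteq> 0 \<Longrightarrow> f y = peval y g / peval y h"
    using f unfolding cox_regular_def by blast
  obtain g' where g': "g' \<in> cox_ring m" "\<And>x. peval x g' = peval (?\<phi> x) g"
    using pull[OF gh(1)] by blast
  obtain h' where h': "h' \<in> cox_ring m" "\<And>x. peval x h' = peval (?\<phi> x) h"
    using pull[OF gh(2)] by blast
  show "\<exists>g\<in>cox_ring m. \<exists>h\<in>cox_ring m. peval x h \<noteq> 0 \<and>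
      (\<forall>y\<in>{x \<in> cox_space \<Sigma> m p. ?\<phi> x \<in> W}. peval y h \<noteq> 0 \<longrightarrow> f (?\<phi> y) = peval y g / peval y h)"
    by (rule bexI[OF _ g'(1)], rule bexI[OF _ h'(1)]) (use gh g' h' in auto)
qed

lemma toric_morphism_root_auto:
  assumes i: "i \<in> {1..m}" "e \<in> demazure_roots_at m p i"
  shows "toric_morphism \<Sigma> m p (root_auto i e (\<alpha> :: 'k::field_char_0))"
proof -
  let ?\<phi> = "root_shift m p i e \<alpha> :: (nat \<Rightarrow> 'k) \<Rightarrow> _" and ?\<psi> = "root_auto i e \<alpha>"
  note act = root_auto_cox_map[OF i]
  note stab = root_shift_in_cox_space[OF _ i]
  have pre: "{x \<in> cox_space \<Sigma> m p. cox_map \<Sigma> m p x \<in> {P \<in> X. ?\<psi> P \<in> V}}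
      = {x \<in> cox_space \<Sigma> m p. ?\<phi> x \<in> {x \<in> cox_space \<Sigma> m p. cox_map \<Sigma> m p x \<in> V}}" for V
    by (auto simp: act stab cox_map_in_X)
  show ?thesis
  proof (rule toric_morphismI)
    show "?\<psi> P \<in> X" if P: "P \<in> X" for P
    proof -
      obtain x :: "nat \<Rightarrow> 'k" where x: "x \<in> cox_space \<Sigma> m p" "P = cox_map \<Sigma> m p x"
        using P by (auto simp: toric_variety_def)
      then show ?thesis using stab[OF x(1)] by (simp add: act cox_map_in_X)
    qed
    show "toric_open \<Sigma> m p {P \<in> X. ?\<psi> P \<in> V}" if "toric_open \<Sigma> m p V" for V
      unfolding toric_open_def pre
    proof
      have "cox_open \<Sigma> m p {x \<in> cox_space \<Sigma> m p. cox_map \<Sigma> m p x \<in> V}"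
        using that by (simp add: toric_open_def)
      then show "cox_open \<Sigma> m p {x \<in> cox_space \<Sigma> m p. ?\<phi> x \<in> {x \<in> cox_space \<Sigma> m p. cox_map \<Sigma> m p x \<in> V}}"
        by (rule cox_open_root_shift[OF i])
    qed auto
    show "toric_regular \<Sigma> m p {P \<in> X. ?\<psi> P \<in> V} (f \<circ> ?\<psi>)" if f: "toric_regular \<Sigma> m p V f" for V f
    proof -
      let ?W = "{x \<in> cox_space \<Sigma> m p. ?\<phi> x \<in> {x \<in> cox_space \<Sigma> m p. cox_map \<Sigma> m p x \<in> V}}"
      have "cox_regular m ?W (\<lambda>x. (f \<circ> cox_map \<Sigma> m p) (?\<phi> x))"
        using f unfolding toric_regular_def by (rule cox_regular_root_shift[OF i])
      moreover have "cox_regular m ?W (f \<circ> ?\<psi> \<circ> cox_map \<Sigma> m p) \<longleftrightarrow> cox_regular m ?W (\<lambda>x. (f \<circ> cox_map \<Sigma> m p) (?\<phi> x))"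
        by (rule cox_regular_cong) (simp add: act)
      ultimately show ?thesis unfolding toric_regular_def pre by (simp only:)
    qed
  qed
qed

lemma root_auto_cancel:
  assumes i: "i \<in> {1..m}" "e \<in> demazure_roots_at m p i" and P: "P \<in> X"
  shows "root_auto i e (- \<alpha>) (root_auto i e \<alpha> P) = P"
proof -
  obtain x where x: "x \<in> cox_space \<Sigma> m p" "P = cox_map \<Sigma> m p x"
    using P by (auto simp: toric_variety_def)
  then show ?thesis
    by (simp add: root_auto_cox_map[OF i] root_shift_in_cox_space[OF _ i] root_shift_add root_shift_zero)
qed

lemma root_auto_lifted:
  assumes i: "i \<in> {1..m}" "e \<in> demazure_roots_at m p i"
  shows "lifted_by (root_auto i e \<alpha>) (root_shift m p i e \<alpha>)"
proof -
  have X: "root_auto i e \<beta> P \<in> X" if "P \<in> X" for P \<beta>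
    using toric_morphismD(1)[OF toric_morphism_root_auto[OF i]] that .
  have "bij_betw (root_auto i e \<alpha>) X X"
    using X root_auto_cancel[OF i, of _ \<alpha>] root_auto_cancel[OF i, of _ "- \<alpha>"]
    by (intro bij_betw_byWitness[where f' = "root_auto i e (- \<alpha>)"]) auto
  then have "root_auto i e \<alpha> \<in> Bij X" by (simp add: Bij_def root_auto_def)
  then have "root_auto i e \<alpha> \<in> carrier Aut"
    unfolding carrier_Aut_iff
    using toric_morphism_root_auto[OF i] root_auto_cancel[OF i] by blast
  then show ?thesis
    by (simp add: lifted_by_def root_auto_cox_map[OF i] root_shift_in_cox_space[OF _ i])
qed

lemma root_subgroup_eq:
  assumes i: "i \<in> {1..m}" "e \<in> demazure_roots_at m p i"
  shows "root_subgroup \<Sigma> m p e = range (root_auto i e :: 'k::field_char_0 \<Rightarrow> _)"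
proof -
  have uniq: "j = i" if "j \<in> {1..m}" "e \<in> demazure_roots_at m p j" for j
    using root_atD(1)[OF i(2)] root_atD(2)[OF that(2) i(1)] by fastforce
  have aff: "root_aut_affine m p i e \<alpha> x = root_shift m p i e \<alpha> x" if "x \<in> cox_space \<Sigma> m p" for \<alpha> and x :: "nat \<Rightarrow> 'k"
    using that i(1) by (intro root_aut_affine_eq) (auto simp: cox_space_iff)
  show ?thesis
  proof
    show "range (root_auto i e :: 'k \<Rightarrow> _) \<subseteq> root_subgroup \<Sigma> m p e"
    proof (rule image_subsetI)
      fix \<alpha> :: 'k
      have "\<forall>x\<in>cox_space \<Sigma> m p. root_auto i e \<alpha> (cox_map \<Sigma> m p x) = cox_map \<Sigma> m p (root_aut_affine m p i e \<alpha> x)"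
        by (simp add: root_auto_cox_map[OF i] aff)
      moreover have "root_auto i e \<alpha> \<in> carrier Aut"
        using root_auto_lifted[OF i, of \<alpha>] by (simp add: lifted_by_def)
      ultimately show "root_auto i e \<alpha> \<in> root_subgroup \<Sigma> m p e"
        using i unfolding root_subgroup_def by blast
    qed
    show "root_subgroup \<Sigma> m p e \<subseteq> range (root_auto i e :: 'k \<Rightarrow> _)"
    proof
      fix \<psi> :: "('n, 'k) tpoint \<Rightarrow> ('n, 'k) tpoint" assume "\<psi> \<in> root_subgroup \<Sigma> m p e"
      then obtain j \<alpha> where \<psi>: "\<psi> \<in> carrier Aut" "j \<in> {1..m}" "e \<in> demazure_roots_at m p j"
        "\<And>x. x \<in> cox_space \<Sigma> m p \<Longrightarrow> \<psi> (cox_map \<Sigma> m p x) = cox_map \<Sigma> m p (root_aut_affine m p j e \<alpha> x)"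
        unfolding root_subgroup_def by (elim CollectE conjE bexE exE) (rule that; blast)
      have "j = i" by (rule uniq[OF \<psi>(2,3)])
      then have "lifted_by \<psi> (root_shift m p i e \<alpha>)"
        using \<psi> by (simp add: lifted_by_def aff root_shift_in_cox_space[OF _ i])
      then have "\<psi> = root_auto i e \<alpha>" by (rule lifted_by_unique[OF _ root_auto_lifted[OF i]]) simp
      then show "\<psi> \<in> range (root_auto i e)" by simp
    qed
  qed
qed

lemma root_auto_add:
  assumes i: "i \<in> {1..m}" "e \<in> demazure_roots_at m p i"
  shows "root_auto i e (\<alpha> + \<beta>) = root_auto i e \<alpha> \<otimes>\<^bsub>Aut\<^esub> root_auto i e \<beta>"
  by (rule lifted_by_unique[OF root_auto_lifted[OF i] lifted_by_mult[OF root_auto_lifted[OF i] root_auto_lifted[OF i]]])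
     (simp add: root_shift_add)

text \<open>Two points of a cone with zero between them are opposite, which strong convexity excludes.\<close>

lemma zero_cone_face:
  assumes "\<sigma> \<in> \<Sigma>"
  shows "{0} face_of \<sigma>"
  unfolding face_of_def
proof (intro conjI ballI impI)
  note cc = cone_polyhedral(1)[OF assms]
  show "{0} \<subseteq> \<sigma>" using cc convex_cone_contains_0 by auto
  fix x y z assume xy: "x \<in> \<sigma>" "y \<in> \<sigma>" "z \<in> {0}" "z \<in> open_segment x y"
  then obtain t where t: "0 < t" "t < 1" "(1 - t) *\<^sub>R x + t *\<^sub>R y = 0" by (auto simp: in_segment)
  have mem: "(1 - t) *\<^sub>R x \<in> \<sigma>" "t *\<^sub>R y \<in> \<sigma>" using cc t xy by (auto intro: convex_cone_scaleR)
  have "(1 - t) *\<^sub>R x = - (t *\<^sub>R y)" using t(3) by (simp add: eq_neg_iff_add_eq_0)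
  with mem have "(1 - t) *\<^sub>R x \<in> \<sigma> \<inter> uminus ` \<sigma>" by auto
  then have "(1 - t) *\<^sub>R x \<in> {0}"
    by (simp only: cone_polyhedral(3)[OF assms, unfolded strongly_convex_cone_def])
  then have "(1 - t) *\<^sub>R x = 0" by simp
  moreover have "t *\<^sub>R y = 0" using t(3) unfolding \<open>(1 - t) *\<^sub>R x = 0\<close> by simp
  ultimately show "x \<in> {0}" "y \<in> {0}" using t by auto
qed simp

text \<open>
  The character of \<open>e\<close> itself distinguishes the point with all coordinates \<open>1\<close> from its image, where
  the \<open>i\<close>-th coordinate is \<open>2\<close>; both lie in the open torus, where every character is defined.
\<close>

lemma root_auto_nontrivial:
  assumes i: "i \<in> {1..m}" "e \<in> demazure_roots_at m p i"
  shows "root_auto i e (1 :: 'k::field_char_0) \<noteq> \<one>\<^bsub>Aut\<^esub>"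
proof
  assume triv: "root_auto i e (1 :: 'k) = \<one>\<^bsub>Aut\<^esub>"
  define x :: "nat \<Rightarrow> 'k" where "x = (\<lambda>s\<in>{1..m}. 1)"
  obtain \<sigma> where \<sigma>: "\<sigma> \<in> \<Sigma>" using fan by (auto simp: fan_def)
  then have "{0} \<in> \<Sigma>" using face_in_fan zero_cone_face by blast
  then have "least_cone {} \<subseteq> {0}" by (rule least_cone_subset) simp
  then have dual: "e \<in> dual_lattice_cone (least_cone {})" by (auto simp: dual_lattice_cone_def)
  have Z: "zeros x = {}" by (simp add: zeros_def x_def)
  have x: "x \<in> cox_space \<Sigma> m p"
    using \<sigma> Z by (auto simp: cox_space_iff x_def in_common_cone_def)
  have "root_monom m p i e x = 1" unfolding root_monom_def by (intro prod.neutral) (auto simp: x_def)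
  then have y: "root_shift m p i e 1 x = x(i := 2)" using i(1) by (simp add: root_shift_def x_def)
  have Zy: "zeros (x(i := 2)) = {}" by (auto simp: zeros_def x_def)
  have "cox_map \<Sigma> m p x = cox_map \<Sigma> m p (x(i := 2))"
    using root_auto_cox_map[OF i x, of 1] triv cox_map_in_X[OF x] by (simp add: Aut_one y)
  then have "character e x = character e (x(i := 2))"
    using cox_map_eqD(2)[OF x root_shift_in_cox_space[OF x i, of 1]] dual by (simp add: y Z)
  moreover have one: "(\<Prod>s\<in>{1..m} - {i}. (x(i := c)) s powi pairing e (p s)) = 1" for c
    by (intro prod.neutral) (auto simp: x_def)
  have "character e (x(i := c)) = c powi (- 1)" for c
    unfolding character_split[OF i(1)] one by (simp add: root_atD(1)[OF i(2)])
  from this[of 2] this[of 1] have "character e (x(i := 2)) = 1 / 2" "character e (x(i := 1)) = 1"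
    by (simp_all add: power_int_minus field_simps)
  moreover have "x(i := 1) = x" using i(1) by (auto simp: x_def)
  ultimately show False by simp
qed

end

section \<open>Groups generated by root subgroups\<close>

lemma up1_iff: "b \<in> up1 M \<longleftrightarrow> b \<in> M \<and> (\<exists>a\<in>M. \<exists>e\<in>M. b = a + e)"
  by (auto simp: up1_def root_arrow_def)

text \<open>
  The relations of the root subgroups \<open>u\<^sub>e\<close>. In the application \<open>d e f\<close> is the exponent with which the
  variable changed by \<open>u\<^sub>e\<close> occurs in the monomial of \<open>u\<^sub>f\<close>.
\<close>

locale root_group = group G for G (structure) +
  fixes R :: "(int ^ 'n) set" and u :: "int ^ 'n \<Rightarrow> 'k::field_char_0 \<Rightarrow> 'a"
    and d :: "int ^ 'n \<Rightarrow> int ^ 'n \<Rightarrow> nat"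
  assumes u_closed: "e \<in> R \<Longrightarrow> u e \<alpha> \<in> carrier G"
    and u_add: "e \<in> R \<Longrightarrow> u e (\<alpha> + \<beta>) = u e \<alpha> \<otimes> u e \<beta>"
    and u_nontrivial: "e \<in> R \<Longrightarrow> u e 1 \<noteq> \<one>"
    and sum_root: "e \<in> R \<Longrightarrow> f \<in> R \<Longrightarrow> e + f \<in> R \<longleftrightarrow> d e f > 0 \<or> d f e > 0"
    and d_sum: "e \<in> R \<Longrightarrow> f \<in> R \<Longrightarrow> d e f > 0 \<Longrightarrow> d e (e + f) = d e f - 1"
    and commute: "e \<in> R \<Longrightarrow> f \<in> R \<Longrightarrow> e + f \<notin> R \<Longrightarrow> u e \<alpha> \<otimes> u f \<beta> = u f \<beta> \<otimes> u e \<alpha>"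
    and commutator: "e \<in> R \<Longrightarrow> f \<in> R \<Longrightarrow> d e f > 0 \<Longrightarrow>
      \<exists>z\<in>generate G (\<Union>t\<in>{2..d e f}. range (u (f + int t *s e))).
        u e \<alpha> \<otimes> u f \<beta> \<otimes> inv (u e \<alpha>) \<otimes> inv (u f \<beta>) = u (f + e) (- (of_nat (d e f) * \<alpha> * \<beta>)) \<otimes> z"
begin

definition closed_roots :: "(int ^ 'n) set \<Rightarrow> bool" where
  "closed_roots M \<longleftrightarrow> M \<subseteq> R \<and> (\<forall>e\<in>M. \<forall>f\<in>M. e + f \<in> R \<longrightarrow> e + f \<in> M)"

definition root_span :: "(int ^ 'n) set \<Rightarrow> 'a set" where
  "root_span M = generate G (\<Union>e\<in>M. range (u e))"

lemma cancel_inv: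
  assumes "x \<in> carrier G" "y \<in> carrier G"
  shows "inv x \<otimes> (x \<otimes> y) = y" "x \<otimes> (inv x \<otimes> y) = y"
  using assms by (simp_all flip: m_assoc)

lemma u_zero: "e \<in> R \<Longrightarrow> u e 0 = \<one>"
  using u_add[of e 0 0] u_closed[of e 0] r_cancel_one' by force

lemma inv_u:
  assumes "e \<in> R"
  shows "inv (u e \<alpha>) = u e (- \<alpha>)"
proof (rule inv_equality)
  show "u e (- \<alpha>) \<otimes> u e \<alpha> = \<one>"
    using u_add[OF assms, of "- \<alpha>" \<alpha>] u_zero[OF assms] by simp
qed (use u_closed assms in auto)

lemma closed_roots_subset: "closed_roots M \<Longrightarrow> M \<subseteq> R"
  by (simp add: closed_roots_def)

lemma closed_roots_up1: "closed_roots M \<Longrightarrow> closed_roots (up1 M)"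
  by (fastforce simp: closed_roots_def up1_iff)

lemma generators_closed: "M \<subseteq> R \<Longrightarrow> (\<Union>e\<in>M. range (u e)) \<subseteq> carrier G"
  using u_closed by auto

lemma subgroup_root_span: "M \<subseteq> R \<Longrightarrow> subgroup (root_span M) G"
  unfolding root_span_def by (rule generate_is_subgroup[OF generators_closed])

lemma u_in_root_span: "e \<in> M \<Longrightarrow> u e \<alpha> \<in> root_span M"
  unfolding root_span_def by (rule generate.incl) auto

text \<open>The multiples of \<open>e\<close> are added one at a time, and each step lowers the degree by one.\<close>

lemma root_string:
  assumes M: "closed_roots M" and ef: "e \<in> M" "f \<in> M" and t: "1 \<le> t" "t \<le> d e f"
  shows "f + int t *s e \<in> up1 M \<and> d e (f + int t *s e) = d e f - t"
  using t
proof (induction t)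
  case (Suc t)
  have eq: "f + int (Suc t) *s e = (f + int t *s e) + e"
    by (simp add: vec_eq_iff algebra_simps)
  have IH: "f + int t *s e \<in> M \<and> d e (f + int t *s e) = d e f - t"
  proof (cases "t = 0")
    case False
    with Suc show ?thesis by (auto simp: up1_iff)
  qed (use ef in simp)
  with Suc.prems have pos: "d e (f + int t *s e) > 0" by simp
  have R: "e \<in> R" "f + int t *s e \<in> R" using M ef IH closed_roots_subset by auto
  have "e + (f + int t *s e) \<in> R" using sum_root[OF R] pos by simp
  then have "e + (f + int t *s e) \<in> M" using M ef IH by (auto simp: closed_roots_def)
  moreover have "d e (e + (f + int t *s e)) = d e f - Suc t"
    using d_sum[OF R pos] IH by simp
  ultimately show ?case
    unfolding eq up1_iff using ef(1) IH by (metis add.commute)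
qed simp

lemma string_subset:
  assumes "closed_roots M" "e \<in> M" "f \<in> M"
  shows "generate G (\<Union>t\<in>{2..d e f}. range (u (f + int t *s e))) \<subseteq> root_span (up1 M)"
  unfolding root_span_def using root_string[OF assms] by (intro mono_generate) force

lemma commutator_of_generators:
  assumes M: "closed_roots M" and ef: "e \<in> M" "f \<in> M"
  shows "u e \<alpha> \<otimes> u f \<beta> \<otimes> inv (u e \<alpha>) \<otimes> inv (u f \<beta>) \<in> root_span (up1 M)"
proof -
  have MR: "M \<subseteq> R" "up1 M \<subseteq> R"
    using closed_roots_subset[OF M] closed_roots_subset[OF closed_roots_up1[OF M]] by auto
  interpret S: subgroup "root_span (up1 M)" G by (rule subgroup_root_span[OF MR(2)])
  have pos: "u e \<alpha> \<otimes> u f \<beta> \<otimes> inv (u e \<alpha>) \<otimes> inv (u f \<beta>) \<in> root_span (up1 M)"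
    if ef: "e \<in> M" "f \<in> M" "d e f > 0" for e f \<alpha> \<beta>
  proof -
    have "e \<in> R" "f \<in> R" using ef MR by auto
    then obtain z where z: "z \<in> generate G (\<Union>t\<in>{2..d e f}. range (u (f + int t *s e)))"
      "u e \<alpha> \<otimes> u f \<beta> \<otimes> inv (u e \<alpha>) \<otimes> inv (u f \<beta>)
        = u (f + e) (- (of_nat (d e f) * \<alpha> * \<beta>)) \<otimes> z"
      using commutator ef by blast
    have "f + e \<in> up1 M" using root_string[OF M ef(1,2), of 1] ef(3) by simp
    with z string_subset[OF M ef(1,2)] show ?thesis
      by (auto intro!: S.m_closed u_in_root_span)
  qed
  have R: "e \<in> R" "f \<in> R" using ef MR by auto
  have [simp]: "u e \<alpha> \<in> carrier G" "u f \<beta> \<in> carrier G" using R u_closed by auto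
  consider "e + f \<notin> R" | "d e f > 0" | "d f e > 0" using sum_root[OF R] by auto
  then show ?thesis
  proof cases
    case 1
    then have "u e \<alpha> \<otimes> u f \<beta> = u f \<beta> \<otimes> u e \<alpha>" using commute R by blast
    then show ?thesis by (simp add: m_assoc)
  next
    case 2
    then show ?thesis using pos ef by blast
  next
    case 3
    \<comment> \<open>this is the inverse of the commutator in the opposite order\<close>
    have "u e \<alpha> \<otimes> u f \<beta> \<otimes> inv (u e \<alpha>) \<otimes> inv (u f \<beta>)
        = inv (u f \<beta> \<otimes> u e \<alpha> \<otimes> inv (u f \<beta>) \<otimes> inv (u e \<alpha>))"
      by (simp add: inv_mult_group m_assoc)
    then show ?thesis using S.m_inv_closed[OF pos[OF ef(2,1) 3]] by (simp only:)
  qed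
qed

text \<open>Induction on the length of a word; inverses need no case of their own if the generating set
  is closed under them.\<close>

lemma generate_left_induct:
  assumes "S \<subseteq> carrier G" "\<And>s. s \<in> S \<Longrightarrow> inv s \<in> S" "g \<in> generate G S"
    and one: "P \<one>" and step: "\<And>s h. s \<in> S \<Longrightarrow> h \<in> generate G S \<Longrightarrow> P h \<Longrightarrow> P (s \<otimes> h)"
  shows "P g"
proof -
  have "\<forall>h\<in>generate G S. P h \<longrightarrow> P (g \<otimes> h)"
    using assms(3)
  proof induction
    case one
    then show ?case using generate_in_carrier[OF assms(1)] by simp
  next
    case (incl s)
    then show ?case using step by blast
  next
    case (inv s)
    then show ?case using step assms(2) by blast
  next
    case (eng h1 h2)
    then show ?case
      using generate_in_carrier[OF assms(1)] by (auto simp: m_assoc generate.eng)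
  qed
  then have "P (g \<otimes> \<one>)" using one generate.one by blast
  then show ?thesis using generate_in_carrier[OF assms(1,3)] by simp
qed

text \<open>
  Conjugating a generator multiplies it by a commutator, and commutators with elements of \<open>up1 M \<subseteq> M\<close>
  already lie in the subgroup.
\<close>

lemma conjugate_in_root_span:
  assumes M: "closed_roots M" and e: "e \<in> M" and g: "g \<in> root_span (up1 M)"
  shows "u e \<alpha> \<otimes> g \<otimes> inv (u e \<alpha>) \<in> root_span (up1 M)"
proof -
  have MR: "M \<subseteq> R" "up1 M \<subseteq> R"
    using closed_roots_subset[OF M] closed_roots_subset[OF closed_roots_up1[OF M]] by auto
  interpret S: subgroup "root_span (up1 M)" G by (rule subgroup_root_span[OF MR(2)])
  have x: "u e \<alpha> \<in> carrier G" using e MR u_closed by auto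
  show ?thesis
  proof (rule generate_left_induct[OF generators_closed[OF MR(2)] _ g[unfolded root_span_def]])
    show "inv s \<in> (\<Union>e\<in>up1 M. range (u e))" if "s \<in> (\<Union>e\<in>up1 M. range (u e))" for s
      using that MR inv_u by force
    show "u e \<alpha> \<otimes> \<one> \<otimes> inv (u e \<alpha>) \<in> root_span (up1 M)" using x by simp
    fix s h
    assume s: "s \<in> (\<Union>e\<in>up1 M. range (u e))" and h: "h \<in> generate G (\<Union>e\<in>up1 M. range (u e))"
      and IH: "u e \<alpha> \<otimes> h \<otimes> inv (u e \<alpha>) \<in> root_span (up1 M)"
    from s obtain f \<beta> where f: "f \<in> up1 M" "s = u f \<beta>" by auto
    then have fM: "f \<in> M" by (simp add: up1_iff)
    have sc: "s \<in> carrier G" using f MR u_closed by auto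
    have hc: "h \<in> carrier G" using generate_in_carrier[OF generators_closed[OF MR(2)] h] .
    have "u e \<alpha> \<otimes> (s \<otimes> h) \<otimes> inv (u e \<alpha>)
        = (u e \<alpha> \<otimes> s \<otimes> inv (u e \<alpha>) \<otimes> inv s) \<otimes> s \<otimes> (u e \<alpha> \<otimes> h \<otimes> inv (u e \<alpha>))"
      using x sc hc by (simp add: m_assoc cancel_inv)
    moreover have "u e \<alpha> \<otimes> s \<otimes> inv (u e \<alpha>) \<otimes> inv s \<in> root_span (up1 M)"
      using commutator_of_generators[OF M e fM] f by simp
    moreover have "s \<in> root_span (up1 M)" using f u_in_root_span by blast
    ultimately show "u e \<alpha> \<otimes> (s \<otimes> h) \<otimes> inv (u e \<alpha>) \<in> root_span (up1 M)"
      using IH by simp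
  qed
qed

text \<open>
  Modulo the normal subgroup \<open>N\<close> the generators commute pairwise, hence so do all elements. The
  commutator identities used below carry this from generators to words, in one argument at a time.
\<close>

lemma derived_subset_of_generator_commutators:
  assumes S: "S \<subseteq> carrier G" "\<And>s. s \<in> S \<Longrightarrow> inv s \<in> S" and N: "subgroup N G"
    and conj: "\<And>s x. s \<in> S \<Longrightarrow> x \<in> N \<Longrightarrow> s \<otimes> x \<otimes> inv s \<in> N"
    and comm: "\<And>s t. s \<in> S \<Longrightarrow> t \<in> S \<Longrightarrow> s \<otimes> t \<otimes> inv s \<otimes> inv t \<in> N"
  shows "derived G (generate G S) \<subseteq> N"
proof -
  interpret N: subgroup N G by (rule N)
  note gc = generate_in_carrier[OF S(1)]
  have conj': "g \<otimes> x \<otimes> inv g \<in> N" if "g \<in> generate G S" "x \<in> N" for g x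
  proof (rule generate_left_induct[OF S that(1), where P = "\<lambda>g. g \<otimes> x \<otimes> inv g \<in> N"])
    show "\<one> \<otimes> x \<otimes> inv \<one> \<in> N" using that by simp
    fix s h assume s: "s \<in> S" and h: "h \<in> generate G S" "h \<otimes> x \<otimes> inv h \<in> N"
    have "s \<otimes> h \<otimes> x \<otimes> inv (s \<otimes> h) = s \<otimes> (h \<otimes> x \<otimes> inv h) \<otimes> inv s"
      using s h S(1) gc that by (auto simp: m_assoc inv_mult_group)
    then show "s \<otimes> h \<otimes> x \<otimes> inv (s \<otimes> h) \<in> N" using conj[OF s h(2)] by simp
  qed
  have comm1: "s \<otimes> g \<otimes> inv s \<otimes> inv g \<in> N" if "s \<in> S" "g \<in> generate G S" for s g
  proof (rule generate_left_induct[OF S that(2), where P = "\<lambda>g. s \<otimes> g \<otimes> inv s \<otimes> inv g \<in> N"])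
    have s: "s \<in> carrier G" using that S by auto
    show "s \<otimes> \<one> \<otimes> inv s \<otimes> inv \<one> \<in> N" using s by simp
    fix t h assume t: "t \<in> S" and h: "h \<in> generate G S" "s \<otimes> h \<otimes> inv s \<otimes> inv h \<in> N"
    have c: "t \<in> carrier G" "h \<in> carrier G" using t h S(1) gc by auto
    have "s \<otimes> (t \<otimes> h) \<otimes> inv s \<otimes> inv (t \<otimes> h)
        = (s \<otimes> t \<otimes> inv s \<otimes> inv t) \<otimes> (t \<otimes> (s \<otimes> h \<otimes> inv s \<otimes> inv h) \<otimes> inv t)"
      using s c by (simp add: inv_mult_group m_assoc cancel_inv)
    then show "s \<otimes> (t \<otimes> h) \<otimes> inv s \<otimes> inv (t \<otimes> h) \<in> N"
      using conj[OF t h(2)] comm[OF that(1) t] by simp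
  qed
  have comm2: "g \<otimes> k \<otimes> inv g \<otimes> inv k \<in> N" if "g \<in> generate G S" "k \<in> generate G S" for g k
  proof (rule generate_left_induct[OF S that(1), where P = "\<lambda>g. g \<otimes> k \<otimes> inv g \<otimes> inv k \<in> N"])
    have k: "k \<in> carrier G" using that gc by auto
    show "\<one> \<otimes> k \<otimes> inv \<one> \<otimes> inv k \<in> N" using k by simp
    fix s h assume s: "s \<in> S" and h: "h \<in> generate G S" "h \<otimes> k \<otimes> inv h \<otimes> inv k \<in> N"
    have c: "s \<in> carrier G" "h \<in> carrier G" using s h S(1) gc by auto
    have "s \<otimes> h \<otimes> k \<otimes> inv (s \<otimes> h) \<otimes> inv k
        = (s \<otimes> (h \<otimes> k \<otimes> inv h \<otimes> inv k) \<otimes> inv s) \<otimes> (s \<otimes> k \<otimes> inv s \<otimes> inv k)"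
      using k c by (simp add: inv_mult_group m_assoc cancel_inv)
    then show "s \<otimes> h \<otimes> k \<otimes> inv (s \<otimes> h) \<otimes> inv k \<in> N"
      using conj[OF s h(2)] comm1[OF s that(2)] by simp
  qed
  show ?thesis
    unfolding derived_def using comm2 by (intro generate_subgroup_incl[OF _ N]) auto
qed

lemma derived_root_span_subset:
  assumes M: "closed_roots M"
  shows "derived G (root_span M) \<subseteq> root_span (up1 M)"
  unfolding root_span_def[of M]
proof (rule derived_subset_of_generator_commutators)
  have MR: "M \<subseteq> R" "up1 M \<subseteq> R"
    using closed_roots_subset[OF M] closed_roots_subset[OF closed_roots_up1[OF M]] by auto
  show "(\<Union>e\<in>M. range (u e)) \<subseteq> carrier G" by (rule generators_closed[OF MR(1)])
  show "subgroup (root_span (up1 M)) G" by (rule subgroup_root_span[OF MR(2)])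
  show "inv s \<in> (\<Union>e\<in>M. range (u e))" if "s \<in> (\<Union>e\<in>M. range (u e))" for s
    using that MR inv_u by force
  show "s \<otimes> x \<otimes> inv s \<in> root_span (up1 M)"
    if "s \<in> (\<Union>e\<in>M. range (u e))" "x \<in> root_span (up1 M)" for s x
    using that conjugate_in_root_span[OF M] by blast
  show "s \<otimes> t \<otimes> inv s \<otimes> inv t \<in> root_span (up1 M)"
    if "s \<in> (\<Union>e\<in>M. range (u e))" "t \<in> (\<Union>e\<in>M. range (u e))" for s t
    using that commutator_of_generators[OF M] by blast
qed

text \<open>
  Choose \<open>\<alpha>\<close> such that the first factor of the commutator of \<open>u\<^sub>e(\<alpha>)\<close> and \<open>u\<^sub>f(1)\<close> is the given element;
  this divides by \<open>d e f\<close>. The other factors belong to \<open>(f + (t - 1) e) + e\<close> with \<open>t \<ge> 2\<close>, where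
  \<open>f + (t - 1) e\<close> has smaller degree, so they are in the derived subgroup by induction.
\<close>

lemma u_sum_in_derived:
  assumes M: "closed_roots M" and e: "e \<in> M" and "f \<in> M" "d e f > 0"
  shows "u (f + e) \<gamma> \<in> derived G (root_span M)"
  using assms(3,4)
proof (induction "d e f" arbitrary: f \<gamma> rule: less_induct)
  case less
  have MR: "M \<subseteq> R" using closed_roots_subset[OF M] .
  have R: "e \<in> R" "f \<in> R" using MR e less.prems by auto
  have carr: "root_span M \<subseteq> carrier G"
    using subgroup_root_span[OF MR] by (simp add: subgroup.subset)
  interpret D: subgroup "derived G (root_span M)" G by (rule derived_is_subgroup[OF carr])
  define \<alpha> where "\<alpha> = - \<gamma> / of_nat (d e f)"
  have \<alpha>: "- (of_nat (d e f) * \<alpha> * 1) = \<gamma>" using less.prems by (simp add: \<alpha>_def)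
  obtain z where z: "z \<in> generate G (\<Union>t\<in>{2..d e f}. range (u (f + int t *s e)))"
    "u e \<alpha> \<otimes> u f 1 \<otimes> inv (u e \<alpha>) \<otimes> inv (u f 1) = u (f + e) \<gamma> \<otimes> z"
    using commutator[OF R less.prems(2), of \<alpha> 1] unfolding \<alpha> by blast
  have "f + e \<in> up1 M" using root_string[OF M e less.prems(1), of 1] less.prems(2) by simp
  then have "f + e \<in> R" using MR by (auto simp: up1_iff)
  have "u e \<alpha> \<in> root_span M" "u f 1 \<in> root_span M"
    using e less.prems by (auto intro: u_in_root_span)
  then have "u e \<alpha> \<otimes> u f 1 \<otimes> inv (u e \<alpha>) \<otimes> inv (u f 1) \<in> derived G (root_span M)"
    unfolding derived_def by (intro generate.incl) auto
  with z have "u (f + e) \<gamma> \<otimes> z \<in> derived G (root_span M)" by simp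
  moreover have "generate G (\<Union>t\<in>{2..d e f}. range (u (f + int t *s e))) \<subseteq> derived G (root_span M)"
  proof (rule generate_subgroup_incl[OF _ D.subgroup_axioms], clarify)
    fix t \<delta> assume t: "t \<in> {2..d e f}"
    let ?g = "f + int (t - 1) *s e"
    have g: "?g \<in> M" "d e ?g = d e f - (t - 1)"
      using root_string[OF M e less.prems(1), of "t - 1"] t by (auto simp: up1_iff)
    have "u (?g + e) \<delta> \<in> derived G (root_span M)"
      using g t by (intro less.hyps) auto
    moreover have "?g + e = f + int t *s e"
      using t by (simp add: vec_eq_iff algebra_simps of_nat_diff)
    ultimately show "u (f + int t *s e) \<delta> \<in> derived G (root_span M)" by (simp only:)
  qed
  ultimately have "u (f + e) \<gamma> \<otimes> z \<otimes> inv z \<in> derived G (root_span M)"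
    "z \<in> derived G (root_span M)" using z by auto
  then show ?case
    using u_closed[OF \<open>f + e \<in> R\<close>] by (simp add: m_assoc D.mem_carrier)
qed

lemma derived_root_span:
  assumes M: "closed_roots M"
  shows "derived G (root_span M) = root_span (up1 M)"
proof
  have MR: "M \<subseteq> R" using closed_roots_subset[OF M] .
  have carr: "root_span M \<subseteq> carrier G"
    using subgroup_root_span[OF MR] by (simp add: subgroup.subset)
  have "u b \<gamma> \<in> derived G (root_span M)" if b: "b \<in> up1 M" for b \<gamma>
  proof -
    obtain a e where ae: "a \<in> M" "e \<in> M" "b = a + e" "b \<in> M" using b by (auto simp: up1_iff)
    then have aeR: "a \<in> R" "e \<in> R" "a + e \<in> R" using MR by auto
    consider "d a e > 0" | "d e a > 0" using sum_root[OF aeR(1,2)] aeR(3) by auto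
    then show ?thesis
    proof cases
      case 1
      then show ?thesis
        using u_sum_in_derived[OF M ae(1,2) 1, of \<gamma>] by (simp only: ae(3) add.commute[of a e])
    next
      case 2
      then show ?thesis
        using u_sum_in_derived[OF M ae(2,1) 2, of \<gamma>] by (simp only: ae(3))
    qed
  qed
  then have "(\<Union>e\<in>up1 M. range (u e)) \<subseteq> derived G (root_span M)" by (intro UN_least) auto
  then show "root_span (up1 M) \<subseteq> derived G (root_span M)"
    unfolding root_span_def[of "up1 M"]
    by (rule generate_subgroup_incl[OF _ derived_is_subgroup[OF carr]])
qed (rule derived_root_span_subset[OF M])

lemma root_span_trivial_iff:
  assumes "M \<subseteq> R"
  shows "root_span M = {\<one>} \<longleftrightarrow> M = {}"
proof
  assume triv: "root_span M = {\<one>}"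
  show "M = {}"
  proof (rule ccontr)
    assume "M \<noteq> {}"
    then obtain e where "e \<in> M" by blast
    then show False using u_in_root_span[of e M 1] u_nontrivial[of e] triv assms by auto
  qed
qed (simp add: root_span_def generate_empty)

lemma derived_series:
  assumes "closed_roots M"
  shows "(derived G ^^ k) (root_span M) = root_span ((up1 ^^ k) M) \<and> closed_roots ((up1 ^^ k) M)"
proof (induction k)
  case (Suc k)
  then show ?case by (simp add: derived_root_span closed_roots_up1)
qed (simp add: assms)

lemma derived_series_trivial_iff:
  assumes "closed_roots M"
  shows "(derived G ^^ k) (root_span M) = {\<one>} \<longleftrightarrow> (up1 ^^ k) M = {}"
  using derived_series[OF assms, of k] root_span_trivial_iff[of "(up1 ^^ k) M"]
    closed_roots_subset[of "(up1 ^^ k) M"] by simp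

end

section \<open>Positive roots of a bilateral fan\<close>

locale radiant_toric = complete_toric \<Sigma> m p
  for \<Sigma> :: "(real ^ 'n) set set" and m :: nat and p :: "nat \<Rightarrow> int ^ 'n" +
  fixes q :: "nat \<Rightarrow> int ^ 'n" and a :: "nat \<Rightarrow> nat \<Rightarrow> nat" and v :: "int ^ 'n"
  assumes bilateral: "bilateral_numbering \<Sigma> m p a"
    and dual: "dual_basis p q"
    and adapted: "adapted_numbering CARD('n) m a"
    and v_mono: "strict_mono_on {1..CARD('n)} (\<lambda>i. pairing (q i) v)"
    and v_neg: "\<forall>i\<in>{1..CARD('n)}. pairing (q i) v < 0"
begin

lemma n_le_m: "CARD('n) \<le> m"
  using bilateral by (simp add: bilateral_numbering_def)

lemma basis_index: "j \<in> {1..CARD('n)} \<Longrightarrow> j \<in> {1..m}"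
  using n_le_m by auto

lemma pairing_q_p:
  "i \<in> {1..CARD('n)} \<Longrightarrow> j \<in> {1..CARD('n)} \<Longrightarrow> pairing (q i) (p j) = (if i = j then 1 else 0)"
  using dual unfolding dual_basis_def by blast

lemma pairing_expand: "pairing e w = (\<Sum>j = 1..CARD('n). pairing (q j) w * pairing e (p j))"
proof -
  obtain c where w: "w = (\<Sum>j = 1..CARD('n). c j *s p j)"
    using bilateral unfolding bilateral_numbering_def lattice_basis_def by (meson ex1_implies_ex)
  have "pairing (q i) w = c i" if i: "i \<in> {1..CARD('n)}" for i
  proof -
    have "pairing (q i) w = (\<Sum>j = 1..CARD('n). c j * pairing (q i) (p j))"
      unfolding w by (simp add: pairing_linear)
    also have "\<dots> = (\<Sum>j = 1..CARD('n). if i = j then c j else 0)"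
      using pairing_q_p[OF i] by (intro sum.cong) auto
    finally show ?thesis using i by simp
  qed
  then have "(\<Sum>j = 1..CARD('n). pairing (q j) w * pairing e (p j))
      = (\<Sum>j = 1..CARD('n). c j * pairing e (p j))"
    by (intro sum.cong) auto
  also have "\<dots> = pairing e w" unfolding w by (simp add: pairing_linear)
  finally show ?thesis by simp
qed

lemma pairing_late:
  "k \<in> {CARD('n)<..m} \<Longrightarrow> pairing e (p k) = - (\<Sum>j = 1..CARD('n). int (a k j) * pairing e (p j))"
  using bilateral unfolding bilateral_numbering_def by (simp add: pairing_linear)

text \<open>By completeness \<open>q\<^sub>j\<close> is negative on some ray, which cannot be spanned by a basis vector.\<close>

lemma column_positive:
  assumes j: "j \<in> {1..CARD('n)}"
  obtains k where "k \<in> {CARD('n)<..m}" "a k j > 0"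
proof -
  have "rvec (q j) \<bullet> (- rvec (p j)) < 0"
    using pairing_q_p[OF j j] by (simp add: rvec_inner)
  then obtain \<sigma> s where s: "s \<in> ray_indices \<sigma>" "pairing (q j) (p s) < 0"
    by (rule ex_ray_negative)
  have sm: "s \<in> {1..m}" using s(1) ray_indices_subset by blast
  have "s \<notin> {1..CARD('n)}" using pairing_q_p[OF j, of s] s(2) by (auto split: if_splits)
  with sm have k: "s \<in> {CARD('n)<..m}" by auto
  have "(\<Sum>i = 1..CARD('n). int (a s i) * pairing (q j) (p i)) = (\<Sum>i = 1..CARD('n). if j = i then int (a s i) else 0)"
    using pairing_q_p[OF j] by (intro sum.cong) auto
  then have "pairing (q j) (p s) = - int (a s j)" using pairing_late[OF k, of "q j"] j by simp
  with s(2) k that show thesis by simp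
qed

text \<open>
  The classes are consecutive intervals, numbered so that strictly larger classes come first.
\<close>

lemma adapted_less:
  assumes i: "i \<in> {1..CARD('n)}" and j: "j \<in> {1..CARD('n)}"
    and ge: "col_ge CARD('n) m a i j" and ne: "\<not> col_eq CARD('n) m a i j"
  shows "i < j"
proof -
  let ?E = "{(i, j). i \<in> {1..CARD('n)} \<and> j \<in> {1..CARD('n)} \<and> col_eq CARD('n) m a i j}"
  obtain r :: nat and c :: "nat \<Rightarrow> nat" where c: "\<forall>s\<in>{1..r}. c (s - 1) < c s"
    and cls: "{1..CARD('n)} // ?E = (\<lambda>s. {c (s - 1) + 1..c s}) ` {1..r}"
    and ord: "\<forall>l\<in>{1..r}. \<forall>s\<in>{1..r}.
           (\<forall>i\<in>{c (l - 1) + 1..c l}. \<forall>j\<in>{c (s - 1) + 1..c s}.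
              col_ge CARD('n) m a i j \<and> \<not> col_eq CARD('n) m a i j) \<longrightarrow> l < s"
    using adapted unfolding adapted_numbering_def by (elim exE conjE) (rule that; assumption)
  have "?E `` {i} \<in> (\<lambda>s. {c (s - 1) + 1..c s}) ` {1..r}"
    using i unfolding cls[symmetric] by (rule quotientI)
  then obtain l where l: "l \<in> {1..r}" "?E `` {i} = {c (l - 1) + 1..c l}" by auto
  have "?E `` {j} \<in> (\<lambda>s. {c (s - 1) + 1..c s}) ` {1..r}"
    using j unfolding cls[symmetric] by (rule quotientI)
  then obtain s where s: "s \<in> {1..r}" "?E `` {j} = {c (s - 1) + 1..c s}" by auto
  have "col_ge CARD('n) m a i' j' \<and> \<not> col_eq CARD('n) m a i' j'"
    if "i' \<in> {c (l - 1) + 1..c l}" "j' \<in> {c (s - 1) + 1..c s}" for i' j'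
  proof -
    have "col_eq CARD('n) m a i i'" "col_eq CARD('n) m a j j'"
      using that l(2) s(2) by auto
    with ge ne show ?thesis unfolding col_eq_def col_ge_def by metis
  qed
  with ord l(1) s(1) have ls: "l < s" by blast
  have mono: "t \<in> {1..r} \<Longrightarrow> l \<le> t \<Longrightarrow> c l \<le> c t" for t
  proof (induction t)
    case (Suc t)
    show ?case
    proof (cases "l = Suc t")
      case False
      with Suc l(1) have "c l \<le> c t" by auto
      moreover have "c t < c (Suc t)" using c Suc.prems(1) by force
      ultimately show ?thesis by simp
    qed simp
  qed simp
  have "i \<in> ?E `` {i}" "j \<in> ?E `` {j}" using i j by (auto simp: col_eq_def)
  then have "i \<in> {c (l - 1) + 1..c l}" "j \<in> {c (s - 1) + 1..c s}"
    by (simp_all only: l(2) s(2))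
  then have "i \<le> c l" "c (s - 1) < j" by auto
  moreover have "c l \<le> c (s - 1)" using ls s(1) l(1) by (intro mono) auto
  ultimately show ?thesis by simp
qed

text \<open>This is the inequality \<open>\<langle>e, p\<^sub>k\<rangle> \<ge> 0\<close> written out in the basis.\<close>

lemma root_column_bound:
  assumes i: "i \<in> {1..CARD('n)}" and e: "e \<in> demazure_roots_at m p i" and k: "k \<in> {CARD('n)<..m}"
  shows "(\<Sum>j\<in>{1..CARD('n)} - {i}. int (a k j) * pairing e (p j)) \<le> int (a k i)"
proof -
  have "k \<in> {1..m} - {i}" using k i by auto
  then have "0 \<le> pairing e (p k)" using e unfolding demazure_roots_at_def by blast
  moreover have "pairing e (p i) = -1" using e by (simp add: demazure_roots_at_def)
  ultimately show ?thesis
    using pairing_late[OF k, of e] i by (simp add: sum.remove[of "{1..CARD('n)}" i] del: One_nat_def)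
qed

lemma root_coordinate_nonneg:
  assumes "i \<in> {1..CARD('n)}" "e \<in> demazure_roots_at m p i" "j \<in> {1..CARD('n)}" "j \<noteq> i"
  shows "0 \<le> pairing e (p j)"
  using assms basis_index unfolding demazure_roots_at_def by blast

lemma root_column_bound_subset:
  assumes i: "i \<in> {1..CARD('n)}" and e: "e \<in> demazure_roots_at m p i" and k: "k \<in> {CARD('n)<..m}"
    and J: "J \<subseteq> {1..CARD('n)} - {i}"
  shows "(\<Sum>j\<in>J. int (a k j) * pairing e (p j)) \<le> int (a k i)"
proof -
  have "(\<Sum>j\<in>J. int (a k j) * pairing e (p j)) \<le> (\<Sum>j\<in>{1..CARD('n)} - {i}. int (a k j) * pairing e (p j))"
    using J root_coordinate_nonneg[OF i e] by (intro sum_mono2) auto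
  also have "\<dots> \<le> int (a k i)" by (rule root_column_bound[OF i e k])
  finally show ?thesis .
qed

text \<open>
  Such a root is nonnegative on the basis and zero on the rays \<open>p\<^sub>l\<close>, \<open>n < l \<noteq> k\<close>. The columns of \<open>a\<close> being nonzero,
  \<open>\<langle>e, p\<^sub>k\<rangle> = -1\<close> leaves a single coordinate, equal to \<open>1\<close>: the root is some \<open>q\<^sub>i\<close>, and \<open>- q\<^sub>i\<close> is a root.
\<close>

lemma root_at_late_semisimple:
  assumes k: "k \<in> {CARD('n)<..m}" and e: "e \<in> demazure_roots_at m p k"
  shows "- e \<in> demazure_roots m p"
proof -
  have ek: "pairing e (p k) = -1" and epos: "\<And>s. s \<in> {1..m} \<Longrightarrow> s \<noteq> k \<Longrightarrow> 0 \<le> pairing e (p s)"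
    using e by (auto simp: demazure_roots_at_def)
  have pos: "0 \<le> pairing e (p j)" if "j \<in> {1..CARD('n)}" for j
    using epos[of j] basis_index[OF that] that k by auto
  have late: "pairing e (p l) \<le> 0" if l: "l \<in> {CARD('n)<..m}" for l
  proof -
    have "0 \<le> (\<Sum>j = 1..CARD('n). int (a l j) * pairing e (p j))"
      using pos by (intro sum_nonneg) auto
    then show ?thesis using pairing_late[OF l, of e] by linarith
  qed
  have late0: "pairing e (p l) = 0" if l: "l \<in> {CARD('n)<..m}" "l \<noteq> k" for l
    using late[OF l(1)] epos[of l] l by auto
  have prod0: "int (a l j) * pairing e (p j) = 0"
    if l: "l \<in> {CARD('n)<..m}" "l \<noteq> k" and j: "j \<in> {1..CARD('n)}" for l j
  proof -
    have "(\<Sum>j = 1..CARD('n). int (a l j) * pairing e (p j)) = 0"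
      using late0[OF l] pairing_late[OF l(1), of e] by simp
    then show ?thesis using j pos by (subst (asm) sum_nonneg_eq_0_iff) auto
  qed
  have sum1: "(\<Sum>j = 1..CARD('n). int (a k j) * pairing e (p j)) = 1"
    using ek pairing_late[OF k, of e] by simp
  have kpos: "a k j > 0" if j: "j \<in> {1..CARD('n)}" "pairing e (p j) > 0" for j
  proof -
    obtain l where l: "l \<in> {CARD('n)<..m}" "a l j > 0" by (rule column_positive[OF j(1)])
    then have "l = k" using prod0[OF l(1) _ j(1)] j(2) by auto
    with l show ?thesis by simp
  qed
  obtain i where i: "i \<in> {1..CARD('n)}" "pairing e (p i) > 0"
  proof (rule ccontr)
    assume "\<not> thesis"
    then have "\<forall>i\<in>{1..CARD('n)}. pairing e (p i) = 0" using that pos by (metis order_le_less)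
    then have "(\<Sum>j = 1..CARD('n). int (a k j) * pairing e (p j)) = 0" by (intro sum.neutral) auto
    with sum1 show False by simp
  qed
  have split: "int (a k i) * pairing e (p i)
      + (\<Sum>j\<in>{1..CARD('n)} - {i}. int (a k j) * pairing e (p j)) = 1"
    using sum1 i(1) by (simp add: sum.remove[of "{1..CARD('n)}" i] del: One_nat_def)
  have rest: "0 \<le> (\<Sum>j\<in>{1..CARD('n)} - {i}. int (a k j) * pairing e (p j))"
    using pos by (intro sum_nonneg) auto
  have "1 \<le> int (a k i) * pairing e (p i)"
    using kpos[OF i] i(2) by (smt (verit) mult_le_cancel_right1 of_nat_0_less_iff zero_less_mult_iff)
  with split rest have one: "int (a k i) * pairing e (p i) = 1"
    and rest0: "(\<Sum>j\<in>{1..CARD('n)} - {i}. int (a k j) * pairing e (p j)) = 0" by linarith+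
  have ei: "pairing e (p i) = 1" using one i(2) by (simp add: zmult_eq_1_iff)
  have others: "pairing e (p j) = 0" if j: "j \<in> {1..CARD('n)}" "j \<noteq> i" for j
  proof -
    have "int (a k j) * pairing e (p j) = 0"
      using rest0 j pos by (subst (asm) sum_nonneg_eq_0_iff) auto
    then show ?thesis using kpos[OF j(1)] pos[OF j(1)] by (cases "pairing e (p j) > 0") auto
  qed
  have "0 \<le> pairing (- e) (p s)" if s: "s \<in> {1..m}" "s \<noteq> i" for s
  proof (cases "s \<in> {1..CARD('n)}")
    case True
    then show ?thesis using others s by (simp add: pairing_linear)
  next
    case False
    then show ?thesis using late[of s] s by (simp add: pairing_linear)
  qed
  then have "- e \<in> demazure_roots_at m p i"
    using ei by (simp add: demazure_roots_at_def pairing_linear)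
  then show ?thesis using basis_index[OF i(1)] by (auto simp: demazure_roots_def)
qed

text \<open>
  If \<open>x\<^sub>l\<close> occurs in the monomial of \<open>e\<close> and the columns of \<open>i\<close> and \<open>l\<close> agree, the bound by the
  \<open>i\<close>-th column leaves no room for anything else: \<open>e = q\<^sub>l - q\<^sub>i\<close>.
\<close>

lemma root_same_column:
  assumes i: "i \<in> {1..CARD('n)}" and e: "e \<in> demazure_roots_at m p i"
    and l: "l \<in> {1..CARD('n)}" "pairing e (p l) > 0" and eq: "col_eq CARD('n) m a i l"
  shows "- e \<in> demazure_roots m p" "pairing e v = pairing (q l) v - pairing (q i) v"
proof -
  have ei: "pairing e (p i) = -1" using e by (simp add: demazure_roots_at_def)
  then have li: "l \<noteq> i" using l by auto
  obtain k where k: "k \<in> {CARD('n)<..m}" "a k l > 0" by (rule column_positive[OF l(1)])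
  have kil: "a k i = a k l" using eq k(1) by (simp add: col_eq_def)
  have el: "pairing e (p l) = 1"
  proof -
    have "int (a k l) * pairing e (p l) \<le> int (a k l) * 1"
      using root_column_bound_subset[OF i e k(1), of "{l}"] l li kil by simp
    then have "pairing e (p l) \<le> 1" using k(2) by (simp add: mult_le_cancel_left)
    with l(2) show ?thesis by simp
  qed
  have others: "pairing e (p j) = 0" if j: "j \<in> {1..CARD('n)}" "j \<noteq> i" "j \<noteq> l" for j
  proof (rule ccontr)
    assume "pairing e (p j) \<noteq> 0"
    then have ej: "pairing e (p j) > 0" using root_coordinate_nonneg[OF i e j(1,2)] by simp
    obtain h where h: "h \<in> {CARD('n)<..m}" "a h j > 0" by (rule column_positive[OF j(1)])
    have "int (a h l) + int (a h j) * pairing e (p j) \<le> int (a h i)"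
      using root_column_bound_subset[OF i e h(1), of "{l, j}"] l li j el by auto
    moreover have "a h i = a h l" using eq h(1) by (simp add: col_eq_def)
    moreover have "int (a h j) * pairing e (p j) > 0" using h ej by simp
    ultimately show False by simp
  qed
  have sum2: "(\<Sum>j = 1..CARD('n). f j * pairing e (p j)) = f l - f i" for f :: "nat \<Rightarrow> int"
  proof -
    have "(\<Sum>j = 1..CARD('n). f j * pairing e (p j)) = (\<Sum>j\<in>{i, l}. f j * pairing e (p j))"
      using i l others by (intro sum.mono_neutral_right) auto
    then show ?thesis using li ei el by simp
  qed
  show "pairing e v = pairing (q l) v - pairing (q i) v" unfolding pairing_expand[of e v] by (rule sum2)
  have "0 \<le> pairing (- e) (p s)" if s: "s \<in> {1..m}" "s \<noteq> l" for s
  proof (cases "s \<in> {1..CARD('n)}")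
    case True
    then show ?thesis using others[of s] s ei by (cases "s = i") (auto simp: pairing_linear)
  next
    case False
    with s have k: "s \<in> {CARD('n)<..m}" by auto
    then have "pairing e (p s) = 0"
      using eq sum2[of "\<lambda>j. int (a s j)"] pairing_late[OF k, of e] by (simp add: col_eq_def)
    then show ?thesis by (simp add: pairing_linear)
  qed
  then have "- e \<in> demazure_roots_at m p l"
    using el by (simp add: demazure_roots_at_def pairing_linear)
  then show "- e \<in> demazure_roots m p" using basis_index[OF l(1)] by (auto simp: demazure_roots_def)
qed

lemma semisimple_iff:
  "e \<in> semisimple_roots m p \<longleftrightarrow> e \<in> demazure_roots m p \<and> - e \<in> demazure_roots m p"
proof -
  have "e \<in> uminus ` demazure_roots m p \<longleftrightarrow> - e \<in> demazure_roots m p"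
  proof
    assume "- e \<in> demazure_roots m p"
    then have "- (- e) \<in> uminus ` demazure_roots m p" by (rule imageI)
    then show "e \<in> uminus ` demazure_roots m p" by simp
  qed auto
  then show ?thesis by (simp add: semisimple_roots_def)
qed

text \<open>
  Triangularity of the positive roots. If \<open>\<langle>e, p\<^sub>l\<rangle> > 0\<close>, then the \<open>i\<close>-th column of \<open>a\<close> dominates the
  \<open>l\<close>-th one. Either this is strict and the numbering puts \<open>i\<close> first, or \<open>e = q\<^sub>l - q\<^sub>i\<close> is semisimple and
  the sign of \<open>\<langle>e, v\<rangle>\<close> decides. Conversely, a triangular semisimple root is \<open>- q\<^sub>i\<close> or \<open>q\<^sub>l - q\<^sub>i\<close> with
  \<open>i < l\<close>, hence positive on \<open>v\<close>.
\<close>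

lemma positive_roots_iff:
  "e \<in> positive_roots m p v \<longleftrightarrow>
    (\<exists>i\<in>{1..CARD('n)}. e \<in> demazure_roots_at m p i \<and>
      (\<forall>l\<in>{1..CARD('n)}. 0 < pairing e (p l) \<longrightarrow> i < l))"
proof
  assume e: "e \<in> positive_roots m p v"
  then have root: "e \<in> demazure_roots m p"
    and pos: "- e \<in> demazure_roots m p \<Longrightarrow> pairing e v > 0"
    by (auto simp: positive_roots_def unipotent_roots_def semisimple_iff)
  then obtain i where i: "i \<in> {1..m}" and ei: "e \<in> demazure_roots_at m p i"
    by (auto simp: demazure_roots_def)
  have i_n: "i \<in> {1..CARD('n)}"
  proof (rule ccontr)
    assume "i \<notin> {1..CARD('n)}"
    with i have k: "i \<in> {CARD('n)<..m}" by auto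
    have "0 \<le> pairing e (p j)" if "j \<in> {1..CARD('n)}" for j
    proof -
      have "j \<in> {1..m} - {i}" using that basis_index[OF that] k by auto
      then show ?thesis using ei unfolding demazure_roots_at_def by blast
    qed
    then have "pairing e v \<le> 0"
      unfolding pairing_expand[of e v] using v_neg by (intro sum_nonpos mult_nonpos_nonneg) (auto simp: less_imp_le)
    then show False using pos[OF root_at_late_semisimple[OF k ei]] by simp
  qed
  have "i < l" if l: "l \<in> {1..CARD('n)}" "0 < pairing e (p l)" for l
  proof -
    have li: "l \<noteq> i" using l ei by (auto simp: demazure_roots_at_def)
    have "a k l \<le> a k i" if k: "k \<in> {CARD('n)<..m}" for k
    proof -
      have "int (a k l) * 1 \<le> int (a k l) * pairing e (p l)"
        using l(2) by (intro mult_left_mono) auto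
      then show ?thesis using root_column_bound_subset[OF i_n ei k, of "{l}"] l li by simp
    qed
    then have ge: "col_ge CARD('n) m a i l" by (simp add: col_ge_def)
    show ?thesis
    proof (cases "col_eq CARD('n) m a i l")
      case False
      then show ?thesis by (rule adapted_less[OF i_n l(1) ge])
    next
      case True
      then have "pairing (q i) v < pairing (q l) v"
        using root_same_column[OF i_n ei l] pos by simp
      then show ?thesis
        using strict_mono_onD[OF v_mono l(1) i_n] li by (meson linorder_neqE_nat less_asym)
    qed
  qed
  with i_n ei show "\<exists>i\<in>{1..CARD('n)}. e \<in> demazure_roots_at m p i \<and>
      (\<forall>l\<in>{1..CARD('n)}. 0 < pairing e (p l) \<longrightarrow> i < l)" by blast
next
  assume "\<exists>i\<in>{1..CARD('n)}. e \<in> demazure_roots_at m p i \<and>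
      (\<forall>l\<in>{1..CARD('n)}. 0 < pairing e (p l) \<longrightarrow> i < l)"
  then obtain i where i: "i \<in> {1..CARD('n)}" and ei: "e \<in> demazure_roots_at m p i"
    and tri: "\<And>l. l \<in> {1..CARD('n)} \<Longrightarrow> 0 < pairing e (p l) \<Longrightarrow> i < l" by blast
  have root: "e \<in> demazure_roots m p" using ei basis_index[OF i] by (auto simp: demazure_roots_def)
  have eii: "pairing e (p i) = -1" using ei by (simp add: demazure_roots_at_def)
  have "pairing e v > 0" if ss: "- e \<in> demazure_roots m p"
  proof -
    obtain l where l: "l \<in> {1..m}" "- e \<in> demazure_roots_at m p l"
      using ss by (auto simp: demazure_roots_def)
    then have el: "pairing e (p l) = 1" by (simp add: demazure_roots_at_def pairing_linear)
    have zero: "pairing e (p j) = 0" if "j \<in> {1..CARD('n)}" "j \<noteq> i" "j \<noteq> l" for j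
      using root_coordinate_nonneg[OF i ei that(1,2)] l(2) basis_index[OF that(1)] that(3)
      by (force simp: demazure_roots_at_def pairing_linear)
    have li: "l \<noteq> i" using el eii by auto
    show ?thesis
    proof (cases "l \<in> {1..CARD('n)}")
      case True
      have "pairing e v = (\<Sum>j\<in>{i, l}. pairing (q j) v * pairing e (p j))"
        unfolding pairing_expand[of e v] using i True zero by (intro sum.mono_neutral_right) auto
      then have "pairing e v = pairing (q l) v - pairing (q i) v" using li el eii by simp
      moreover have "i < l" using tri[OF True] el by simp
      ultimately show ?thesis using strict_mono_onD[OF v_mono i True] by simp
    next
      case False
      have "pairing e v = (\<Sum>j\<in>{i}. pairing (q j) v * pairing e (p j))"
        unfolding pairing_expand[of e v] using i False zero by (intro sum.mono_neutral_right) auto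
      then show ?thesis using eii v_neg i by simp
    qed
  qed
  with root show "e \<in> positive_roots m p v"
    by (auto simp: positive_roots_def unipotent_roots_def semisimple_iff)
qed

definition root_index :: "int ^ 'n \<Rightarrow> nat" where
  "root_index e = (SOME i. i \<in> {1..m} \<and> e \<in> demazure_roots_at m p i)"

lemma root_index_eq:
  assumes "i \<in> {1..m}" "e \<in> demazure_roots_at m p i"
  shows "root_index e = i"
proof -
  have *: "root_index e \<in> {1..m} \<and> e \<in> demazure_roots_at m p (root_index e)"
    unfolding root_index_def
    using someI[of "\<lambda>i. i \<in> {1..m} \<and> e \<in> demazure_roots_at m p i" i] assms by simp
  show ?thesis
  proof (rule ccontr)
    assume "root_index e \<noteq> i"
    then have "i \<in> {1..m} - {root_index e}" using assms(1) by simp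
    moreover have "\<forall>s\<in>{1..m} - {root_index e}. 0 \<le> pairing e (p s)"
      using * by (simp add: demazure_roots_at_def)
    ultimately have "0 \<le> pairing e (p i)" by (rule bspec[rotated])
    then show False using assms(2) by (simp add: demazure_roots_at_def)
  qed
qed

lemma positive_rootD:
  assumes "e \<in> positive_roots m p v"
  shows "root_index e \<in> {1..CARD('n)}" "root_index e \<in> {1..m}" "e \<in> demazure_roots_at m p (root_index e)"
    "\<And>l. l \<in> {1..CARD('n)} \<Longrightarrow> 0 < pairing e (p l) \<Longrightarrow> root_index e < l"
    "pairing e (p (root_index e)) = -1"
    "\<And>l. l \<in> {1..m} \<Longrightarrow> l \<noteq> root_index e \<Longrightarrow> 0 \<le> pairing e (p l)"
proof -
  obtain i where i: "i \<in> {1..CARD('n)}" "e \<in> demazure_roots_at m p i"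
    "\<And>l. l \<in> {1..CARD('n)} \<Longrightarrow> 0 < pairing e (p l) \<Longrightarrow> i < l"
    using assms unfolding positive_roots_iff by (elim bexE conjE) simp
  have [simp]: "root_index e = i" by (rule root_index_eq[OF basis_index[OF i(1)] i(2)])
  show "root_index e \<in> {1..CARD('n)}" "root_index e \<in> {1..m}"
    "e \<in> demazure_roots_at m p (root_index e)"
    "\<And>l. l \<in> {1..CARD('n)} \<Longrightarrow> 0 < pairing e (p l) \<Longrightarrow> root_index e < l"
    "pairing e (p (root_index e)) = -1"
    "\<And>l. l \<in> {1..m} \<Longrightarrow> l \<noteq> root_index e \<Longrightarrow> 0 \<le> pairing e (p l)"
    using i basis_index[OF i(1)] by (auto simp: demazure_roots_at_def)
qed

definition root_degree :: "int ^ 'n \<Rightarrow> int ^ 'n \<Rightarrow> nat" where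
  "root_degree e f = nat (pairing f (p (root_index e)))"

text \<open>
  By triangularity at most one of two roots has a monomial involving the variable of the other.
\<close>

lemma root_degree_pos:
  assumes e: "e \<in> positive_roots m p v" and f: "f \<in> positive_roots m p v" and d: "root_degree e f > 0"
  shows "root_index f < root_index e" "pairing e (p (root_index f)) = 0"
    "pairing f (p (root_index e)) > 0"
    "e + f \<in> positive_roots m p v" "root_index (e + f) = root_index f"
proof -
  let ?i = "root_index e" and ?j = "root_index f"
  show fi: "pairing f (p ?i) > 0" using d by (simp add: root_degree_def)
  then show less: "?j < ?i" using positive_rootD(4)[OF f positive_rootD(1)[OF e]] by simp
  have "\<not> 0 < pairing e (p ?j)"
    using positive_rootD(4)[OF e positive_rootD(1)[OF f]] less by auto
  then show ej: "pairing e (p ?j) = 0"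
    using positive_rootD(6)[OF e positive_rootD(2)[OF f]] less by simp
  have "0 \<le> pairing (e + f) (p s)" if s: "s \<in> {1..m}" "s \<noteq> ?j" for s
  proof (cases "s = ?i")
    case True
    then show ?thesis using fi positive_rootD(5)[OF e] by (simp add: pairing_linear)
  next
    case False
    then show ?thesis
      using positive_rootD(6)[OF e s(1)] positive_rootD(6)[OF f s] by (simp add: pairing_linear)
  qed
  then have at: "e + f \<in> demazure_roots_at m p ?j"
    using ej positive_rootD(5)[OF f] by (simp add: demazure_roots_at_def pairing_linear)
  moreover have "?j < l" if l: "l \<in> {1..CARD('n)}" "0 < pairing (e + f) (p l)" for l
  proof -
    have "0 < pairing e (p l) \<or> 0 < pairing f (p l)" using l(2) by (auto simp: pairing_linear)
    then show ?thesis
      using positive_rootD(4)[OF e l(1)] positive_rootD(4)[OF f l(1)] less by auto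
  qed
  ultimately show "e + f \<in> positive_roots m p v"
    unfolding positive_roots_iff using positive_rootD(1)[OF f] by blast
  show "root_index (e + f) = ?j" by (rule root_index_eq[OF positive_rootD(2)[OF f] at])
qed

lemma sum_positive_root_iff:
  assumes e: "e \<in> positive_roots m p v" and f: "f \<in> positive_roots m p v"
  shows "e + f \<in> positive_roots m p v \<longleftrightarrow> root_degree e f > 0 \<or> root_degree f e > 0"
proof
  assume ef: "e + f \<in> positive_roots m p v"
  let ?i = "root_index e" and ?j = "root_index f"
  show "root_degree e f > 0 \<or> root_degree f e > 0"
  proof (rule ccontr)
    assume "\<not> (root_degree e f > 0 \<or> root_degree f e > 0)"
    then have le: "pairing f (p ?i) \<le> 0" "pairing e (p ?j) \<le> 0" by (auto simp: root_degree_def)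
    have neg: "pairing (e + f) (p s) < 0 \<Longrightarrow> s \<in> {1..m} \<Longrightarrow> s = root_index (e + f)" for s
      using positive_rootD(6)[OF ef, of s] by auto
    have lt: "pairing (e + f) (p ?i) < 0" "pairing (e + f) (p ?j) < 0"
      using le positive_rootD(5)[OF e] positive_rootD(5)[OF f] by (auto simp: pairing_linear)
    have "?i = root_index (e + f)" by (rule neg[OF lt(1) positive_rootD(2)[OF e]])
    moreover have "?j = root_index (e + f)" by (rule neg[OF lt(2) positive_rootD(2)[OF f]])
    ultimately show False
      using positive_rootD(5)[OF e] positive_rootD(5)[OF f] positive_rootD(5)[OF ef]
      by (simp add: pairing_linear)
  qed
next
  assume "root_degree e f > 0 \<or> root_degree f e > 0"
  then show "e + f \<in> positive_roots m p v"
    using root_degree_pos(4)[OF e f] root_degree_pos(4)[OF f e] by (auto simp: add.commute)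
qed

lemma root_degree_sum:
  assumes e: "e \<in> positive_roots m p v"
  shows "root_degree e (e + f) = root_degree e f - 1"
  using positive_rootD(5)[OF e] by (simp add: root_degree_def pairing_linear nat_diff_distrib')

lemma geometric_tail:
  fixes A :: int and n :: nat
  assumes "i \<le> n"
  shows "(\<Sum>j\<in>{i<..n}. A * (A + 1) ^ (n - j)) = (A + 1) ^ (n - i) - 1"
  using assms
proof (induction "n - i" arbitrary: i)
  case (Suc k)
  then have i: "i < n" by simp
  then have "{i<..n} = insert (Suc i) {Suc i<..n}" by auto
  then have "(\<Sum>j\<in>{i<..n}. A * (A + 1) ^ (n - j))
      = A * (A + 1) ^ (n - Suc i) + (\<Sum>j\<in>{Suc i<..n}. A * (A + 1) ^ (n - j))" by simp
  also have "\<dots> = A * (A + 1) ^ (n - Suc i) + ((A + 1) ^ (n - Suc i) - 1)"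
    using Suc by simp
  also have "\<dots> = (A + 1) ^ Suc (n - Suc i) - 1" by (simp add: algebra_simps)
  also have "Suc (n - Suc i) = n - i" using i by simp
  finally show ?case .
qed simp

text \<open>
  By the bounds on the columns no pairing of a positive root with a basis vector exceeds a constant
  \<open>A\<close>. With weights \<open>(A + 1)\<^bsup>n-j\<^esup>\<close> the contribution \<open>-1\<close> of the index of a root therefore outweighs all
  later ones, and by triangularity there are no earlier ones.
\<close>

lemma ex_height:
  obtains h :: "int ^ 'n \<Rightarrow> int" and B :: int
  where "\<And>e f. h (e + f) = h e + h f" "\<And>e. e \<in> positive_roots m p v \<Longrightarrow> 1 \<le> h e \<and> h e \<le> B"
proof -
  define A where "A = (\<Sum>k\<in>{CARD('n)<..m}. \<Sum>j\<in>{1..CARD('n)}. int (a k j))"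
  have A: "int (a k j) \<le> A" if "k \<in> {CARD('n)<..m}" "j \<in> {1..CARD('n)}" for k j
  proof -
    have "int (a k j) \<le> (\<Sum>j\<in>{1..CARD('n)}. int (a k j))"
      using that by (intro member_le_sum[of j _ "\<lambda>j. int (a k j)"]) auto
    also have "\<dots> \<le> A"
      unfolding A_def using that
      by (intro member_le_sum[of k _ "\<lambda>k. \<Sum>j\<in>{1..CARD('n)}. int (a k j)"]) (auto simp: sum_nonneg)
    finally show ?thesis .
  qed
  have A0: "0 \<le> A" by (simp add: A_def sum_nonneg)
  have bound: "pairing e (p l) \<le> A"
    if e: "e \<in> positive_roots m p v" and l: "l \<in> {1..CARD('n)}" "l \<noteq> root_index e" for e l
  proof -
    obtain k where k: "k \<in> {CARD('n)<..m}" "a k l > 0" by (rule column_positive[OF l(1)])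
    have "pairing e (p l) * 1 \<le> pairing e (p l) * int (a k l)"
      using k positive_rootD(6)[OF e basis_index[OF l(1)] l(2)] by (intro mult_left_mono) auto
    also have "\<dots> \<le> int (a k (root_index e))"
      using root_column_bound_subset[OF positive_rootD(1,3)[OF e] k(1), of "{l}"] l by (simp add: mult.commute)
    also have "\<dots> \<le> A" by (rule A[OF k(1) positive_rootD(1)[OF e]])
    finally show ?thesis by simp
  qed
  define wt where "wt j = (A + 1) ^ (CARD('n) - j)" for j
  have wt: "0 \<le> wt j" for j using A0 by (simp add: wt_def)
  define h where "h e = - (\<Sum>j = 1..CARD('n). wt j * pairing e (p j))" for e :: "int ^ 'n"
  show thesis
  proof
    show "h (e + f) = h e + h f" for e f
      by (simp add: h_def pairing_linear distrib_left sum.distrib)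
    fix e assume e: "e \<in> positive_roots m p v"
    let ?i = "root_index e"
    note i = positive_rootD(1)[OF e]
    have split: "h e = wt ?i - (\<Sum>j\<in>{1..CARD('n)} - {?i}. wt j * pairing e (p j))"
      using i positive_rootD(5)[OF e] by (simp add: h_def sum.remove[of "{1..CARD('n)}" ?i] del: One_nat_def)
    have nonneg: "0 \<le> pairing e (p j)" if "j \<in> {1..CARD('n)} - {?i}" for j
      using that positive_rootD(6)[OF e basis_index] by auto
    have "(\<Sum>j\<in>{1..CARD('n)} - {?i}. wt j * pairing e (p j)) = (\<Sum>j\<in>{?i<..CARD('n)}. wt j * pairing e (p j))"
    proof (rule sum.mono_neutral_right)
      show "\<forall>j\<in>{1..CARD('n)} - {?i} - {?i<..CARD('n)}. wt j * pairing e (p j) = 0"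
      proof
        fix j assume j: "j \<in> {1..CARD('n)} - {?i} - {?i<..CARD('n)}"
        then have "\<not> 0 < pairing e (p j)" using positive_rootD(4)[OF e, of j] by auto
        moreover have "0 \<le> pairing e (p j)" using nonneg[of j] j by simp
        ultimately show "wt j * pairing e (p j) = 0" by simp
      qed
    qed (use i in auto)
    also have "\<dots> \<le> (\<Sum>j\<in>{?i<..CARD('n)}. A * (A + 1) ^ (CARD('n) - j))"
    proof (rule sum_mono)
      fix j assume "j \<in> {?i<..CARD('n)}"
      then have "pairing e (p j) \<le> A" using i by (intro bound[OF e]) auto
      then have "wt j * pairing e (p j) \<le> wt j * A" by (rule mult_left_mono[OF _ wt])
      then show "wt j * pairing e (p j) \<le> A * (A + 1) ^ (CARD('n) - j)"
        by (simp add: wt_def mult.commute)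
    qed
    also have "\<dots> = wt ?i - 1" using i by (subst geometric_tail) (auto simp: wt_def)
    finally have "1 \<le> h e" using split by simp
    moreover have "0 \<le> (\<Sum>j\<in>{1..CARD('n)} - {?i}. wt j * pairing e (p j))"
      using nonneg wt by (intro sum_nonneg mult_nonneg_nonneg) auto
    then have "h e \<le> wt ?i" using split by simp
    then have "h e \<le> (A + 1) ^ CARD('n)"
      using A0 power_increasing[of "CARD('n) - ?i" "CARD('n)" "A + 1"] by (simp add: wt_def)
    ultimately show "1 \<le> h e \<and> h e \<le> (A + 1) ^ CARD('n)" by simp
  qed
qed

text \<open>A sum of two roots of height at least \<open>k + 1\<close> has height at least \<open>k + 2\<close>.\<close>

lemma up1_eventually_empty: "\<exists>k. (up1 ^^ k) (positive_roots m p v) = {}"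
proof -
  obtain h and B :: int where h: "\<And>e f. h (e + f) = h e + h f"
    "\<And>e. e \<in> positive_roots m p v \<Longrightarrow> 1 \<le> h e \<and> h e \<le> B"
    by (rule ex_height) (rule that)
  have "e \<in> positive_roots m p v \<and> int k + 1 \<le> h e" if "e \<in> (up1 ^^ k) (positive_roots m p v)" for k e
    using that
  proof (induction k arbitrary: e)
    case (Suc k)
    then obtain b c where "e \<in> (up1 ^^ k) (positive_roots m p v)"
      "b \<in> (up1 ^^ k) (positive_roots m p v)" "c \<in> (up1 ^^ k) (positive_roots m p v)" "e = b + c"
      unfolding funpow.simps comp_def up1_iff by blast
    with Suc.IH[of e] Suc.IH[of b] Suc.IH[of c] h(1)[of b c] show ?case by auto
  qed (use h in auto)
  then have "(up1 ^^ nat B) (positive_roots m p v) = {}" using h(2) by force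
  then show ?thesis by blast
qed

end

section \<open>Commutator relations\<close>

lemma root_monom_other_indep:
  assumes "pairing e (p j) = 0"
  shows "root_monom m p i e (x(j := c)) = root_monom m p i e x"
  unfolding root_monom_def using assms by (intro prod.cong) auto

text \<open>Adding \<open>t e\<close> lowers the exponent of \<open>x\<^sub>i\<close> by \<open>t\<close> and multiplies by the \<open>t\<close>-th power of the monomial
  of \<open>e\<close>, which does not involve \<open>x\<^sub>i\<close> and \<open>x\<^sub>j\<close>.\<close>

lemma root_monom_string:
  fixes x :: "nat \<Rightarrow> 'k::field"
  assumes ij: "i \<in> {1..m}" "j \<in> {1..m}" "i \<noteq> j"
    and e: "e \<in> demazure_roots_at m p i" and f: "f \<in> demazure_roots_at m p j"
    and ej: "pairing e (p j) = 0" and t: "int t \<le> pairing f (p i)"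
  shows "root_monom m p j (f + int t *s e) x
    = x i ^ (nat (pairing f (p i)) - t) * root_monom m p i e x ^ t
        * (\<Prod>s\<in>{1..m} - {i, j}. x s ^ nat (pairing f (p s)))"
proof -
  have remove: "(\<Prod>s\<in>{1..m} - {i}. g s) = g j * (\<Prod>s\<in>{1..m} - {i, j}. g s)"
    "(\<Prod>s\<in>{1..m} - {j}. g s) = g i * (\<Prod>s\<in>{1..m} - {i, j}. g s)" for g :: "nat \<Rightarrow> 'k"
  proof -
    have 1: "{1..m} - {j} - {i} = {1..m} - {i, j}" "{1..m} - {i} - {j} = {1..m} - {i, j}" by auto
    show "(\<Prod>s\<in>{1..m} - {i}. g s) = g j * (\<Prod>s\<in>{1..m} - {i, j}. g s)"
      using prod.remove[of "{1..m} - {i}" j g] ij by (simp only: 1) simp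
    show "(\<Prod>s\<in>{1..m} - {j}. g s) = g i * (\<Prod>s\<in>{1..m} - {i, j}. g s)"
      using prod.remove[of "{1..m} - {j}" i g] ij by (simp only: 1) simp
  qed
  have M: "root_monom m p i e x = (\<Prod>s\<in>{1..m} - {i, j}. x s ^ nat (pairing e (p s)))"
    unfolding root_monom_def remove(1) by (simp add: ej)
  have "root_monom m p j (f + int t *s e) x
      = x i ^ nat (pairing f (p i) - int t)
        * (\<Prod>s\<in>{1..m} - {i, j}. x s ^ nat (pairing f (p s) + int t * pairing e (p s)))"
    unfolding root_monom_def remove(2) pairing_linear using e by (simp add: demazure_roots_at_def)
  also have "(\<Prod>s\<in>{1..m} - {i, j}. x s ^ nat (pairing f (p s) + int t * pairing e (p s)))
      = (\<Prod>s\<in>{1..m} - {i, j}. x s ^ nat (pairing f (p s)) * (x s ^ nat (pairing e (p s))) ^ t)"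
  proof (rule prod.cong)
    fix s assume "s \<in> {1..m} - {i, j}"
    then have "0 \<le> pairing e (p s)" "0 \<le> pairing f (p s)"
      using e f by (auto simp: demazure_roots_at_def)
    then have "nat (pairing f (p s) + int t * pairing e (p s))
        = nat (pairing f (p s)) + nat (pairing e (p s)) * t"
      by (simp add: nat_add_distrib nat_mult_distrib mult.commute)
    then show "x s ^ nat (pairing f (p s) + int t * pairing e (p s))
        = x s ^ nat (pairing f (p s)) * (x s ^ nat (pairing e (p s))) ^ t"
      by (simp add: power_add power_mult)
  qed simp
  also have "nat (pairing f (p i) - int t) = nat (pairing f (p i)) - t" using t by simp
  finally show ?thesis unfolding M by (simp add: prod.distrib prod_power_distrib mult_ac)
qed

lemma string_is_root:
  assumes "i \<in> {1..m}" "j \<in> {1..m}" "i \<noteq> j"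
    and e: "e \<in> demazure_roots_at m p i" and f: "f \<in> demazure_roots_at m p j"
    and ej: "pairing e (p j) = 0" and t: "int t \<le> pairing f (p i)"
  shows "f + int t *s e \<in> demazure_roots_at m p j"
proof -
  have "0 \<le> pairing f (p s) + int t * pairing e (p s)" if s: "s \<in> {1..m} - {j}" for s
  proof (cases "s = i")
    case True
    then show ?thesis using t e by (simp add: demazure_roots_at_def)
  next
    case False
    then show ?thesis using s e f by (auto simp: demazure_roots_at_def)
  qed
  then show ?thesis using f ej by (simp add: demazure_roots_at_def pairing_linear)
qed

lemma binomial_from_second_term:
  fixes y z :: "'k::field_char_0"
  assumes "d \<ge> 1"
  shows "(y + z) ^ d - z ^ d = of_nat d * y * z ^ (d - 1)
    + (\<Sum>t\<in>{2..d}. of_nat (d choose t) * y ^ t * z ^ (d - t))"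
proof -
  have "{..d} = insert 0 (insert 1 {2..d})" using assms by auto
  then show ?thesis by (simp add: binomial_ring)
qed

text \<open>
  The four substitutions compose to \<open>x\<^sub>j \<mapsto> x\<^sub>j + \<beta> ((x\<^sub>i - \<alpha> M)\<^sup>d - x\<^sub>i\<^sup>d) F\<close>, where \<open>M\<close> is the monomial of \<open>e\<close>
  and \<open>x\<^sub>i\<^sup>d F\<close> that of \<open>f\<close>. The binomial formula expands this into the monomials of the roots \<open>f + t e\<close>.
\<close>

lemma root_shift_commutator:
  fixes x :: "nat \<Rightarrow> 'k::field_char_0"
  assumes ij: "i \<in> {1..m}" "j \<in> {1..m}" "i \<noteq> j"
    and e: "e \<in> demazure_roots_at m p i" and f: "f \<in> demazure_roots_at m p j"
    and ej: "pairing e (p j) = 0" and d: "pairing f (p i) = int d" "d \<ge> 1"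
  shows "root_shift m p i e \<alpha> (root_shift m p j f \<beta> (root_shift m p i e (- \<alpha>) (root_shift m p j f (- \<beta>) x)))
    = root_shift m p j (f + e) (- (of_nat d * \<alpha> * \<beta>))
        (x(j := x j + (\<Sum>t\<in>{2..d}. \<beta> * of_nat (d choose t) * (- \<alpha>) ^ t * root_monom m p j (f + int t *s e) x)))"
proof -
  define M where "M = root_monom m p i e x"
  define F where "F = (\<Prod>s\<in>{1..m} - {i, j}. x s ^ nat (pairing f (p s)))"
  have F: "(\<Prod>s\<in>{1..m} - {i, j}. (x(i := c, j := b)) s ^ nat (pairing f (p s))) = F" for b c
    unfolding F_def by (intro prod.cong) auto
  have mf: "root_monom m p j f (x(i := c, j := b)) = c ^ d * F" for b c
    using root_monom_string[OF ij e f ej, of 0 "x(i := c, j := b)"] ij d F by simp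
  have mf': "root_monom m p j f (x(j := b)) = x i ^ d * F" for b
    using mf[of "x i" b] by simp
  have mf'': "root_monom m p j f (x(j := b, i := c)) = c ^ d * F" for b c
    using mf[of c b] ij(3) by (simp add: fun_upd_twist)
  have me: "root_monom m p i e (x(j := b, i := c)) = M" "root_monom m p i e (x(j := b)) = M" for b c
    unfolding M_def by (simp_all add: root_monom_indep root_monom_other_indep[where p = p and e = e and j = j, OF ej])
  have string: "root_monom m p j (f + int t *s e) x = x i ^ (d - t) * M ^ t * F" if "t \<le> d" for t
    using root_monom_string[OF ij e f ej, of t x] that d by (simp add: M_def F_def)
  have fe: "root_monom m p j (f + e) x = x i ^ (d - 1) * M * F"
    using string[of 1] d by simp
  have "root_shift m p j f (- \<beta>) x = x(j := x j - \<beta> * (x i ^ d * F))"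
    using mf'[of "x j"] by (simp add: root_shift_def)
  moreover have "root_shift m p i e (- \<alpha>) (x(j := b)) = x(j := b, i := x i - \<alpha> * M)" for b
    using ij(3) by (simp add: root_shift_def me)
  moreover have "root_shift m p j f \<beta> (x(j := b, i := c)) = x(j := b + \<beta> * (c ^ d * F), i := c)" for b c
    using ij(3) by (simp add: root_shift_def mf mf'' fun_upd_twist)
  moreover have "root_shift m p i e \<alpha> (x(j := b, i := c)) = x(j := b, i := c + \<alpha> * M)" for b c
    by (simp add: root_shift_def me)
  moreover have "x(j := b, i := x i) = x(j := b)" for b
    using ij(3) by (auto simp: fun_eq_iff)
  ultimately have "root_shift m p i e \<alpha> (root_shift m p j f \<beta> (root_shift m p i e (- \<alpha>) (root_shift m p j f (- \<beta>) x)))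
      = x(j := x j + \<beta> * (((- \<alpha> * M) + x i) ^ d - x i ^ d) * F)"
    by (simp add: algebra_simps)
  also have "\<beta> * (((- \<alpha> * M) + x i) ^ d - x i ^ d) * F
      = (- (of_nat d * \<alpha> * \<beta>)) * root_monom m p j (f + e) x
        + (\<Sum>t\<in>{2..d}. \<beta> * of_nat (d choose t) * (- \<alpha>) ^ t * root_monom m p j (f + int t *s e) x)"
  proof -
    have "(\<Sum>t\<in>{2..d}. \<beta> * of_nat (d choose t) * (- \<alpha>) ^ t * root_monom m p j (f + int t *s e) x)
        = \<beta> * (\<Sum>t\<in>{2..d}. of_nat (d choose t) * (- \<alpha> * M) ^ t * x i ^ (d - t)) * F"
      unfolding sum_distrib_left sum_distrib_right
    proof (rule sum.cong)
      fix t assume "t \<in> {2..d}"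
      then show "\<beta> * of_nat (d choose t) * (- \<alpha>) ^ t * root_monom m p j (f + int t *s e) x
          = \<beta> * (of_nat (d choose t) * (- \<alpha> * M) ^ t * x i ^ (d - t)) * F"
        using string[of t] by (simp only: power_mult_distrib mult_ac atLeastAtMost_iff)
    qed simp
    then show ?thesis
      unfolding binomial_from_second_term[OF d(2)] fe by (simp add: algebra_simps)
  qed
  also have "x(j := x j + (- (of_nat d * \<alpha> * \<beta>) * root_monom m p j (f + e) x + S))
      = root_shift m p j (f + e) (- (of_nat d * \<alpha> * \<beta>)) (x(j := x j + S))" for S
    by (simp add: root_shift_def root_monom_indep algebra_simps)
  finally show ?thesis .
qed

context complete_toric
begin

text \<open>Root subgroups changing the same variable compose by adding up their monomials.\<close>

lemma lifted_by_root_sum: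
  assumes j: "j \<in> {1..m}" and T: "finite T" and g: "\<And>t. t \<in> T \<Longrightarrow> g t \<in> demazure_roots_at m p j"
  shows "\<exists>z\<in>generate Aut (\<Union>t\<in>T. range (root_auto j (g t) :: 'k::field_char_0 \<Rightarrow> _)).
    lifted_by z (\<lambda>x. x(j := x j + (\<Sum>t\<in>T. c t * root_monom m p j (g t) x)))"
  using T g
proof (induction T rule: finite_induct)
  case empty
  show ?case by (rule bexI[OF _ generate.one]) (simp add: lifted_by_one)
next
  case (insert t T)
  have "\<exists>z\<in>generate Aut (\<Union>t\<in>T. range (root_auto j (g t) :: 'k \<Rightarrow> _)).
    lifted_by z (\<lambda>x. x(j := x j + (\<Sum>t\<in>T. c t * root_monom m p j (g t) x)))"
    using insert.prems by (intro insert.IH) auto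
  then obtain z where z: "z \<in> generate Aut (\<Union>t\<in>T. range (root_auto j (g t) :: 'k \<Rightarrow> _))"
    "lifted_by z (\<lambda>x. x(j := x j + (\<Sum>t\<in>T. c t * root_monom m p j (g t) x)))"
    by (elim bexE) (rule that; assumption)
  let ?S = "\<Union>t\<in>insert t T. range (root_auto j (g t) :: 'k \<Rightarrow> _)"
  have zS: "z \<in> generate Aut ?S"
    using z(1) by (rule subsetD[OF group.mono_generate[OF group_Aut], rotated]) auto
  have "root_auto j (g t) (c t) \<in> generate Aut ?S" by (rule generate.incl) auto
  then have mem: "root_auto j (g t) (c t) \<otimes>\<^bsub>Aut\<^esub> z \<in> generate Aut ?S" by (rule generate.eng[OF _ zS])
  have eq: "(\<lambda>x. root_shift m p j (g t) (c t) (x(j := x j + (\<Sum>t\<in>T. c t * root_monom m p j (g t) x))))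
      = (\<lambda>x. x(j := x j + (\<Sum>t\<in>insert t T. c t * root_monom m p j (g t) x)))"
    using insert(1,2) by (simp add: root_shift_def root_monom_indep algebra_simps)
  have "lifted_by (root_auto j (g t) (c t)) (root_shift m p j (g t) (c t))"
    using insert.prems by (intro root_auto_lifted[OF j]) auto
  from lifted_by_mult[OF this z(2)]
  have "lifted_by (root_auto j (g t) (c t) \<otimes>\<^bsub>Aut\<^esub> z)
      (\<lambda>x. x(j := x j + (\<Sum>t\<in>insert t T. c t * root_monom m p j (g t) x)))"
    by (simp only: eq)
  with mem show ?case unfolding Bex_def by (intro exI conjI)
qed

lemma root_auto_inv:
  assumes i: "i \<in> {1..m}" "e \<in> demazure_roots_at m p i"
  shows "inv\<^bsub>Aut\<^esub> (root_auto i e \<alpha>) = root_auto i e (- \<alpha>)"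
proof (rule group.inv_equality[OF group_Aut])
  have "root_auto i e (- \<alpha> + \<alpha>) = \<one>\<^bsub>Aut\<^esub>"
    by (rule lifted_by_unique[OF root_auto_lifted[OF i] lifted_by_one]) (simp add: root_shift_zero)
  then show "root_auto i e (- \<alpha>) \<otimes>\<^bsub>Aut\<^esub> root_auto i e \<alpha> = \<one>\<^bsub>Aut\<^esub>"
    by (simp only: root_auto_add[OF i])
qed (use root_auto_lifted[OF i] in \<open>auto simp: lifted_by_def\<close>)

lemma root_auto_commutator:
  fixes \<alpha> \<beta> :: "'k::field_char_0"
  assumes ij: "i \<in> {1..m}" "j \<in> {1..m}" "i \<noteq> j"
    and e: "e \<in> demazure_roots_at m p i" and f: "f \<in> demazure_roots_at m p j"
    and ej: "pairing e (p j) = 0" and d: "pairing f (p i) = int d" "d \<ge> 1"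
  shows "\<exists>z\<in>generate Aut (\<Union>t\<in>{2..d}. range (root_auto j (f + int t *s e) :: 'k \<Rightarrow> _)).
    root_auto i e \<alpha> \<otimes>\<^bsub>Aut\<^esub> root_auto j f \<beta> \<otimes>\<^bsub>Aut\<^esub> inv\<^bsub>Aut\<^esub> (root_auto i e \<alpha>) \<otimes>\<^bsub>Aut\<^esub> inv\<^bsub>Aut\<^esub> (root_auto j f \<beta>)
      = root_auto j (f + e) (- (of_nat d * \<alpha> * \<beta>)) \<otimes>\<^bsub>Aut\<^esub> z"
proof -
  have root: "f + int t *s e \<in> demazure_roots_at m p j" if "t \<le> d" for t
    using d that by (intro string_is_root[OF ij e f ej]) auto
  then have fe: "f + e \<in> demazure_roots_at m p j" using root[of 1] d by simp
  obtain z where z: "z \<in> generate Aut (\<Union>t\<in>{2..d}. range (root_auto j (f + int t *s e) :: 'k \<Rightarrow> _))"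
    "lifted_by z (\<lambda>x. x(j := x j + (\<Sum>t\<in>{2..d}. \<beta> * of_nat (d choose t) * (- \<alpha>) ^ t * root_monom m p j (f + int t *s e) x)))"
    using lifted_by_root_sum[OF ij(2), of "{2..d}" "\<lambda>t. f + int t *s e"
        "\<lambda>t. \<beta> * of_nat (d choose t) * (- \<alpha>) ^ t"] root by auto
  note E = root_auto_lifted[OF ij(1) e] and F = root_auto_lifted[OF ij(2) f]
  have "root_auto i e \<alpha> \<otimes>\<^bsub>Aut\<^esub> root_auto j f \<beta> \<otimes>\<^bsub>Aut\<^esub> root_auto i e (- \<alpha>) \<otimes>\<^bsub>Aut\<^esub> root_auto j f (- \<beta>)
      = root_auto j (f + e) (- (of_nat d * \<alpha> * \<beta>)) \<otimes>\<^bsub>Aut\<^esub> z"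
    by (rule lifted_by_unique[OF lifted_by_mult[OF lifted_by_mult[OF lifted_by_mult[OF E F] E] F]
          lifted_by_mult[OF root_auto_lifted[OF ij(2) fe] z(2)]])
       (rule root_shift_commutator[OF ij e f ej d])
  with z(1) show ?thesis unfolding root_auto_inv[OF ij(1) e] root_auto_inv[OF ij(2) f] by blast
qed

lemma root_auto_commute:
  assumes i: "i \<in> {1..m}" "e \<in> demazure_roots_at m p i" and j: "j \<in> {1..m}" "f \<in> demazure_roots_at m p j"
    and ij: "i = j \<or> pairing e (p j) = 0 \<and> pairing f (p i) = 0"
  shows "root_auto i e \<alpha> \<otimes>\<^bsub>Aut\<^esub> root_auto j f \<beta> = root_auto j f \<beta> \<otimes>\<^bsub>Aut\<^esub> root_auto i e \<alpha>"
proof (rule lifted_by_unique[OF lifted_by_mult lifted_by_mult])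
  note E = root_auto_lifted[OF i] and F = root_auto_lifted[OF j]
  show "lifted_by (root_auto i e \<alpha>) (root_shift m p i e \<alpha>)" "lifted_by (root_auto j f \<beta>) (root_shift m p j f \<beta>)"
    "lifted_by (root_auto j f \<beta>) (root_shift m p j f \<beta>)" "lifted_by (root_auto i e \<alpha>) (root_shift m p i e \<alpha>)"
    by (rule E F)+
  fix x :: "nat \<Rightarrow> 'a"
  have m1: "root_monom m p i e (x(j := c)) = root_monom m p i e x" for c
    using ij by (auto simp: root_monom_indep root_monom_other_indep)
  have m2: "root_monom m p j f (x(i := c)) = root_monom m p j f x" for c
    using ij by (auto simp: root_monom_indep root_monom_other_indep)
  show "root_shift m p i e \<alpha> (root_shift m p j f \<beta> x) = root_shift m p j f \<beta> (root_shift m p i e \<alpha> x)"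
    unfolding root_shift_def m1 m2 by (auto simp: fun_eq_iff)
qed

end

context radiant_toric
begin

definition positive_root_auto :: "int ^ 'n \<Rightarrow> 'k::field_char_0 \<Rightarrow> ('n, 'k) tpoint \<Rightarrow> ('n, 'k) tpoint" where
  "positive_root_auto e = root_auto (root_index e) e"

lemma root_group_Aut:
  "root_group (Aut :: (('n, 'k::field_char_0) tpoint \<Rightarrow> ('n, 'k) tpoint) monoid)
     (positive_roots m p v) positive_root_auto root_degree"
proof (intro root_group.intro group_Aut root_group_axioms.intro)
  fix e f :: "int ^ 'n" and \<alpha> \<beta> :: 'k
  let ?R = "positive_roots m p v"
  assume e: "e \<in> ?R"
  note e_at = positive_rootD(2,3)[OF e]
  show "positive_root_auto e \<alpha> \<in> carrier Aut"
    using root_auto_lifted[OF e_at, of \<alpha>] by (simp add: lifted_by_def positive_root_auto_def)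
  show "positive_root_auto e (\<alpha> + \<beta>) = positive_root_auto e \<alpha> \<otimes>\<^bsub>Aut\<^esub> positive_root_auto e \<beta>"
    unfolding positive_root_auto_def by (rule root_auto_add[OF e_at])
  show "positive_root_auto e (1 :: 'k) \<noteq> \<one>\<^bsub>Aut\<^esub>"
    unfolding positive_root_auto_def by (rule root_auto_nontrivial[OF e_at])
  assume f: "f \<in> ?R"
  note f_at = positive_rootD(2,3)[OF f]
  show "e + f \<in> ?R \<longleftrightarrow> root_degree e f > 0 \<or> root_degree f e > 0"
    by (rule sum_positive_root_iff[OF e f])
  show "root_degree e (e + f) = root_degree e f - 1" by (rule root_degree_sum[OF e])
  show "positive_root_auto e \<alpha> \<otimes>\<^bsub>Aut\<^esub> positive_root_auto f \<beta> = positive_root_auto f \<beta> \<otimes>\<^bsub>Aut\<^esub> positive_root_auto e \<alpha>"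
    if nsum: "e + f \<notin> ?R"
    unfolding positive_root_auto_def
  proof (rule root_auto_commute[OF e_at f_at])
    have "pairing f (p (root_index e)) \<le> 0" "pairing e (p (root_index f)) \<le> 0"
      using nsum sum_positive_root_iff[OF e f] by (auto simp: root_degree_def)
    then show "root_index e = root_index f \<or>
        pairing e (p (root_index f)) = 0 \<and> pairing f (p (root_index e)) = 0"
      using positive_rootD(6)[OF e f_at(1)] positive_rootD(6)[OF f e_at(1)] by auto
  qed
  assume d: "root_degree e f > 0"
  note deg = root_degree_pos[OF e f d]
  have d': "pairing f (p (root_index e)) = int (root_degree e f)" "root_degree e f \<ge> 1"
    using deg(3) d by (auto simp: root_degree_def)
  have index: "root_index (f + int t *s e) = root_index f" if "t \<le> root_degree e f" for t
    using that d' deg(1)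
    by (intro root_index_eq[OF f_at(1)] string_is_root[OF e_at(1) f_at(1) _ e_at(2) f_at(2) deg(2)]) auto
  have fe: "root_index (f + e) = root_index f" using index[of 1] d' by simp
  have "(\<Union>t\<in>{2..root_degree e f}. range (positive_root_auto (f + int t *s e) :: 'k \<Rightarrow> _))
      = (\<Union>t\<in>{2..root_degree e f}. range (root_auto (root_index f) (f + int t *s e)))"
    using index by (auto simp: positive_root_auto_def)
  moreover have "root_index e \<noteq> root_index f" using deg(1) by simp
  ultimately show "\<exists>z\<in>generate Aut (\<Union>t\<in>{2..root_degree e f}. range (positive_root_auto (f + int t *s e))).
      positive_root_auto e \<alpha> \<otimes>\<^bsub>Aut\<^esub> positive_root_auto f \<beta> \<otimes>\<^bsub>Aut\<^esub> inv\<^bsub>Aut\<^esub> (positive_root_auto e \<alpha>)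
        \<otimes>\<^bsub>Aut\<^esub> inv\<^bsub>Aut\<^esub> (positive_root_auto f \<beta>)
      = positive_root_auto (f + e) (- (of_nat (root_degree e f) * \<alpha> * \<beta>)) \<otimes>\<^bsub>Aut\<^esub> z"
    using root_auto_commutator[OF e_at(1) f_at(1) _ e_at(2) f_at(2) deg(2) d', of \<alpha> \<beta>]
    by (simp add: positive_root_auto_def fe)
qed

end

text \<open>The derived series does not depend on the ambient group.\<close>

lemma (in group) derived_series_in_subgroup:
  assumes "subgroup H G"
  shows "(derived (G\<lparr>carrier := H\<rparr>) ^^ k) H = (derived G ^^ k) H"
proof -
  have sub: "(derived G ^^ k) H \<subseteq> H" for k
  proof (induction k)
    case (Suc k)
    show ?case using derived_incl[OF Suc assms] by simp
  qed simp
  show ?thesis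
  proof (induction k)
    case (Suc k)
    show ?case using derived_consistent[OF sub[of k] assms] by (simp add: Suc)
  qed simp
qed

section \<open>The derived length of the maximal unipotent subgroup\<close>

context radiant_toric
begin

lemma U_max_derived_series:
  fixes U :: "(('n, 'k::field_char_0) tpoint \<Rightarrow> ('n, 'k) tpoint) monoid"
  assumes U: "U = U_max \<Sigma> m p v"
  shows "group U" "(derived U ^^ k) (carrier U) = {\<one>\<^bsub>U\<^esub>} \<longleftrightarrow> (up1 ^^ k) (positive_roots m p v) = {}"
proof -
  interpret root_group "Aut :: (('n, 'k) tpoint \<Rightarrow> ('n, 'k) tpoint) monoid"
    "positive_roots m p v" positive_root_auto root_degree by (rule root_group_Aut)
  have "(\<Union>e\<in>positive_roots m p v. root_subgroup \<Sigma> m p e)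
      = (\<Union>e\<in>positive_roots m p v. range (positive_root_auto e :: 'k \<Rightarrow> _))"
    using root_subgroup_eq[OF positive_rootD(2,3)] by (intro SUP_cong) (auto simp: positive_root_auto_def)
  moreover have "(\<Union>e\<in>positive_roots m p v. range (positive_root_auto e :: 'k \<Rightarrow> _)) \<subseteq> carrier Aut"
    by (rule generators_closed) simp
  ultimately have gen: "U = Aut\<lparr>carrier := root_span (positive_roots m p v)\<rparr>"
    by (simp add: U U_max_def subgroup_generated_def root_span_def Int_absorb1)
  have H: "subgroup (root_span (positive_roots m p v)) Aut" by (rule subgroup_root_span) simp
  then show "group U" unfolding gen by (rule subgroup.subgroup_is_group) (rule group_Aut)
  have "closed_roots (positive_roots m p v)" by (auto simp: closed_roots_def)
  from derived_series_trivial_iff[OF this, of k]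
  show "(derived U ^^ k) (carrier U) = {\<one>\<^bsub>U\<^esub>} \<longleftrightarrow> (up1 ^^ k) (positive_roots m p v) = {}"
    by (simp add: gen derived_series_in_subgroup[OF H])
qed

end

theorem corollary5p8:
  fixes \<Sigma> :: "(real ^ 'n) set set"
    and m :: nat
    and p q :: "nat \<Rightarrow> int ^ 'n"
    and a :: "nat \<Rightarrow> nat \<Rightarrow> nat"
    and v :: "int ^ 'n"
    and U :: "(('n, 'k::{alg_closed_field, field_char_0}) tpoint \<Rightarrow> ('n, 'k) tpoint) monoid"
  assumes "complete_fan \<Sigma>"
    and "bilateral_numbering \<Sigma> m p a"
    and "dual_basis p q"
    and "adapted_numbering CARD('n) m a"
    and "strict_mono_on {1..CARD('n)} (\<lambda>i. pairing (q i) v)"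
    and "\<forall>i\<in>{1..CARD('n)}. pairing (q i) v < 0"
    and "U = U_max \<Sigma> m p v"
  shows "solvable U \<and>
    (\<exists>k. (up1 ^^ k) (positive_roots m p v) = {}) \<and>
    derived_length U = (LEAST k. (up1 ^^ k) (positive_roots m p v) = {})"
proof -
  interpret radiant_toric \<Sigma> m p q a v
    using assms(1-6) by unfold_locales (simp_all add: bilateral_numbering_def)
  note U = U_max_derived_series[OF assms(7)]
  obtain k where k: "(up1 ^^ k) (positive_roots m p v) = {}" using up1_eventually_empty by blast
  interpret U: group U by (rule U(1))
  have "solvable U"
    unfolding solvable_def using U.trivial_derived_seq_imp_solvable[OF U.subgroup_self] k U(2) by blast
  moreover have "derived_length U = (LEAST k. (up1 ^^ k) (positive_roots m p v) = {})"
    unfolding derived_length_def U(2) ..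
  ultimately show ?thesis using k by blast
qed

end
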